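(* Consider the spectral problem $$\lambda v=\big(\partial_x^n+a_1(x)\partial_x^{n-1}+\cdots+a_n(x)\big)v,\qquad\lambda\in\mathbb{C},$$ where $a_k(x)$, $k=1,2,\dots,n$, are real-valued smooth functions on $\mathbb{R}$ satisfying $a_k(x+T)=a_k(x)$ for some $T>0$. Let $p(\mu,\lambda)$ be the characteristic polynomial of the associated monodromy matrix and $\Phi_n(\lambda)=\operatorname{res}_\mu\big(p(\mu,\lambda),p_\lambda(\mu,\lambda)\big)$. For $n$ odd, there exist only finitely many zeros of $\Phi_n(\lambda)$ with $\lambda\in i\mathbb{R}$. Consequently, there are only finitely many points along the imaginary axis where the $L^2(\mathbb{R})$ essential spectrum of the spectral problem $\lambda v=\big(\partial_x^n+a_1(x)\partial_x^{n-1}+\cdots+a_n(x)\big)v$ bifurcates away from the axis in a transversal manner.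
   Context: Monodromy matrix: write the equation as a first-order system $\mathbf{v}_x=\mathbf{A}(x,\lambda)\mathbf{v}$ for $\mathbf{v}=(v,v_x,\dots,\partial_x^{n-1}v)^\top$; let $\mathbf{V}_x=\mathbf{A}(x,\lambda)\mathbf{V}$, $\mathbf{V}(0,\lambda)=\mathbf{I}_n$ (identity matrix), and $\mathbf{M}(\lambda)=\mathbf{V}(T,\lambda)$. Its characteristic polynomial is $p(\mu,\lambda)=\det(\mathbf{M}(\lambda)-\mu\mathbf{I}_n)$; $p_\lambda=\partial p/\partial\lambda$, and $\operatorname{res}_\mu$ denotes the resultant of two polynomials in $\mu$ (here it vanishes iff they have a common root). Spectrum: by Floquet theory the $L^2(\mathbb{R})$ essential spectrum is $\{\lambda\in\mathbb{C}:p(\mu,\lambda)=0\text{ for some }|\mu|=1\}$. Bifurcation: the spectrum bifurcates at $\lambda_0\in i\mathbb{R}$ away from the imaginary axis in a transversal manner if, in addition to a nondegenerate segment of $i\mathbb{R}$ containing $\lambda_0$ that lies in the spectrum, there is a curve of spectrum emanating from $\lambda_0$ into $\mathbb{C}\setminus i\mathbb{R}$ that is not tangent to $i\mathbb{R}$ at $\lambda_0$. *)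

theory Defs
  imports "HOL-Analysis.Analysis" "Subresultants.Resultant_Prelim"
begin

definition smooth_real :: "(real \<Rightarrow> real) \<Rightarrow> bool" where
  "smooth_real f \<longleftrightarrow> (\<forall>m x. (deriv ^^ m) f differentiable at x)"

text \<open>
  Companion matrix of \<open>lam v = v\<^sup>(\<^sup>n\<^sup>) + a\<^sub>1(x) v\<^sup>(\<^sup>n\<^sup>-\<^sup>1\<^sup>) + \<dots> + a\<^sub>n(x) v\<close> for the vector
  \<open>(v, v', \<dots>, v\<^sup>(\<^sup>n\<^sup>-\<^sup>1\<^sup>))\<close>.  Indices start at 0, so column \<open>j\<close> belongs to the \<open>j\<close>-th derivative,
  whose coefficient in the equation is \<open>a (n - j)\<close>.
\<close>

definition companion_mat ::
    "nat \<Rightarrow> (nat \<Rightarrow> real \<Rightarrow> real) \<Rightarrow> real \<Rightarrow> complex \<Rightarrow> complex Matrix.mat" where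
  "companion_mat n a x lam = Matrix.mat n n (\<lambda>(i, j).
     if Suc i < n then (if j = Suc i then 1 else 0)
     else (if j = 0 then lam else 0) - complex_of_real (a (n - j) x))"

text \<open>
  \<open>V\<close> solves \<open>V\<^sub>x = A(x,lam) V\<close>, \<open>V(0) = I\<close> on the whole line.  The system is linear with continuous
  coefficients, so exactly one such \<open>V\<close> exists.
\<close>

definition principal_solution ::
    "nat \<Rightarrow> (nat \<Rightarrow> real \<Rightarrow> real) \<Rightarrow> complex \<Rightarrow> (real \<Rightarrow> complex Matrix.mat) \<Rightarrow> bool" where
  "principal_solution n a lam V \<longleftrightarrow>
     (\<forall>x. V x \<in> carrier_mat n n) \<and>
     V 0 = 1\<^sub>m n \<and>
     (\<forall>x. \<forall>i<n. \<forall>j<n.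
        ((\<lambda>y. V y $$ (i, j)) has_vector_derivative (companion_mat n a x lam * V x) $$ (i, j)) (at x))"

text \<open>
  From here on \<open>M\<close> is the map from \<open>lam\<close> to the monodromy matrix.  The polynomial variable is \<open>\<mu>\<close>, and
  \<open>char_pol n M lam\<close> is \<open>det (M(lam) - \<mu> I)\<close>, with leading coefficient
  \<open>(-1)\<^sup>n\<close>.
\<close>

definition char_pol :: "nat \<Rightarrow> (complex \<Rightarrow> complex Matrix.mat) \<Rightarrow> complex \<Rightarrow> complex poly" where
  "char_pol n M lam = Determinant.det (map_mat (\<lambda>c. [:c:]) (M lam) - [:0, 1:] \<cdot>\<^sub>m 1\<^sub>m n)"

text \<open>
  The partial derivative with respect to \<open>lam\<close>, again as a polynomial in \<open>\<mu>\<close>: the coefficients are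
  differentiated.
\<close>

definition char_pol_dlam :: "nat \<Rightarrow> (complex \<Rightarrow> complex Matrix.mat) \<Rightarrow> complex \<Rightarrow> complex poly" where
  "char_pol_dlam n M lam = (\<Sum>i\<le>n. Polynomial.monom (deriv (\<lambda>l. poly.coeff (char_pol n M l) i) lam) i)"

text \<open>
  The resultant is the Sylvester determinant for the actual degrees at \<open>lam\<close>.  Since the leading
  coefficient of \<^const>\<open>char_pol\<close> is \<open>1\<close> or \<open>-1\<close>, a drop in the degree of the derivative changes at most
  the sign, so the zeros of \<open>Phi\<close> do not depend on this choice.
\<close>

definition Phi :: "nat \<Rightarrow> (complex \<Rightarrow> complex Matrix.mat) \<Rightarrow> complex \<Rightarrow> complex" where
  "Phi n M lam = resultant (char_pol n M lam) (char_pol_dlam n M lam)"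

text \<open>
  The essential spectrum on \<open>L\<^sup>2(\<real>)\<close> of the periodic problem, as described by Floquet theory: there is a
  Floquet multiplier on the unit circle.
\<close>

definition ess_spectrum :: "nat \<Rightarrow> (complex \<Rightarrow> complex Matrix.mat) \<Rightarrow> complex set" where
  "ess_spectrum n M = {lam. \<exists>\<mu>. norm \<mu> = 1 \<and> poly (char_pol n M lam) \<mu> = 0}"

abbreviation imag_axis :: "complex set" where
  "imag_axis \<equiv> {z. Re z = 0}"

text \<open>
  The curve \<open>\<gamma>\<close> is tangent to the imaginary axis at its start point: the direction of the secant from
  the start point becomes vertical in the limit.
\<close>

definition tangent_imag_axis_at_start :: "(real \<Rightarrow> complex) \<Rightarrow> bool" where
  "tangent_imag_axis_at_start \<gamma> \<longleftrightarrow>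
     ((\<lambda>t. Re (\<gamma> t - \<gamma> 0) / norm (\<gamma> t - \<gamma> 0)) \<longlongrightarrow> 0) (at_right 0)"

definition bifurcates_transversally :: "complex set \<Rightarrow> complex \<Rightarrow> bool" where
  "bifurcates_transversally S lam0 \<longleftrightarrow>
     lam0 \<in> imag_axis \<and>
     (\<exists>b c. b \<noteq> c \<and> lam0 \<in> closed_segment b c \<and> closed_segment b c \<subseteq> S \<inter> imag_axis) \<and>
     (\<exists>\<gamma>. path \<gamma> \<and> pathstart \<gamma> = lam0 \<and> path_image \<gamma> \<subseteq> S \<and>
          (\<forall>t\<in>{0<..1}. \<gamma> t \<notin> imag_axis) \<and>
          \<not> tangent_imag_axis_at_start \<gamma>)"

end

theory Submission
  imports Defs "HOL-Complex_Analysis.Complex_Analysis" "HOL-Real_Asymp.Real_Asymp"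
    "HOL-Computational_Algebra.Field_as_Ring" "Jordan_Normal_Form.Schur_Decomposition"
    "Subresultants.Subresultant_Gcd"
begin

text \<open>
  The proof follows the multipliers, that is, the roots \<open>\<mu>\<close> of the characteristic polynomial
  \<open>p(\<mu>, \<lambda>)\<close> of the monodromy matrix, whose entries are entire functions of \<open>\<lambda>\<close>
  (\<open>solution_holomorphic_in_parameter\<close>).

  \<^bold>\<open>High frequency.\<close> Let \<open>\<kappa>\<^sub>0, \<dots>, \<kappa>\<^sub>n\<^sub>-\<^sub>1\<close> be the \<open>n\<close>-th roots of \<open>\<lambda>\<close>. In the coordinates
  \<open>w\<^sub>k = (1/n) \<Sum>\<^sub>m \<kappa>\<^sub>k\<^sup>-\<^sup>m v\<^sup>(\<^sup>m\<^sup>)\<close> the equation takes the form \<open>w\<^sub>k' = \<kappa>\<^sub>k w\<^sub>k + O(max |w|)\<close> with a constant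
  that does not depend on \<open>\<lambda>\<close> (\<open>nearly_diagonal_mode_coord\<close>). Consider a solution with
  \<open>w(x + T) = \<mu> w(x)\<close> and put \<open>\<nu> = ln |\<mu>| / T\<close>. At a point where the largest of the periodic functions
  \<open>|w\<^sub>k|\<^sup>2 exp(-2\<nu>x)\<close> has its maximum the derivative vanishes, which gives \<open>|\<nu> - Re \<kappa>\<^sub>k| \<le> C\<close>
  (\<open>floquet_exponent_near_diagonal\<close>). The same maximum principle on the whole line, with the weight
  \<open>exp(-2\<nu>x - 2D|x|)\<close>, shows that only one multiplier, counted with multiplicity, can belong to a given
  \<open>\<kappa>\<^sub>k\<close> that is separated from the others in real part (\<open>no_two_multipliers_near_one_exponent\<close>).
  Two different \<open>n\<close>-th roots of a nonreal number never have the same real part, and by scaling the gaps are of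
  order \<open>|\<lambda>|\<^sup>1\<^sup>/\<^sup>n\<close> in discs around \<open>is\<close> with radius proportional to \<open>|s|\<close>. For large \<open>|s|\<close> there is thus
  exactly one multiplier \<open>\<mu>\<^sub>k(\<lambda>)\<close> for each \<open>k\<close>, and it is simple and holomorphic in \<open>\<lambda>\<close>. The function
  \<open>\<mu>\<^sub>k exp(-\<kappa>\<^sub>k T)\<close> is bounded above and below in modulus, so Cauchy's inequality makes its logarithmic derivative
  \<open>O(1/|\<lambda>|)\<close>, whereas \<open>\<kappa>\<^sub>k' T\<close> has size \<open>|\<lambda>|\<^sup>1\<^sup>/\<^sup>n T / (n |\<lambda>|)\<close>. Hence \<open>\<mu>\<^sub>k' \<noteq> 0\<close>, which says
  that \<open>p\<close> and \<open>p\<^sub>\<lambda>\<close> have no common root (\<open>large_imaginary_axis\<close>). Common roots of \<open>p\<close> and \<open>p\<^sub>\<lambda>\<close> occur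
  at the zeros of an entire function, the product of \<open>p\<^sub>\<lambda>\<close> over the roots of \<open>p\<close>, and an entire function
  that is not identically zero has finitely many zeros on a compact part of the axis.

  \<^bold>\<open>Bifurcation.\<close> Let \<open>q(\<mu>, \<lambda>)\<close> be the polynomial \<open>\<mu>\<^sup>n cnj (p(1 / cnj \<mu>, - cnj \<lambda>))\<close>. On the
  imaginary axis a unimodular multiplier is a common root of \<open>p\<close> and \<open>q\<close>. The number of common roots is
  constant off the zeros of a further entire function (\<open>common_root_count\<close>). Near any other
  point of the axis where the multipliers are simple, a unimodular multiplier \<open>\<mu>\<close> therefore continues
  to be a root of \<open>q\<close>, and this means \<open>\<mu>(- cnj \<lambda>) cnj (\<mu>(\<lambda>)) = 1\<close>. If in addition \<open>\<mu>' \<noteq> 0\<close>, then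
  \<open>\<mu>\<close> is injective and \<open>|\<mu>(\<lambda>)| = 1\<close> forces \<open>\<lambda> = - cnj \<lambda>\<close>: there is no spectrum off the axis nearby
  (\<open>spectrum_on_axis_near_generic_point\<close>). This leaves finitely many points in each bounded part of the axis.
  For large \<open>|\<lambda>|\<close> at most one multiplier is unimodular, so along a segment of the axis contained in
  the spectrum it stays unimodular, and the identity theorem gives the same reflection identity
  (\<open>spectrum_on_axis_near_segment_point\<close>).
\<close>

section \<open>The linear system: a priori bounds and dependence on the parameter\<close>

text \<open>
  Solutions are treated one at a time, as families of scalar functions indexed by the order of the
  derivative: linear combinations, sums and shifts are then formed without matrix algebra.
\<close>

abbreviation companion_apply ::
    "nat \<Rightarrow> (nat \<Rightarrow> real \<Rightarrow> real) \<Rightarrow> real \<Rightarrow> complex \<Rightarrow> (nat \<Rightarrow> complex) \<Rightarrow> nat \<Rightarrow> complex" where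
  "companion_apply n a x l v i \<equiv> \<Sum>j<n. companion_mat n a x l $$ (i, j) * v j"

definition solves :: "nat \<Rightarrow> (nat \<Rightarrow> real \<Rightarrow> real) \<Rightarrow> complex \<Rightarrow> (real \<Rightarrow> nat \<Rightarrow> complex) \<Rightarrow> bool" where
  "solves n a lam v \<longleftrightarrow> (\<forall>x. \<forall>i<n. ((\<lambda>y. v y i) has_vector_derivative
      companion_apply n a x lam (v x) i) (at x))"

lemma solvesD:
  "solves n a lam v \<Longrightarrow> i < n \<Longrightarrow> ((\<lambda>y. v y i) has_vector_derivative
      companion_apply n a x lam (v x) i) (at x)"
  unfolding solves_def by blast

lemma norm_square_has_derivative:
  fixes f :: "real \<Rightarrow> complex"
  assumes "(f has_vector_derivative d) (at x)"
  shows "((\<lambda>y. (norm (f y))\<^sup>2) has_real_derivative 2 * Re (cnj (f x) * d)) (at x)"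
proof -
  have dRe: "((\<lambda>y. Re (f y)) has_real_derivative Re d) (at x)"
    using bounded_linear.has_vector_derivative[OF bounded_linear_Re assms]
    by (simp add: has_real_derivative_iff_has_vector_derivative)
  have dIm: "((\<lambda>y. Im (f y)) has_real_derivative Im d) (at x)"
    using bounded_linear.has_vector_derivative[OF bounded_linear_Im assms]
    by (simp add: has_real_derivative_iff_has_vector_derivative)
  show ?thesis
    unfolding cmod_power2 by (rule derivative_eq_intros dRe dIm refl | simp add: algebra_simps)+
qed

text \<open>
  Adding \<open>G\<^sup>2\<close> to the sum of squares absorbs the inhomogeneous term: with
  \<open>K = (2L + 1)n + 1\<close> the function \<open>(sum + G\<^sup>2) exp(-Kx)\<close> is nonincreasing.
\<close>

lemma gronwall_sum_squares:
  fixes u u' :: "real \<Rightarrow> nat \<Rightarrow> complex"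
  assumes X: "X \<ge> 0" and L: "L \<ge> 0" and G: "G \<ge> 0"
    and der: "\<And>x i. x \<in> {0..X} \<Longrightarrow> i < n \<Longrightarrow> ((\<lambda>y. u y i) has_vector_derivative u' x i) (at x)"
    and bd: "\<And>x i. x \<in> {0..X} \<Longrightarrow> i < n \<Longrightarrow> norm (u' x i) \<le> L * (\<Sum>j<n. norm (u x j)) + G"
  shows "(\<Sum>i<n. (norm (u X i))\<^sup>2) + G\<^sup>2
           \<le> ((\<Sum>i<n. (norm (u 0 i))\<^sup>2) + G\<^sup>2) * exp (((2 * L + 1) * n + 1) * X)"
proof -
  define K where "K = (2 * L + 1) * n + 1"
  have K: "K \<ge> 1" using L by (simp add: K_def)
  define \<phi> where "\<phi> = (\<lambda>x. \<Sum>i<n. (norm (u x i))\<^sup>2)"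
  define d where "d = (\<lambda>x. \<Sum>i<n. 2 * Re (cnj (u x i) * u' x i))"
  have d: "(\<phi> has_real_derivative d x) (at x)" if x: "x \<in> {0..X}" for x
    unfolding \<phi>_def d_def using norm_square_has_derivative[OF der[OF x]] by (intro DERIV_sum) simp
  have dle: "d x \<le> K * \<phi> x + G\<^sup>2" if x: "x \<in> {0..X}" for x
  proof -
    define s where "s = (\<Sum>i<n. norm (u x i))"
    have s0: "s \<ge> 0" by (simp add: s_def sum_nonneg)
    have s2: "s\<^sup>2 \<le> n * \<phi> x"
      using sum_squared_le_sum_of_squares[of "\<lambda>i. norm (u x i)" "{..<n}"] by (simp add: s_def \<phi>_def mult.commute)
    have "d x \<le> (\<Sum>i<n. 2 * (norm (u x i) * (L * s + G)))"
      unfolding d_def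
    proof (rule sum_mono)
      fix i assume i: "i \<in> {..<n}"
      have "Re (cnj (u x i) * u' x i) \<le> norm (u x i) * norm (u' x i)"
        by (metis complex_Re_le_cmod complex_mod_cnj norm_mult)
      also have "\<dots> \<le> norm (u x i) * (L * s + G)"
        using bd[OF x, of i] i by (intro mult_left_mono) (auto simp: s_def)
      finally show "2 * Re (cnj (u x i) * u' x i) \<le> 2 * (norm (u x i) * (L * s + G))" by simp
    qed
    also have "\<dots> = 2 * L * s\<^sup>2 + 2 * G * s"
      by (simp add: s_def power2_eq_square algebra_simps flip: sum_distrib_left sum_distrib_right)
    also have "2 * G * s \<le> G\<^sup>2 + s\<^sup>2" using sum_squares_bound[of G s] by simp
    also have "2 * L * s\<^sup>2 + (G\<^sup>2 + s\<^sup>2) = (2 * L + 1) * s\<^sup>2 + G\<^sup>2" by (simp add: algebra_simps)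
    also have "(2 * L + 1) * s\<^sup>2 \<le> (2 * L + 1) * (n * \<phi> x)"
      using s2 L by (intro mult_left_mono) auto
    also have "\<dots> \<le> K * \<phi> x"
      by (simp add: K_def \<phi>_def algebra_simps sum_nonneg)
    finally show ?thesis by simp
  qed
  define \<psi> where "\<psi> = (\<lambda>x. (\<phi> x + G\<^sup>2) * exp (- K * x))"
  have "\<psi> X \<le> \<psi> 0"
  proof (rule DERIV_nonpos_imp_nonincreasing[OF X])
    fix x assume "0 \<le> x" "x \<le> X"
    then have x: "x \<in> {0..X}" by simp
    have "(\<psi> has_real_derivative (d x - K * (\<phi> x + G\<^sup>2)) * exp (- K * x)) (at x)"
      unfolding \<psi>_def by (rule derivative_eq_intros d[OF x] refl | simp add: algebra_simps)+
    moreover have "d x \<le> K * (\<phi> x + G\<^sup>2)"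
    proof -
      have "1 * G\<^sup>2 \<le> K * G\<^sup>2" using K by (intro mult_right_mono) auto
      then show ?thesis using dle[OF x] by (simp add: algebra_simps)
    qed
    then have "(d x - K * (\<phi> x + G\<^sup>2)) * exp (- K * x) \<le> 0" by (simp add: mult_nonpos_nonneg)
    ultimately show "\<exists>y. (\<psi> has_real_derivative y) (at x) \<and> y \<le> 0" by blast
  qed
  then have "(\<phi> X + G\<^sup>2) * exp (- K * X) * exp (K * X) \<le> (\<phi> 0 + G\<^sup>2) * exp (K * X)"
    unfolding \<psi>_def by (intro mult_right_mono) auto
  moreover have "exp (- K * X) * exp (K * X) = 1" by (simp flip: exp_add)
  ultimately show ?thesis
    unfolding mult.assoc by (simp only: mult_1_right \<phi>_def K_def)
qed

lemma companion_row_sum_bound: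
  assumes A: "\<And>k x. k \<in> {1..n} \<Longrightarrow> \<bar>a k x\<bar> \<le> A" and i: "i < n"
  shows "norm (\<Sum>j<n. companion_mat n a x lam $$ (i, j) * v j) \<le> (1 + norm lam + A) * (\<Sum>j<n. norm (v j))"
proof -
  have A0: "A \<ge> 0" using A[of n x] i by force
  have "norm (companion_mat n a x lam $$ (i, j)) \<le> 1 + norm lam + A" if j: "j < n" for j
  proof (cases "Suc i < n")
    case True
    then show ?thesis using i j A0 by (simp add: companion_mat_def)
  next
    case False
    have "norm ((if j = 0 then lam else 0) - complex_of_real (a (n - j) x)) \<le> norm lam + A"
      using A[of "n - j" x] j
      by (intro order_trans[OF norm_triangle_ineq4] add_mono) auto
    then show ?thesis using False i j by (simp add: companion_mat_def)
  qed
  then have "norm (\<Sum>j<n. companion_mat n a x lam $$ (i, j) * v j)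
      \<le> (\<Sum>j<n. (1 + norm lam + A) * norm (v j))"
    by (intro sum_norm_le) (auto simp: norm_mult intro!: mult_right_mono)
  then show ?thesis by (simp add: sum_distrib_left)
qed

text \<open>
  Gronwall's inequality with \<open>G = 0\<close>, started at \<open>x0\<close>; the reflection \<open>\<epsilon> = -1\<close> treats the points to
  the left of \<open>x0\<close>.
\<close>

lemma solves_unique_zero:
  assumes A: "\<And>k x. k \<in> {1..n} \<Longrightarrow> \<bar>a k x\<bar> \<le> A"
    and v: "solves n a lam v" and v0: "\<And>i. i < n \<Longrightarrow> v x0 i = 0" and i: "i < n"
  shows "v x i = 0"
proof -
  define L where "L = 1 + norm lam + A"
  have A0: "A \<ge> 0" using A[of n x] i by force
  have L: "L \<ge> 0" using A0 by (simp add: L_def)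
  define \<epsilon> where "\<epsilon> = (if x \<ge> x0 then 1 else - 1 :: real)"
  define u where "u = (\<lambda>y. v (x0 + \<epsilon> * y))"
  have der: "((\<lambda>y. u y i) has_vector_derivative
      \<epsilon> *\<^sub>R companion_apply n a (x0 + \<epsilon> * y) lam (v (x0 + \<epsilon> * y)) i) (at y)" if "i < n" for i y
  proof -
    have "((\<lambda>y. x0 + \<epsilon> * y) has_vector_derivative \<epsilon>) (at y)"
      by (rule derivative_eq_intros refl | simp)+
    from vector_diff_chain_at[OF this solvesD[OF v that]] show ?thesis
      unfolding u_def o_def .
  qed
  have "(\<Sum>i<n. (norm (u \<bar>x - x0\<bar> i))\<^sup>2) + 0\<^sup>2
           \<le> ((\<Sum>i<n. (norm (u 0 i))\<^sup>2) + 0\<^sup>2) * exp (((2 * L + 1) * n + 1) * \<bar>x - x0\<bar>)"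
  proof (rule gronwall_sum_squares[OF _ L])
    fix y i assume "i < n"
    have "norm (\<epsilon> *\<^sub>R companion_apply n a (x0 + \<epsilon> * y) lam (v (x0 + \<epsilon> * y)) i)
       = norm (companion_apply n a (x0 + \<epsilon> * y) lam (v (x0 + \<epsilon> * y)) i)"
      by (simp add: \<epsilon>_def)
    also have "\<dots> \<le> L * (\<Sum>j<n. norm (u y j)) + 0"
      using companion_row_sum_bound[where A = A, OF A \<open>i < n\<close>] by (simp add: u_def L_def)
    finally show "norm (\<epsilon> *\<^sub>R companion_apply n a (x0 + \<epsilon> * y) lam (v (x0 + \<epsilon> * y)) i)
       \<le> L * (\<Sum>j<n. norm (u y j)) + 0" .
  qed (use der in auto)
  then have "(\<Sum>i<n. (norm (u \<bar>x - x0\<bar> i))\<^sup>2) \<le> 0"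
    using v0 by (simp add: u_def)
  then have "(\<Sum>i<n. (norm (u \<bar>x - x0\<bar> i))\<^sup>2) = 0" by (simp add: order_antisym sum_nonneg)
  then have "u \<bar>x - x0\<bar> i = 0" using i by (subst (asm) sum_nonneg_eq_0_iff) auto
  then show ?thesis by (auto simp: u_def \<epsilon>_def split: if_splits)
qed

lemma solves_lincomb:
  assumes "solves n a lam v" "solves n a lam w"
  shows "solves n a lam (\<lambda>x i. \<alpha> * v x i + \<beta> * w x i)"
  unfolding solves_def
proof (intro allI impI)
  fix x i assume i: "i < n"
  have "((\<lambda>y. \<alpha> * v y i + \<beta> * w y i) has_vector_derivative
      \<alpha> * companion_apply n a x lam (v x) i + \<beta> * companion_apply n a x lam (w x) i) (at x)"
    by (intro has_vector_derivative_add has_vector_derivative_mult_right solvesD assms i)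
  then show "((\<lambda>y. \<alpha> * v y i + \<beta> * w y i) has_vector_derivative
      (\<Sum>j<n. companion_mat n a x lam $$ (i, j) * (\<alpha> * v x j + \<beta> * w x j))) (at x)"
    by (simp add: sum_distrib_left sum.distrib algebra_simps)
qed

lemma solves_sum:
  assumes "\<And>k. k \<in> I \<Longrightarrow> solves n a lam (v k)"
  shows "solves n a lam (\<lambda>x i. \<Sum>k\<in>I. v k x i * c k)"
  unfolding solves_def
proof (intro allI impI)
  fix x i assume i: "i < n"
  have "((\<lambda>y. \<Sum>k\<in>I. v k y i * c k) has_vector_derivative
      (\<Sum>k\<in>I. (\<Sum>j<n. companion_mat n a x lam $$ (i, j) * v k x j) * c k)) (at x)"
    by (intro has_vector_derivative_sum has_vector_derivative_mult_left solvesD assms i)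
  also have "(\<Sum>k\<in>I. (\<Sum>j<n. companion_mat n a x lam $$ (i, j) * v k x j) * c k)
     = (\<Sum>j<n. companion_mat n a x lam $$ (i, j) * (\<Sum>k\<in>I. v k x j * c k))"
    unfolding sum_distrib_left sum_distrib_right by (subst sum.swap) (simp add: mult.assoc)
  finally show "((\<lambda>y. \<Sum>k\<in>I. v k y i * c k) has_vector_derivative
      (\<Sum>j<n. companion_mat n a x lam $$ (i, j) * (\<Sum>k\<in>I. v k x j * c k))) (at x)" .
qed

lemma solves_shift:
  assumes "\<And>k x. k \<in> {1..n} \<Longrightarrow> a k (x + T) = a k x" "solves n a lam v"
  shows "solves n a lam (\<lambda>x. v (x + T))"
  unfolding solves_def
proof (intro allI impI)
  fix x i assume i: "i < n"
  have "((\<lambda>y. y + T) has_vector_derivative 1) (at x)"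
    by (rule derivative_eq_intros refl | simp)+
  from vector_diff_chain_at[OF this solvesD[OF assms(2) i]]
  have "((\<lambda>y. v (y + T) i) has_vector_derivative
       companion_apply n a (x + T) lam (v (x + T)) i) (at x)"
    by (simp add: o_def)
  moreover have "companion_mat n a (x + T) lam $$ (i, j) = companion_mat n a x lam $$ (i, j)" if "j < n" for j
    using i that assms(1)[of "n - j" x] by (simp add: companion_mat_def)
  ultimately show "((\<lambda>y. v (y + T) i) has_vector_derivative
       companion_apply n a x lam (v (x + T)) i) (at x)" by simp
qed

text \<open>
  The parameter occurs in a single matrix entry. A solution for \<open>l\<close> thus solves the system for
  \<open>l'\<close> with an extra forcing of the last component by the zeroth one.
\<close>

lemma companion_apply_change_parameter:
  assumes "i < n"
  shows "(\<Sum>j<n. companion_mat n a x l $$ (i, j) * v j)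
     = (\<Sum>j<n. companion_mat n a x l' $$ (i, j) * v j) + (if Suc i = n then (l - l') * v 0 else 0)"
proof -
  have "(\<Sum>j<n. companion_mat n a x l $$ (i, j) * v j)
     = (\<Sum>j<n. companion_mat n a x l' $$ (i, j) * v j + (if j = 0 then (if Suc i = n then (l - l') * v 0 else 0) else 0))"
    using assms by (intro sum.cong) (auto simp: companion_mat_def algebra_simps)
  also have "\<dots> = (\<Sum>j<n. companion_mat n a x l' $$ (i, j) * v j) + (if Suc i = n then (l - l') * v 0 else 0)"
    using assms by (subst sum.distrib, subst sum.delta) auto
  finally show ?thesis .
qed

lemma forced_companion_bound:
  fixes u :: "real \<Rightarrow> nat \<Rightarrow> complex"
  assumes A: "\<And>k x. k \<in> {1..n} \<Longrightarrow> \<bar>a k x\<bar> \<le> A" and X: "X \<ge> 0" and G: "G \<ge> 0"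
    and der: "\<And>x i. i < n \<Longrightarrow> ((\<lambda>y. u y i) has_vector_derivative
       companion_apply n a x lam (u x) i + (if Suc i = n then g x else 0)) (at x)"
    and g: "\<And>x. x \<in> {0..X} \<Longrightarrow> norm (g x) \<le> G" and u0: "\<And>i. i < n \<Longrightarrow> u 0 i = 0"
    and lam: "norm lam \<le> \<Lambda>" and i: "i < n"
  shows "norm (u X i) \<le> G * exp (((2 * (1 + \<Lambda> + A) + 1) * n + 1) * X)"
proof -
  define L where "L = 1 + \<Lambda> + A"
  have A0: "A \<ge> 0" using A[of n 0] i by force
  have \<Lambda>0: "\<Lambda> \<ge> 0" using lam norm_ge_zero order_trans by blast
  have L: "L \<ge> 0" using A0 \<Lambda>0 by (simp add: L_def)
  define E where "E = ((2 * L + 1) * n + 1) * X"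
  have E0: "E \<ge> 0" using L X by (simp add: E_def)
  have "(\<Sum>i<n. (norm (u X i))\<^sup>2) + G\<^sup>2 \<le> ((\<Sum>i<n. (norm (u 0 i))\<^sup>2) + G\<^sup>2) * exp E"
    unfolding E_def
  proof (rule gronwall_sum_squares[OF X L G der])
    fix x i assume x: "x \<in> {0..X}" and i: "i < n"
    have "norm ((companion_apply n a x lam (u x) i) + (if Suc i = n then g x else 0))
      \<le> (1 + norm lam + A) * (\<Sum>j<n. norm (u x j)) + G"
      using g[OF x] G
      by (intro order_trans[OF norm_triangle_ineq] add_mono companion_row_sum_bound[where A = A, OF A i]) auto
    also have "\<dots> \<le> L * (\<Sum>j<n. norm (u x j)) + G"
      using lam by (intro add_mono mult_right_mono) (auto simp: L_def sum_nonneg)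
    finally show "norm ((companion_apply n a x lam (u x) i) + (if Suc i = n then g x else 0))
      \<le> L * (\<Sum>j<n. norm (u x j)) + G" .
  qed
  moreover have "(norm (u X i))\<^sup>2 \<le> (\<Sum>i<n. (norm (u X i))\<^sup>2)"
    using i by (intro member_le_sum) auto
  ultimately have "(norm (u X i))\<^sup>2 \<le> G\<^sup>2 * exp E" using u0 by simp (smt (verit) zero_le_power2)
  also have "\<dots> \<le> G\<^sup>2 * exp (2 * E)" using E0 by (intro mult_left_mono) auto
  also have "\<dots> = (G * exp E)\<^sup>2" by (simp add: power_mult_distrib flip: exp_of_nat_mult)
  finally show ?thesis
    using G by (simp add: E_def L_def power2_le_iff_abs_le)
qed

lemma solves_bounded:
  assumes A: "\<And>k x. k \<in> {1..n} \<Longrightarrow> \<bar>a k x\<bar> \<le> A" and v: "solves n a lam v" and x: "x \<in> {0..X}"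
    and lam: "norm lam \<le> \<Lambda>" and i: "i < n"
  shows "norm (v x i) \<le> (1 + (\<Sum>i<n. (norm (v 0 i))\<^sup>2)) * exp (((2 * (1 + \<Lambda> + A) + 1) * n + 1) * X)"
proof -
  define L where "L = 1 + \<Lambda> + A"
  have A0: "A \<ge> 0" using A[of n 0] i by force
  have \<Lambda>0: "\<Lambda> \<ge> 0" using lam norm_ge_zero order_trans by blast
  have L: "L \<ge> 0" using A0 \<Lambda>0 by (simp add: L_def)
  define S where "S = (\<Sum>i<n. (norm (v 0 i))\<^sup>2)"
  have S: "S \<ge> 0" by (simp add: S_def sum_nonneg)
  define E where "E = ((2 * L + 1) * n + 1) * X"
  have "E \<ge> 0" using L x by (simp add: E_def)
  have "(\<Sum>i<n. (norm (v x i))\<^sup>2) + 0\<^sup>2 \<le> (S + 0\<^sup>2) * exp (((2 * L + 1) * n + 1) * x)"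
    unfolding S_def
  proof (rule gronwall_sum_squares[OF _ L _ solvesD[OF v]])
    fix y i assume i: "i < n"
    have "norm (companion_apply n a y lam (v y) i)
      \<le> (1 + norm lam + A) * (\<Sum>j<n. norm (v y j))"
      by (rule companion_row_sum_bound[where A = A, OF A i])
    also have "\<dots> \<le> L * (\<Sum>j<n. norm (v y j))"
      using lam by (intro mult_right_mono) (auto simp: L_def sum_nonneg)
    finally show "norm (companion_apply n a y lam (v y) i) \<le> L * (\<Sum>j<n. norm (v y j)) + 0" by simp
  qed (use x in auto)
  moreover have "(norm (v x i))\<^sup>2 \<le> (\<Sum>i<n. (norm (v x i))\<^sup>2)"
    using i by (intro member_le_sum) auto
  ultimately have "(norm (v x i))\<^sup>2 \<le> S * exp (((2 * L + 1) * n + 1) * x)" by simp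
  also have "\<dots> \<le> S * exp E"
  proof -
    have "((2 * L + 1) * n + 1) * x \<le> E"
      using x L unfolding E_def by (intro mult_left_mono) auto
    then show ?thesis using S by (intro mult_left_mono) auto
  qed
  also have "\<dots> \<le> (1 + S) * (1 + S) * (exp E * exp E)"
    using S \<open>E \<ge> 0\<close> by (intro mult_mono) (auto simp: algebra_simps mult_le_cancel_left1)
  finally have "(norm (v x i))\<^sup>2 \<le> ((1 + S) * exp E)\<^sup>2" by (simp add: power2_eq_square mult_ac)
  then show ?thesis
    using S by (simp add: E_def L_def S_def power2_le_iff_abs_le)
qed

text \<open>
  The difference quotients at \<open>l0\<close> solve the system for \<open>l0\<close> with forcing \<open>v l x 0\<close>, and two of
  them differ by a solution whose forcing is \<open>O(|l - l'|)\<close>. They are therefore a Lipschitz function of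
  \<open>l\<close> on the punctured disc and converge as \<open>l\<close> tends to \<open>l0\<close>, by the completeness of the complex
  numbers.
\<close>

lemma solution_holomorphic_in_parameter:
  assumes A: "\<And>k x. k \<in> {1..n} \<Longrightarrow> \<bar>a k x\<bar> \<le> A" and X: "X \<ge> 0"
    and v: "\<And>lam. solves n a lam (v lam)" and v0: "\<And>lam i. i < n \<Longrightarrow> v lam 0 i = c i" and i: "i < n"
  shows "(\<lambda>lam. v lam X i) holomorphic_on UNIV"
proof -
  have n: "0 < n" using i by simp
  have "\<exists>D. ((\<lambda>lam. v lam X i) has_field_derivative D) (at l0)" for l0
  proof -
    define \<Lambda> where "\<Lambda> = norm l0 + 1"
    define B where "B = (1 + (\<Sum>i<n. (norm (c i))\<^sup>2)) * exp (((2 * (1 + \<Lambda> + A) + 1) * n + 1) * X)"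
    define E where "E = exp (((2 * (1 + \<Lambda> + A) + 1) * n + 1) * X)"
    have B0: "B \<ge> 0" by (simp add: B_def sum_nonneg add_nonneg_nonneg)
    have ball: "norm l \<le> \<Lambda>" if "l \<in> ball l0 1" for l
      using that norm_triangle_sub[of l l0] by (simp add: \<Lambda>_def dist_norm norm_minus_commute)
    have bounded: "norm (v l x 0) \<le> B" if "l \<in> ball l0 1" "x \<in> {0..X}" for l x
      using solves_bounded[where A = A, OF A v that(2) ball[OF that(1)] n] v0 by (simp add: B_def)
    have lip: "norm (v l x 0 - v l' x 0) \<le> (norm (l - l') * B) * E"
      if l: "l \<in> ball l0 1" "l' \<in> ball l0 1" and x: "x \<in> {0..X}" for l l' x
    proof -
      have "norm (v l x 0 - v l' x 0) \<le> (norm (l - l') * B) * exp (((2 * (1 + \<Lambda> + A) + 1) * n + 1) * x)"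
      proof (rule forced_companion_bound[where u = "\<lambda>x i. v l x i - v l' x i" and a = a and A = A
              and lam = l and g = "\<lambda>x. (l - l') * v l' x 0"])
        fix y k assume k: "k < n"
        show "((\<lambda>y. v l y k - v l' y k) has_vector_derivative
          (\<Sum>j<n. companion_mat n a y l $$ (k, j) * (v l y j - v l' y j)) +
          (if Suc k = n then (l - l') * v l' y 0 else 0)) (at y)"
          using has_vector_derivative_diff[OF solvesD[OF v[of l] k, of y] solvesD[OF v[of l'] k, of y]]
          by (simp add: companion_apply_change_parameter[OF k, of a y l "v l' y" l'] sum_subtractf right_diff_distrib)
      qed (use A n v0 x B0 ball l bounded in \<open>auto simp: norm_mult intro!: mult_left_mono\<close>)
      also have "\<dots> \<le> (norm (l - l') * B) * E"
        unfolding E_def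
      proof (intro mult_left_mono)
        have "A \<ge> 0" using A[of n 0] i by force
        moreover have "\<Lambda> \<ge> 0" by (simp add: \<Lambda>_def)
        ultimately have "(2 * (1 + \<Lambda> + A) + 1) * n + 1 \<ge> 0" by simp
        then show "exp (((2 * (1 + \<Lambda> + A) + 1) * n + 1) * x) \<le> exp (((2 * (1 + \<Lambda> + A) + 1) * n + 1) * X)"
          using x by (simp add: mult_left_mono)
      qed (use B0 in auto)
      finally show ?thesis .
    qed
    define Q where "Q = (\<lambda>l x k. (v l x k - v l0 x k) / (l - l0))"
    have Qlip: "norm (Q l X i - Q l' X i) \<le> norm (l - l') * (B * E * E)"
      if l: "l \<in> ball l0 1 - {l0}" "l' \<in> ball l0 1 - {l0}" for l l'
    proof -
      have Qder: "((\<lambda>y. Q l y k) has_vector_derivative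
          companion_apply n a y l0 (Q l y) k + (if Suc k = n then v l y 0 else 0)) (at y)"
        if k: "k < n" and l: "l \<noteq> l0" for l y k
      proof -
        have "((\<lambda>y. Q l y k) has_vector_derivative
          ((companion_apply n a y l (v l y) k) - (companion_apply n a y l0 (v l0 y) k)) / (l - l0)) (at y)"
          unfolding Q_def
          by (intro has_vector_derivative_divide has_vector_derivative_diff solvesD v k)
        moreover have "(companion_apply n a y l (v l y) k - (companion_apply n a y l0 (v l0 y) k)) / (l - l0)
          = companion_apply n a y l0 (Q l y) k + (if Suc k = n then v l y 0 else 0)"
        proof -
          have "(companion_apply n a y l0 (Q l y) k)
            = ((companion_apply n a y l0 (v l y) k) - (companion_apply n a y l0 (v l0 y) k)) / (l - l0)"
            by (simp add: Q_def right_diff_distrib flip: sum_subtractf sum_divide_distrib)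
          then show ?thesis using l
            by (simp add: companion_apply_change_parameter[OF k, of a y l "v l y" l0] diff_divide_distrib add_divide_distrib)
        qed
        ultimately show ?thesis by simp
      qed
      have "norm (Q l X i - Q l' X i) \<le> (norm (l - l') * B * E) * exp (((2 * (1 + \<Lambda> + A) + 1) * n + 1) * X)"
      proof (rule forced_companion_bound[where u = "\<lambda>x i. Q l x i - Q l' x i" and a = a and A = A
              and lam = l0 and g = "\<lambda>x. v l x 0 - v l' x 0"])
        fix y k assume k: "k < n"
        show "((\<lambda>y. Q l y k - Q l' y k) has_vector_derivative
          (\<Sum>j<n. companion_mat n a y l0 $$ (k, j) * (Q l y j - Q l' y j)) +
          (if Suc k = n then v l y 0 - v l' y 0 else 0)) (at y)"
        proof -
          have "(\<Sum>j<n. companion_mat n a y l0 $$ (k, j) * (Q l y j - Q l' y j)) +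
              (if Suc k = n then v l y 0 - v l' y 0 else 0)
            = ((companion_apply n a y l0 (Q l y) k) + (if Suc k = n then v l y 0 else 0))
            - ((companion_apply n a y l0 (Q l' y) k) + (if Suc k = n then v l' y 0 else 0))"
            by (auto simp: sum_subtractf algebra_simps)
          then show ?thesis using has_vector_derivative_diff[OF Qder[OF k, of l y] Qder[OF k, of l' y]] l by simp
        qed
      qed (use A i X v0 B0 lip l in \<open>auto simp: Q_def \<Lambda>_def E_def\<close>)
      then show ?thesis by (simp add: E_def mult_ac)
    qed
    have "uniformly_continuous_on (ball l0 1 - {l0}) (\<lambda>l. Q l X i)"
    proof (rule lipschitz_on_uniformly_continuous)
      show "(B * E * E)-lipschitz_on (ball l0 1 - {l0}) (\<lambda>l. Q l X i)"
        using Qlip B0 by (intro lipschitz_onI) (auto simp: dist_norm E_def mult_ac)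
    qed
    moreover have "l0 \<in> closure (ball l0 1 - {l0})"
      unfolding closure_approachable
    proof (intro allI impI)
      fix e :: real assume "e > 0"
      then show "\<exists>y\<in>ball l0 1 - {l0}. dist y l0 < e"
        by (intro bexI[of _ "l0 + of_real (min (e / 2) (1 / 2))"]) (auto simp: dist_norm)
    qed
    ultimately obtain D where "((\<lambda>l. Q l X i) \<longlongrightarrow> D) (at l0 within (ball l0 1 - {l0}))"
      by (rule uniformly_continuous_on_extension_at_closure)
    moreover have "at l0 within (ball l0 1 - {l0}) = at l0"
      by (rule at_within_nhd[of _ "ball l0 1"]) auto
    ultimately have "((\<lambda>l. (v l X i - v l0 X i) / (l - l0)) \<longlongrightarrow> D) (at l0)" by (simp add: Q_def)
    then show ?thesis by (auto simp: has_field_derivative_iff)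
  qed
  then show ?thesis by (auto simp: holomorphic_on_def field_differentiable_def)
qed

section \<open>Growth rates of nearly diagonal systems\<close>

text \<open>
  The error is compared with every common bound \<open>B\<close> of the components at \<open>x\<close>; this is the estimate
  against \<open>max |w x m|\<close>, written without a maximum over an index set.
\<close>

definition nearly_diagonal :: "nat \<Rightarrow> (nat \<Rightarrow> complex) \<Rightarrow> real \<Rightarrow> (real \<Rightarrow> nat \<Rightarrow> complex) \<Rightarrow> bool" where
  "nearly_diagonal n \<kappa> C w \<longleftrightarrow> (\<forall>x. \<forall>k<n. \<exists>d.
     ((\<lambda>y. w y k) has_vector_derivative d) (at x) \<and>
     (\<forall>B. (\<forall>m<n. norm (w x m) \<le> B) \<longrightarrow> norm (d - \<kappa> k * w x k) \<le> C * B))"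

lemma nearly_diagonal_continuous:
  assumes "nearly_diagonal n \<kappa> C w" "k < n"
  shows "continuous_on S (\<lambda>y. w y k)"
proof (rule continuous_at_imp_continuous_on, rule ballI)
  fix x
  show "isCont (\<lambda>y. w y k) x"
    using assms unfolding nearly_diagonal_def
    by (meson has_vector_derivative_continuous)
qed

lemma nearly_diagonal_bound_nonneg:
  assumes nd: "nearly_diagonal n \<kappa> C w" and j: "j < n"
  shows "C \<ge> 0"
proof -
  obtain d where "\<forall>B. (\<forall>m<n. norm (w 0 m) \<le> B) \<longrightarrow> norm (d - \<kappa> j * w 0 j) \<le> C * B"
    using nd j unfolding nearly_diagonal_def by blast
  moreover have "\<forall>m<n. norm (w 0 m) \<le> 1 + (\<Sum>m<n. norm (w 0 m))"
    by (metis (no_types, lifting) add_increasing finite_lessThan lessThan_iff member_le_sum norm_ge_zero zero_le_one)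
  ultimately have "0 \<le> C * (1 + (\<Sum>m<n. norm (w 0 m)))" by (meson norm_ge_zero order_trans)
  moreover have "1 + (\<Sum>m<n. norm (w 0 m)) > 0" by (simp add: add_pos_nonneg sum_nonneg)
  ultimately show ?thesis by (simp add: zero_le_mult_iff)
qed

text \<open>
  Where component \<open>k\<close> dominates, the error is at most \<open>C |w x k|\<close>, hence the logarithmic growth
  rate of \<open>|w k|\<close> differs from \<open>Re (\<kappa> k)\<close> by at most \<open>C\<close>.
\<close>

lemma growth_rate_of_dominant_component:
  assumes nd: "nearly_diagonal n \<kappa> C w" and k: "k < n"
    and dom: "\<And>m. m < n \<Longrightarrow> norm (w x m) \<le> norm (w x k)" and nz: "w x k \<noteq> 0"
  obtains \<sigma> where "\<bar>\<sigma> - Re (\<kappa> k)\<bar> \<le> C"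
    "((\<lambda>y. (norm (w y k))\<^sup>2) has_real_derivative 2 * \<sigma> * (norm (w x k))\<^sup>2) (at x)"
proof -
  obtain d where d: "((\<lambda>y. w y k) has_vector_derivative d) (at x)"
    and e: "norm (d - \<kappa> k * w x k) \<le> C * norm (w x k)"
    using nd k dom unfolding nearly_diagonal_def by blast
  define z where "z = w x k"
  have z: "norm z > 0" using nz by (simp add: z_def)
  define \<sigma> where "\<sigma> = Re (cnj z * d) / (norm z)\<^sup>2"
  have D: "((\<lambda>y. (norm (w y k))\<^sup>2) has_real_derivative 2 * \<sigma> * (norm (w x k))\<^sup>2) (at x)"
    using norm_square_has_derivative[OF d] z by (simp add: \<sigma>_def z_def)
  have "\<sigma> - Re (\<kappa> k) = Re (cnj z * (d - \<kappa> k * z)) / (norm z)\<^sup>2"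
  proof -
    have "Re (cnj z * (d - \<kappa> k * z)) = Re (cnj z * d) - Re (\<kappa> k) * (norm z)\<^sup>2"
      unfolding cmod_power2 by (simp add: algebra_simps power2_eq_square)
    then show ?thesis using z by (simp add: \<sigma>_def field_simps)
  qed
  also have "\<bar>\<dots>\<bar> \<le> norm (cnj z * (d - \<kappa> k * z)) / (norm z)\<^sup>2"
    using abs_Re_le_cmod[of "cnj z * (d - \<kappa> k * z)"] by (simp add: divide_right_mono)
  also have "\<dots> \<le> norm z * (C * norm z) / (norm z)\<^sup>2"
    using e z by (intro divide_right_mono) (auto simp: norm_mult z_def intro: mult_left_mono)
  also have "\<dots> = C" using z by (simp add: power2_eq_square)
  finally show thesis using that D by blast
qed

lemma weighted_component_derivative:
  assumes "((\<lambda>y. (norm (w y k))\<^sup>2) has_real_derivative 2 * \<sigma> * (norm (w x k))\<^sup>2) (at x)"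
  shows "((\<lambda>y. (norm (w y k))\<^sup>2 * exp (- 2 * (\<nu> * y))) has_real_derivative
            2 * (\<sigma> - \<nu>) * ((norm (w x k))\<^sup>2 * exp (- 2 * (\<nu> * x)))) (at x)"
  by (rule derivative_eq_intros assms refl | simp add: algebra_simps)+

lemma growth_rate_at_maximum:
  assumes D: "((\<lambda>y. (norm (w y k))\<^sup>2) has_real_derivative 2 * \<sigma> * (norm (w x k))\<^sup>2) (at x)"
    and nz: "w x k \<noteq> 0" and h: "h > 0"
  shows "(\<And>t. 0 < t \<Longrightarrow> t < h \<Longrightarrow> (norm (w (x + t) k))\<^sup>2 * exp (- 2 * (\<nu> * (x + t))) \<le> (norm (w x k))\<^sup>2 * exp (- 2 * (\<nu> * x)))
      \<Longrightarrow> \<sigma> \<le> \<nu>"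
    and "(\<And>t. 0 < t \<Longrightarrow> t < h \<Longrightarrow> (norm (w (x - t) k))\<^sup>2 * exp (- 2 * (\<nu> * (x - t))) \<le> (norm (w x k))\<^sup>2 * exp (- 2 * (\<nu> * x)))
      \<Longrightarrow> \<nu> \<le> \<sigma>"
proof -
  define f where "f = (\<lambda>y. (norm (w y k))\<^sup>2 * exp (- 2 * (\<nu> * y)))"
  have f: "(f has_real_derivative 2 * (\<sigma> - \<nu>) * f x) (at x)"
    unfolding f_def by (rule weighted_component_derivative[of w k \<sigma> x \<nu>, OF D])
  have fx: "f x > 0" using nz by (simp add: f_def)
  show "\<sigma> \<le> \<nu>" if max: "\<And>t. 0 < t \<Longrightarrow> t < h \<Longrightarrow> (norm (w (x + t) k))\<^sup>2 * exp (- 2 * (\<nu> * (x + t))) \<le> (norm (w x k))\<^sup>2 * exp (- 2 * (\<nu> * x))"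
  proof (rule ccontr)
    assume "\<not> \<sigma> \<le> \<nu>"
    then have "2 * (\<sigma> - \<nu>) * f x > 0" using fx by simp
    from DERIV_pos_inc_right[OF f this] obtain d where d: "d > 0" "\<And>t. t > 0 \<Longrightarrow> t < d \<Longrightarrow> f x < f (x + t)" by blast
    define t where "t = min d h / 2"
    have "0 < t" "t < d" "t < h" using d(1) h by (auto simp: t_def)
    then show False using max[of t] d(2)[of t] by (simp add: f_def)
  qed
  show "\<nu> \<le> \<sigma>" if max: "\<And>t. 0 < t \<Longrightarrow> t < h \<Longrightarrow> (norm (w (x - t) k))\<^sup>2 * exp (- 2 * (\<nu> * (x - t))) \<le> (norm (w x k))\<^sup>2 * exp (- 2 * (\<nu> * x))"
  proof (rule ccontr)
    assume "\<not> \<nu> \<le> \<sigma>"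
    then have "2 * (\<sigma> - \<nu>) * f x < 0" using fx by (simp add: mult_neg_pos)
    from DERIV_neg_dec_left[OF f this] obtain d where d: "d > 0" "\<And>t. t > 0 \<Longrightarrow> t < d \<Longrightarrow> f x < f (x - t)" by blast
    define t where "t = min d h / 2"
    have "0 < t" "t < d" "t < h" using d(1) h by (auto simp: t_def)
    then show False using max[of t] d(2)[of t] by (simp add: f_def)
  qed
qed

lemma common_maximizer:
  fixes \<phi> :: "nat \<Rightarrow> real \<Rightarrow> real"
  assumes "n > 0" "\<And>m. m < n \<Longrightarrow> \<exists>y. \<forall>x. \<phi> m x \<le> \<phi> m y"
  obtains k y where "k < n" "\<And>m x. m < n \<Longrightarrow> \<phi> m x \<le> \<phi> k y"
proof -
  from assms(2) obtain y where y: "\<And>m x. m < n \<Longrightarrow> \<phi> m x \<le> \<phi> m (y m)" by metis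
  define F where "F = (\<lambda>m. \<phi> m (y m)) ` {..<n}"
  have "finite F" "F \<noteq> {}" using assms(1) by (auto simp: F_def)
  then have "Max F \<in> F" by (rule Max_in)
  then obtain k where k: "k < n" "\<phi> k (y k) = Max F" unfolding F_def by force
  have "\<phi> m x \<le> \<phi> k (y k)" if "m < n" for m x
  proof -
    have "\<phi> m (y m) \<le> Max F" using that by (intro Max_ge[OF \<open>finite F\<close>]) (auto simp: F_def)
    then show ?thesis using y[OF that, of x] k by simp
  qed
  with k that show thesis by blast
qed

lemma periodic_attains_max:
  fixes \<phi> :: "real \<Rightarrow> real"
  assumes "T > 0" "\<And>x. \<phi> (x + T) = \<phi> x" "continuous_on UNIV \<phi>"
  shows "\<exists>y. \<forall>x. \<phi> x \<le> \<phi> y"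
proof -
  have per: "\<phi> (x + of_int k * T) = \<phi> x" for x k
  proof (induction k rule: int_induct[of _ 0])
    case (step1 i)
    then show ?case using assms(2)[of "x + of_int i * T"] by (simp add: algebra_simps)
  next
    case (step2 i)
    then show ?case using assms(2)[of "x + of_int (i - 1) * T"] by (simp add: algebra_simps)
  qed simp
  obtain y where y: "\<And>x. x \<in> {0..T} \<Longrightarrow> \<phi> x \<le> \<phi> y"
    using continuous_attains_sup[of "{0..T}" \<phi>] assms(1) continuous_on_subset[OF assms(3)]
    by (metis atLeastAtMost_iff compact_Icc empty_iff order_less_imp_le order_refl top_greatest)
  have "\<phi> x \<le> \<phi> y" for x
  proof -
    define k where "k = \<lfloor>x / T\<rfloor>"
    have "of_int k * T \<le> x" "x \<le> of_int k * T + T"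
      using assms(1) floor_divide_lower[of T x] floor_divide_upper[of T x] by (auto simp: k_def algebra_simps)
    then have "\<phi> (x + of_int (- k) * T) \<le> \<phi> y" by (intro y) auto
    then show ?thesis by (simp only: per)
  qed
  then show ?thesis by blast
qed

text \<open>
  The weight \<open>exp(-2\<nu>x)\<close> with \<open>\<nu> = ln r / T\<close> makes all \<open>|w k|\<^sup>2\<close> periodic. At a common maximum over
  the indices and the line, the component is dominant and its growth rate is exactly \<open>\<nu>\<close>.
\<close>

lemma floquet_exponent_near_diagonal:
  assumes nd: "nearly_diagonal n \<kappa> C w" and T: "T > 0" and r: "r > 0"
    and per: "\<And>x m. m < n \<Longrightarrow> norm (w (x + T) m) = r * norm (w x m)"
    and nz: "m0 < n" "w x0 m0 \<noteq> 0"
  shows "\<exists>k<n. \<bar>ln r / T - Re (\<kappa> k)\<bar> \<le> C"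
proof -
  define \<nu> where "\<nu> = ln r / T"
  define \<phi> where "\<phi> = (\<lambda>m x. (norm (w x m))\<^sup>2 * exp (- 2 * (\<nu> * x)))"
  have "exp (- 2 * (\<nu> * T)) = 1 / r\<^sup>2"
  proof -
    have "\<nu> * T = ln r" using T by (simp add: \<nu>_def)
    then have "exp (- 2 * (\<nu> * T)) = inverse ((exp (ln r))\<^sup>2)"
      by (simp add: exp_minus flip: exp_of_nat_mult)
    then show ?thesis using r by (simp add: field_simps)
  qed
  then have "\<phi> m (x + T) = \<phi> m x" if "m < n" for m x
    using r per[OF that, of x] by (simp add: \<phi>_def ring_distribs exp_add exp_diff exp_minus power_mult_distrib field_simps)
  moreover have "continuous_on UNIV (\<phi> m)" if "m < n" for m
    unfolding \<phi>_def by (intro continuous_intros nearly_diagonal_continuous[OF nd that])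
  ultimately have "\<exists>y. \<forall>x. \<phi> m x \<le> \<phi> m y" if "m < n" for m
    using periodic_attains_max[OF T, of "\<phi> m"] that by blast
  then obtain k y where k: "k < n" and max: "\<And>m x. m < n \<Longrightarrow> \<phi> m x \<le> \<phi> k y"
    using common_maximizer[of n \<phi>] nz(1) by (metis gr_zeroI not_less_zero)
  have "\<phi> m0 x0 > 0" using nz by (simp add: \<phi>_def)
  then have pos: "\<phi> k y > 0" using max[OF nz(1), of x0] by linarith
  then have wk: "w y k \<noteq> 0" by (auto simp: \<phi>_def)
  have dom: "norm (w y m) \<le> norm (w y k)" if "m < n" for m
    using max[OF that, of y] by (simp add: \<phi>_def power2_le_iff_abs_le)
  obtain \<sigma> where \<sigma>: "\<bar>\<sigma> - Re (\<kappa> k)\<bar> \<le> C"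
    and D: "((\<lambda>y. (norm (w y k))\<^sup>2) has_real_derivative 2 * \<sigma> * (norm (w y k))\<^sup>2) (at y)"
    using growth_rate_of_dominant_component[OF nd k dom wk] by blast
  have "2 * (\<sigma> - \<nu>) * ((norm (w y k))\<^sup>2 * exp (- 2 * (\<nu> * y))) = 0"
    using DERIV_local_max[OF weighted_component_derivative[of w k \<sigma> y \<nu>, OF D], of 1] max[OF k]
    by (simp add: \<phi>_def)
  then have "\<sigma> = \<nu>" using wk by simp
  then show ?thesis using \<sigma> k by (auto simp: \<nu>_def)
qed

lemma decaying_attains_max:
  fixes \<phi> :: "real \<Rightarrow> real"
  assumes "continuous_on UNIV \<phi>" "\<And>x. 0 \<le> \<phi> x" "\<And>x. \<phi> x \<le> B * exp (- (\<epsilon> * \<bar>x\<bar>))" "\<epsilon> > 0"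
  shows "\<exists>y. \<forall>x. \<phi> x \<le> \<phi> y"
proof (cases "\<exists>z. \<phi> z > 0")
  case True
  then obtain z where z: "\<phi> z > 0" by blast
  have "((\<lambda>R. B * exp (- (\<epsilon> * R))) \<longlongrightarrow> 0) at_top" using assms(4) by real_asymp
  then have "eventually (\<lambda>R. B * exp (- (\<epsilon> * R)) < \<phi> z) at_top"
    using z by (rule order_tendstoD)
  then obtain R0 where R0: "\<And>R. R \<ge> R0 \<Longrightarrow> B * exp (- (\<epsilon> * R)) < \<phi> z"
    unfolding eventually_at_top_linorder by blast
  define R where "R = max R0 \<bar>z\<bar>"
  obtain y where y: "\<And>x. x \<in> {-R..R} \<Longrightarrow> \<phi> x \<le> \<phi> y"
    using continuous_attains_sup[of "{-R..R}" \<phi>] continuous_on_subset[OF assms(1)]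
    by (metis R_def abs_ge_zero abs_le_iff atLeastatMost_empty_iff2 compact_Icc le_max_iff_disj
        minus_le_iff order.trans order_refl top_greatest)
  have zy: "\<phi> z \<le> \<phi> y" by (rule y) (auto simp: R_def)
  have "\<phi> x \<le> \<phi> y" for x
  proof (cases "\<bar>x\<bar> \<le> R")
    case True then show ?thesis by (intro y) auto
  next
    case False
    then have "R0 \<le> \<bar>x\<bar>" by (simp add: R_def)
    then have "\<phi> x < \<phi> z" using R0 assms(3)[of x] by (meson le_less_trans)
    then show ?thesis using zy by simp
  qed
  then show ?thesis by blast
next
  case False
  then have "\<phi> x \<le> \<phi> 0" for x using assms(2)[of 0] by (meson linorder_not_less order_trans)
  then show ?thesis by blast
qed

text \<open>
  The weighted squares have a common maximum, at a point \<open>y\<close> and an index \<open>k\<close>. The growth rate of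
  \<open>|w k|\<close> there is \<open>\<nu> + D\<close> if \<open>y > 0\<close>, \<open>\<nu> - D\<close> if \<open>y < 0\<close>, and lies between the two if
  \<open>y = 0\<close>, where the weight has a corner. Because of the gap only \<open>k = j\<close> is possible, because of
  \<open>C < D\<close> only \<open>y = 0\<close>, and there component \<open>j\<close> vanishes.
\<close>

lemma slow_solution_vanishing_component:
  assumes nd: "nearly_diagonal n \<kappa> C w" and j: "j < n"
    and CD: "C < D" "D' < D"
    and gap: "\<And>k. k < n \<Longrightarrow> k \<noteq> j \<Longrightarrow> \<bar>Re (\<kappa> k) - Re (\<kappa> j)\<bar> > C + D"
    and grow: "\<And>x m. m < n \<Longrightarrow> norm (w x m) \<le> B * exp (Re (\<kappa> j) * x + D' * \<bar>x\<bar>)"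
    and w0: "w 0 j = 0" and m: "m < n"
  shows "w x m = 0"
proof (rule ccontr)
  assume nz: "w x m \<noteq> 0"
  define \<nu> where "\<nu> = Re (\<kappa> j)"
  define \<phi> where "\<phi> = (\<lambda>m x. (norm (w x m))\<^sup>2 * exp (- 2 * (\<nu> * x + D * \<bar>x\<bar>)))"
  have C0: "C \<ge> 0" by (rule nearly_diagonal_bound_nonneg[OF nd j])
  have "\<exists>y. \<forall>x. \<phi> m x \<le> \<phi> m y" if m: "m < n" for m
  proof (rule decaying_attains_max)
    show "continuous_on UNIV (\<phi> m)"
      unfolding \<phi>_def by (intro continuous_intros nearly_diagonal_continuous[OF nd m])
    show "2 * (D - D') > 0" using CD by simp
    show "0 \<le> \<phi> m x" for x by (simp add: \<phi>_def)
    show "\<phi> m x \<le> B\<^sup>2 * exp (- (2 * (D - D') * \<bar>x\<bar>))" for x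
    proof -
      have "(norm (w x m))\<^sup>2 \<le> (B * exp (\<nu> * x + D' * \<bar>x\<bar>))\<^sup>2"
        using grow[OF m, of x] by (intro power_mono) (auto simp: \<nu>_def)
      also have "\<dots> = B\<^sup>2 * exp (2 * (\<nu> * x + D' * \<bar>x\<bar>))"
        by (simp add: power_mult_distrib flip: exp_of_nat_mult)
      finally have "\<phi> m x \<le> B\<^sup>2 * exp (2 * (\<nu> * x + D' * \<bar>x\<bar>)) * exp (- 2 * (\<nu> * x + D * \<bar>x\<bar>))"
        unfolding \<phi>_def by (intro mult_right_mono) auto
      also have "\<dots> = B\<^sup>2 * exp (- (2 * (D - D') * \<bar>x\<bar>))"
        by (simp add: algebra_simps flip: exp_add)
      finally show ?thesis .
    qed
  qed
  then obtain k y where k: "k < n" and max: "\<And>m x. m < n \<Longrightarrow> \<phi> m x \<le> \<phi> k y"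
    using common_maximizer[of n \<phi>] m by (metis gr_zeroI not_less_zero)
  have "\<phi> m x > 0" using nz by (simp add: \<phi>_def)
  then have pos: "\<phi> k y > 0" using max[OF m, of x] by linarith
  then have wk: "w y k \<noteq> 0" by (auto simp: \<phi>_def)
  then have wk2: "(norm (w y k))\<^sup>2 > 0" by simp
  have dom: "norm (w y m) \<le> norm (w y k)" if "m < n" for m
    using max[OF that, of y] by (simp add: \<phi>_def power2_le_iff_abs_le)
  obtain \<sigma> where \<sigma>: "\<bar>\<sigma> - Re (\<kappa> k)\<bar> \<le> C"
    and D: "((\<lambda>y. (norm (w y k))\<^sup>2) has_real_derivative 2 * \<sigma> * (norm (w y k))\<^sup>2) (at y)"
    using growth_rate_of_dominant_component[OF nd k dom wk] by blast
  note max_right = growth_rate_at_maximum(1)[of w k \<sigma> y, OF D wk]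
    and max_left = growth_rate_at_maximum(2)[of w k \<sigma> y, OF D wk]
  have \<phi>_right: "\<phi> k x = (norm (w x k))\<^sup>2 * exp (- 2 * ((\<nu> + D) * x))" if "x \<ge> 0" for x
    using that by (simp add: \<phi>_def distrib_right)
  have \<phi>_left: "\<phi> k x = (norm (w x k))\<^sup>2 * exp (- 2 * ((\<nu> - D) * x))" if "x \<le> 0" for x
    using that by (simp add: \<phi>_def left_diff_distrib)
  have right: "\<sigma> \<le> \<nu> + D" if "y \<ge> 0"
  proof (rule max_right[of "1"])
    fix t :: real assume "0 < t" "t < 1"
    then show "(norm (w (y + t) k))\<^sup>2 * exp (- 2 * ((\<nu> + D) * (y + t)))
        \<le> (norm (w y k))\<^sup>2 * exp (- 2 * ((\<nu> + D) * y))"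
      using max[OF k, of "y + t"] \<phi>_right[of "y + t"] \<phi>_right[of y] that by simp
  qed (use that in simp)
  have right': "\<nu> + D \<le> \<sigma>" if "y > 0"
  proof (rule max_left[of "y"])
    fix t :: real assume "0 < t" "t < y"
    then show "(norm (w (y - t) k))\<^sup>2 * exp (- 2 * ((\<nu> + D) * (y - t)))
        \<le> (norm (w y k))\<^sup>2 * exp (- 2 * ((\<nu> + D) * y))"
      using max[OF k, of "y - t"] \<phi>_right[of "y - t"] \<phi>_right[of y] that by simp
  qed (use that in simp)
  have left: "\<nu> - D \<le> \<sigma>" if "y \<le> 0"
  proof (rule max_left[of "1"])
    fix t :: real assume "0 < t" "t < 1"
    then show "(norm (w (y - t) k))\<^sup>2 * exp (- 2 * ((\<nu> - D) * (y - t)))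
        \<le> (norm (w y k))\<^sup>2 * exp (- 2 * ((\<nu> - D) * y))"
      using max[OF k, of "y - t"] \<phi>_left[of "y - t"] \<phi>_left[of y] that by simp
  qed (use that in simp)
  have left': "\<sigma> \<le> \<nu> - D" if "y < 0"
  proof (rule max_right[of "- y"])
    fix t :: real assume "0 < t" "t < - y"
    then show "(norm (w (y + t) k))\<^sup>2 * exp (- 2 * ((\<nu> - D) * (y + t)))
        \<le> (norm (w y k))\<^sup>2 * exp (- 2 * ((\<nu> - D) * y))"
      using max[OF k, of "y + t"] \<phi>_left[of "y + t"] \<phi>_left[of y] that by simp
  qed (use that in simp)
  have "\<bar>\<sigma> - \<nu>\<bar> \<le> D" using right right' left left' C0 CD by linarith
  then have kj: "k = j" using gap[OF k] \<sigma> by (force simp: \<nu>_def)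
  then have "y \<noteq> 0" using w0 wk by auto
  then have "\<bar>\<sigma> - \<nu>\<bar> = D" using right right' left left' C0 CD by linarith
  then show False using \<sigma> kj CD by (simp add: \<nu>_def)
qed

lemma quasi_periodic_growth:
  fixes G :: "real \<Rightarrow> real"
  assumes T: "T > 0" and E: "E \<ge> 0" and cont: "continuous_on UNIV G" and G0: "\<And>x. G x \<ge> 0"
    and fwd: "\<And>x. G (x + T) \<le> exp (E * T) * G x" and bwd: "\<And>x. G x \<le> exp (E * T) * G (x + T)"
  shows "\<exists>B\<ge>0. \<forall>x. G x \<le> B * exp (E * \<bar>x\<bar>)"
proof -
  have "\<exists>y0\<in>{0..T}. \<forall>y\<in>{0..T}. G y \<le> G y0"
    using T by (intro continuous_attains_sup continuous_on_subset[OF cont]) auto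
  then obtain y0 where y0: "\<And>y. y \<in> {0..T} \<Longrightarrow> G y \<le> G y0" by blast
  define B0 where "B0 = G y0"
  have B0: "B0 \<ge> 0" using G0 by (simp add: B0_def)
  have F: "G (y + real k * T) \<le> exp (E * (real k * T)) * G y" for y k
  proof (induction k)
    case (Suc k)
    have "G (y + real (Suc k) * T) = G (y + real k * T + T)" by (simp add: algebra_simps)
    also have "\<dots> \<le> exp (E * T) * (exp (E * (real k * T)) * G y)"
      using fwd[of "y + real k * T"] Suc by (meson exp_ge_zero mult_left_mono order_trans)
    also have "\<dots> = exp (E * (real (Suc k) * T)) * G y" by (simp add: algebra_simps exp_add)
    finally show ?case .
  qed simp
  have Bk: "G (y - real k * T) \<le> exp (E * (real k * T)) * G y" for y k
  proof (induction k)
    case (Suc k)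
    have "G (y - real (Suc k) * T) \<le> exp (E * T) * G (y - real (Suc k) * T + T)" by (rule bwd)
    also have "\<dots> = exp (E * T) * G (y - real k * T)" by (simp add: algebra_simps)
    also have "\<dots> \<le> exp (E * T) * (exp (E * (real k * T)) * G y)" using Suc by simp
    also have "\<dots> = exp (E * (real (Suc k) * T)) * G y" by (simp add: algebra_simps exp_add)
    finally show ?case .
  qed simp
  have "G x \<le> (B0 * exp (E * T)) * exp (E * \<bar>x\<bar>)" for x
  proof (cases "x \<ge> 0")
    case True
    define k where "k = nat \<lfloor>x / T\<rfloor>"
    have k: "real k = of_int \<lfloor>x / T\<rfloor>" using True T by (simp add: k_def)
    have y: "x - real k * T \<in> {0..T}"
      using floor_divide_lower[OF T, of x] floor_divide_upper[OF T, of x] unfolding k by (auto simp: algebra_simps)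
    have "G x \<le> exp (E * (real k * T)) * G (x - real k * T)" using F[of "x - real k * T" k] by simp
    also have "\<dots> \<le> exp (E * (T + \<bar>x\<bar>)) * B0"
      using y y0[OF y] E G0 True T by (intro mult_mono) (auto simp: B0_def intro!: mult_left_mono)
    finally show ?thesis by (simp add: ring_distribs exp_add mult_ac)
  next
    case False
    define k where "k = nat \<lceil>- x / T\<rceil>"
    have k: "real k = of_int \<lceil>- x / T\<rceil>" using False T by (simp add: k_def divide_nonpos_pos)
    have y: "x + real k * T \<in> {0..T}"
      using ceiling_divide_lower[OF T, of "- x"] ceiling_divide_upper[OF T, of "- x"] unfolding k
      by (auto simp: algebra_simps)
    have "G x \<le> exp (E * (real k * T)) * G (x + real k * T)" using Bk[of "x + real k * T" k] by simp
    also have "\<dots> \<le> exp (E * (T + \<bar>x\<bar>)) * B0"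
      using y y0[OF y] E G0 False T by (intro mult_mono) (auto simp: B0_def intro!: mult_left_mono)
    finally show ?thesis by (simp add: ring_distribs exp_add mult_ac)
  qed
  moreover have "B0 * exp (E * T) \<ge> 0" using B0 by simp
  ultimately show ?thesis by blast
qed

text \<open>
  The relations describe a triangular block, whose eigenvalues have modulus between \<open>exp((\<nu> - C)T)\<close>
  and \<open>exp((\<nu> + C)T)\<close>. Giving the second
  function a small weight \<open>\<eta>\<close> makes the off-diagonal entry harmless, at the price of the \<open>1/2\<close>
  in the exponent.
\<close>

lemma floquet_pair_growth:
  fixes f1 f2 :: "real \<Rightarrow> complex"
  assumes T: "T > 0" and C: "C \<ge> 0"
    and cont: "continuous_on UNIV f1" "continuous_on UNIV f2"
    and s1: "\<And>x. f1 (x + T) = \<mu>1 * f1 x" and s2: "\<And>x. f2 (x + T) = \<mu>2 * f2 x + \<gamma> * f1 x"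
    and r1: "\<mu>1 \<noteq> 0" "\<bar>ln (norm \<mu>1) / T - \<nu>\<bar> \<le> C" and r2: "\<mu>2 \<noteq> 0" "\<bar>ln (norm \<mu>2) / T - \<nu>\<bar> \<le> C"
  shows "\<exists>B\<ge>0. \<forall>x. norm (f1 x) \<le> B * exp (\<nu> * x + (C + 1/2) * \<bar>x\<bar>) \<and> norm (f2 x) \<le> B * exp (\<nu> * x + (C + 1/2) * \<bar>x\<bar>)"
proof -
  define b where "b = exp (C * T)"
  have b: "b \<ge> 1" using T C by (simp add: b_def)
  have up: "norm \<mu> * exp (- (\<nu> * T)) \<le> b" and down: "1 \<le> b * (norm \<mu> * exp (- (\<nu> * T)))"
    if "\<mu> \<noteq> 0" "\<bar>ln (norm \<mu>) / T - \<nu>\<bar> \<le> C" for \<mu> :: complex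
  proof -
    have "norm \<mu> * exp (- (\<nu> * T)) = exp (ln (norm \<mu>) - \<nu> * T)" using that(1) by (simp add: exp_diff exp_minus field_simps)
    moreover have "\<bar>ln (norm \<mu>) - \<nu> * T\<bar> \<le> C * T"
    proof -
      have "ln (norm \<mu>) - \<nu> * T = (ln (norm \<mu>) / T - \<nu>) * T" using T by (simp add: field_simps)
      then show ?thesis using that(2) T by (simp add: abs_mult)
    qed
    ultimately show "norm \<mu> * exp (- (\<nu> * T)) \<le> b" "1 \<le> b * (norm \<mu> * exp (- (\<nu> * T)))"
      by (auto simp: b_def simp flip: exp_add)
  qed
  define c where "c = norm \<gamma> * exp (- (\<nu> * T))"
  have c: "c \<ge> 0" by (simp add: c_def)
  \<comment> \<open>Chosen such that \<open>1 + \<eta> b c \<le> exp (T / 2)\<close>; the summand \<open>1\<close> allows for \<open>c = 0\<close>.\<close>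
  define \<eta> where "\<eta> = (exp (T / 2) - 1) / (b * c + 1)"
  have bc: "b * c + 1 > 0" using b c by (simp add: add_nonneg_pos)
  have \<eta>: "\<eta> > 0" using T bc by (simp add: \<eta>_def)
  have "\<eta> * (b * c) \<le> \<eta> * (b * c + 1)" using \<eta> by (intro mult_left_mono) auto
  also have "\<dots> = exp (T / 2) - 1" using bc by (simp add: \<eta>_def)
  finally have \<eta>2: "1 + \<eta> * (b * c) \<le> exp (T / 2)" by simp
  define g1 where "g1 = (\<lambda>x. norm (f1 x) * exp (- (\<nu> * x)))"
  define g2 where "g2 = (\<lambda>x. norm (f2 x) * exp (- (\<nu> * x)))"
  have g0: "g1 x \<ge> 0" "g2 x \<ge> 0" for x by (auto simp: g1_def g2_def)
  define G where "G = (\<lambda>x. g1 x + \<eta> * g2 x)"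
  have e: "exp (- (\<nu> * (x + T))) = exp (- (\<nu> * T)) * exp (- (\<nu> * x))" for x
    by (simp add: algebra_simps flip: exp_add)
  have q: "exp ((C + 1/2) * T) = b * exp (T / 2)" by (simp add: b_def algebra_simps flip: exp_add)
  have g1T: "g1 (x + T) = norm \<mu>1 * exp (- (\<nu> * T)) * g1 x" for x
    by (simp add: g1_def s1 norm_mult e)
  have g1f: "g1 (x + T) \<le> b * g1 x" for x
    unfolding g1T using up[OF r1] g0 by (intro mult_right_mono) auto
  have g1b: "g1 x \<le> b * g1 (x + T)" for x
    using mult_right_mono[OF down[OF r1] g0(1)[of x]] by (simp add: g1T mult_ac)
  have g2f: "g2 (x + T) \<le> b * g2 x + c * g1 x" for x
  proof -
    have "g2 (x + T) \<le> (norm \<mu>2 * norm (f2 x) + norm \<gamma> * norm (f1 x)) * exp (- (\<nu> * (x + T)))"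
      unfolding g2_def s2 using norm_triangle_ineq[of "\<mu>2 * f2 x" "\<gamma> * f1 x"]
      by (intro mult_right_mono) (auto simp: norm_mult)
    also have "\<dots> = norm \<mu>2 * exp (- (\<nu> * T)) * g2 x + c * g1 x"
      unfolding g1_def g2_def c_def e by (simp only: ring_distribs mult_ac)
    also have "\<dots> \<le> b * g2 x + c * g1 x"
      using up[OF r2] g0 by (intro add_right_mono mult_right_mono) auto
    finally show ?thesis .
  qed
  have g2b: "g2 x \<le> b * (g2 (x + T) + c * g1 x)" for x
  proof -
    have "g2 x \<le> b * (norm \<mu>2 * exp (- (\<nu> * T))) * g2 x"
      using mult_right_mono[OF down[OF r2] g0(2)[of x]] by simp
    also have "norm (f2 x) * norm \<mu>2 \<le> norm (f2 (x + T)) + norm \<gamma> * norm (f1 x)"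
      using norm_triangle_ineq4[of "f2 (x + T)" "\<gamma> * f1 x"] by (simp add: s2 norm_mult mult.commute)
    then have "b * (norm \<mu>2 * exp (- (\<nu> * T))) * g2 x
        \<le> b * ((norm (f2 (x + T)) + norm \<gamma> * norm (f1 x)) * exp (- (\<nu> * (x + T))))"
      using b unfolding g2_def e by (simp add: mult_ac)
    also have "\<dots> = b * (g2 (x + T) + c * g1 x)"
      unfolding g1_def g2_def c_def e by (simp only: ring_distribs mult_ac)
    finally show ?thesis .
  qed
  have "\<exists>B\<ge>0. \<forall>x. G x \<le> B * exp ((C + 1/2) * \<bar>x\<bar>)"
  proof (rule quasi_periodic_growth[OF T])
    show "continuous_on UNIV G"
      unfolding G_def g1_def g2_def by (intro continuous_intros cont)
    show "G x \<ge> 0" for x using g0 \<eta> by (simp add: G_def)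
    show "G (x + T) \<le> exp ((C + 1/2) * T) * G x" for x
    proof -
      have "G (x + T) \<le> b * g1 x + \<eta> * (b * g2 x + c * g1 x)"
        unfolding G_def using g1f g2f \<eta> by (intro add_mono mult_left_mono) auto
      also have "\<dots> \<le> b * g1 x + \<eta> * (b * g2 x + b * b * c * g1 x)"
      proof -
        have "1 * (c * g1 x) \<le> (b * b) * (c * g1 x)"
          using b c g0(1)[of x] mult_mono[OF b b] by (intro mult_right_mono) auto
        then show ?thesis using \<eta> by (simp add: mult_ac)
      qed
      also have "\<dots> = b * ((1 + \<eta> * (b * c)) * g1 x + 1 * (\<eta> * g2 x))" by (simp add: algebra_simps)
      also have "\<dots> \<le> b * (exp (T / 2) * g1 x + exp (T / 2) * (\<eta> * g2 x))"
        using \<eta>2 \<eta> b g0[of x] T by (intro mult_left_mono add_mono mult_right_mono) auto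
      also have "\<dots> = exp ((C + 1/2) * T) * G x" unfolding q G_def by (simp only: ring_distribs mult_ac)
      finally show ?thesis .
    qed
    show "G x \<le> exp ((C + 1/2) * T) * G (x + T)" for x
    proof -
      have "G x \<le> g1 x + \<eta> * (b * (g2 (x + T) + c * g1 x))"
        unfolding G_def using g2b \<eta> by (intro add_mono mult_left_mono) auto
      also have "\<dots> = (1 + \<eta> * (b * c)) * g1 x + b * (\<eta> * g2 (x + T))" by (simp add: algebra_simps)
      also have "\<dots> \<le> exp (T / 2) * (b * g1 (x + T)) + b * (exp (T / 2) * (\<eta> * g2 (x + T)))"
      proof (rule add_mono)
        show "(1 + \<eta> * (b * c)) * g1 x \<le> exp (T / 2) * (b * g1 (x + T))"
          by (rule mult_mono[OF \<eta>2 g1b]) (use g0 in auto)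
        have "1 * (\<eta> * g2 (x + T)) \<le> exp (T / 2) * (\<eta> * g2 (x + T))"
          using \<eta> T g0(2)[of "x + T"] by (intro mult_right_mono) auto
        then show "b * (\<eta> * g2 (x + T)) \<le> b * (exp (T / 2) * (\<eta> * g2 (x + T)))"
          using b by (intro mult_left_mono) auto
      qed
      also have "\<dots> = exp ((C + 1/2) * T) * G (x + T)" unfolding q G_def by (simp only: ring_distribs mult_ac)
      finally show ?thesis .
    qed
  qed (use C in auto)
  then obtain B where B: "B \<ge> 0" "\<And>x. G x \<le> B * exp ((C + 1/2) * \<bar>x\<bar>)" by blast
  have n1: "norm (f1 x) = g1 x * exp (\<nu> * x)" "norm (f2 x) = g2 x * exp (\<nu> * x)" for x
    by (simp_all add: g1_def g2_def flip: exp_add)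
  have "norm (f1 x) \<le> (B + B / \<eta>) * exp (\<nu> * x + (C + 1/2) * \<bar>x\<bar>)
      \<and> norm (f2 x) \<le> (B + B / \<eta>) * exp (\<nu> * x + (C + 1/2) * \<bar>x\<bar>)" for x
  proof -
    define E where "E = exp ((C + 1/2) * \<bar>x\<bar>)"
    have E: "E > 0" by (simp add: E_def)
    have "g1 x \<le> G x" using g0(2)[of x] \<eta> by (simp add: G_def)
    moreover have "g2 x \<le> G x / \<eta>"
      using g0(1)[of x] \<eta> by (simp add: pos_le_divide_eq G_def mult.commute)
    ultimately have "g1 x \<le> B * E" "g2 x \<le> B / \<eta> * E"
      using B(2)[of x] \<eta> divide_right_mono[of "G x" "B * E" \<eta>] by (auto simp: E_def)
    moreover have "B * E \<le> (B + B / \<eta>) * E" "B / \<eta> * E \<le> (B + B / \<eta>) * E"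
      using B(1) \<eta> E by (simp_all add: distrib_right)
    ultimately have "g1 x \<le> (B + B / \<eta>) * E" "g2 x \<le> (B + B / \<eta>) * E" by linarith+
    then have "g1 x * exp (\<nu> * x) \<le> (B + B / \<eta>) * E * exp (\<nu> * x)" "g2 x * exp (\<nu> * x) \<le> (B + B / \<eta>) * E * exp (\<nu> * x)"
      by (auto intro!: mult_right_mono)
    then show ?thesis by (simp add: n1 E_def exp_add mult_ac)
  qed
  moreover have "B + B / \<eta> \<ge> 0" using B(1) \<eta> by simp
  ultimately show ?thesis by blast
qed

text \<open>
  The relation with \<open>\<gamma>\<close> covers two independent Floquet solutions as well as a Jordan block. Some
  nontrivial combination of \<open>w1\<close> and \<open>w2\<close> has vanishing component \<open>j\<close> at \<open>0\<close>; it grows too slowly to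
  be different from zero.
\<close>

lemma no_two_multipliers_near_one_exponent:
  assumes nd: "\<And>\<alpha> \<beta>. nearly_diagonal n \<kappa> C (\<lambda>x k. \<alpha> * w1 x k + \<beta> * w2 x k)"
    and T: "T > 0" and j: "j < n"
    and s1: "\<And>x k. k < n \<Longrightarrow> w1 (x + T) k = \<mu>1 * w1 x k"
    and s2: "\<And>x k. k < n \<Longrightarrow> w2 (x + T) k = \<mu>2 * w2 x k + \<gamma> * w1 x k"
    and r1: "\<mu>1 \<noteq> 0" "\<bar>ln (norm \<mu>1) / T - Re (\<kappa> j)\<bar> \<le> C"
    and r2: "\<mu>2 \<noteq> 0" "\<bar>ln (norm \<mu>2) / T - Re (\<kappa> j)\<bar> \<le> C"
    and gap: "\<And>k. k < n \<Longrightarrow> k \<noteq> j \<Longrightarrow> \<bar>Re (\<kappa> k) - Re (\<kappa> j)\<bar> > 2 * C + 1"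
    and indep: "\<And>\<alpha> \<beta>. (\<And>x k. k < n \<Longrightarrow> \<alpha> * w1 x k + \<beta> * w2 x k = 0) \<Longrightarrow> \<alpha> = 0 \<and> \<beta> = 0"
  shows False
proof -
  define \<nu> where "\<nu> = Re (\<kappa> j)"
  have C: "C \<ge> 0" by (rule nearly_diagonal_bound_nonneg[OF nd j])
  have cont: "continuous_on UNIV (\<lambda>x. w1 x k)" "continuous_on UNIV (\<lambda>x. w2 x k)" if "k < n" for k
    using nearly_diagonal_continuous[OF nd[of 1 0] that] nearly_diagonal_continuous[OF nd[of 0 1] that] by auto
  have "\<exists>B\<ge>0. \<forall>x. norm (w1 x k) \<le> B * exp (\<nu> * x + (C + 1/2) * \<bar>x\<bar>) \<and> norm (w2 x k) \<le> B * exp (\<nu> * x + (C + 1/2) * \<bar>x\<bar>)"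
    if k: "k < n" for k
    by (rule floquet_pair_growth[OF T C cont[OF k] s1[OF k] s2[OF k] r1[folded \<nu>_def] r2[folded \<nu>_def]])
  then obtain B where B: "\<And>k. k < n \<Longrightarrow> B k \<ge> 0"
    "\<And>k x. k < n \<Longrightarrow> norm (w1 x k) \<le> B k * exp (\<nu> * x + (C + 1/2) * \<bar>x\<bar>)"
    "\<And>k x. k < n \<Longrightarrow> norm (w2 x k) \<le> B k * exp (\<nu> * x + (C + 1/2) * \<bar>x\<bar>)" by metis
  define B' where "B' = (\<Sum>k<n. B k)"
  have B': "B k \<le> B'" if "k < n" for k
    unfolding B'_def using that B(1) by (intro member_le_sum) auto
  \<comment> \<open>A nontrivial linear functional on a plane has a nonzero kernel.\<close>
  obtain \<alpha> \<beta> where \<alpha>\<beta>: "\<alpha> * w1 0 j + \<beta> * w2 0 j = 0" "\<not> (\<alpha> = 0 \<and> \<beta> = 0)"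
  proof (cases "w1 0 j = 0 \<and> w2 0 j = 0")
    case True then show thesis using that[of 1 0] by simp
  next
    case False then show thesis using that[of "w2 0 j" "- w1 0 j"] by auto
  qed
  have "\<alpha> * w1 x k + \<beta> * w2 x k = 0" if k: "k < n" for x k
  proof (rule slow_solution_vanishing_component[OF nd j, where D = "C + 1" and D' = "C + 1/2" and B = "(norm \<alpha> + norm \<beta>) * B'"])
    fix x m assume m: "m < n"
    define e where "e = exp (\<nu> * x + (C + 1/2) * \<bar>x\<bar>)"
    have "norm (\<alpha> * w1 x m + \<beta> * w2 x m) \<le> norm \<alpha> * norm (w1 x m) + norm \<beta> * norm (w2 x m)"
      by (metis norm_mult norm_triangle_ineq)
    also have "\<dots> \<le> norm \<alpha> * (B' * e) + norm \<beta> * (B' * e)"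
    proof -
      have "B m * e \<le> B' * e" using B'[OF m] by (intro mult_right_mono) (auto simp: e_def)
      then show ?thesis using B(2,3)[OF m, of x]
        by (intro add_mono mult_left_mono) (auto simp: e_def elim: order_trans)
    qed
    finally show "norm (\<alpha> * w1 x m + \<beta> * w2 x m) \<le> (norm \<alpha> + norm \<beta>) * B' * exp (Re (\<kappa> j) * x + (C + 1/2) * \<bar>x\<bar>)"
      by (simp add: e_def \<nu>_def algebra_simps)
  qed (use gap \<alpha>\<beta>(1) k in force)+
  then show False using indep \<alpha>\<beta>(2) by blast
qed

section \<open>The exponents and the coordinates adapted to them\<close>

definition unit_root :: "nat \<Rightarrow> nat \<Rightarrow> complex" where
  "unit_root n k = exp (2 * of_real pi * \<i> * of_nat k / of_nat n)"

lemma unit_root_power: "n > 0 \<Longrightarrow> unit_root n k ^ n = 1"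
  unfolding unit_root_def by (rule complex_root_unity) simp

lemma unit_root_eq_power: "unit_root n k = unit_root n 1 ^ k"
  by (simp add: unit_root_def algebra_simps flip: exp_of_nat_mult)

lemma norm_unit_root: "norm (unit_root n k) = 1"
  by (simp add: unit_root_def)

lemma unit_root_eq_iff: "i < n \<Longrightarrow> j < n \<Longrightarrow> unit_root n i = unit_root n j \<longleftrightarrow> i = j"
  unfolding unit_root_def using complex_root_unity_eq[of n i j] by simp

text \<open>
  All \<open>n\<close>-th roots of \<open>l\<close>, in cyclic order starting from one of them.
\<close>

definition exponents :: "nat \<Rightarrow> complex \<Rightarrow> (nat \<Rightarrow> complex) \<Rightarrow> bool" where
  "exponents n l \<kappa> \<longleftrightarrow> (\<exists>c. c \<noteq> 0 \<and> c ^ n = l \<and> (\<forall>k. \<kappa> k = c * unit_root n k))"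

lemma exponents_power: "exponents n l \<kappa> \<Longrightarrow> n > 0 \<Longrightarrow> \<kappa> k ^ n = l"
  by (auto simp: exponents_def power_mult_distrib unit_root_power)

lemma exponents_norm:
  assumes "exponents n l \<kappa>"
  shows "norm (\<kappa> k) = norm (\<kappa> j)"
  using assms by (auto simp: exponents_def norm_mult norm_unit_root)

lemma exponents_nonzero: "exponents n l \<kappa> \<Longrightarrow> \<kappa> k \<noteq> 0"
  by (auto simp: exponents_def unit_root_def)

lemma exponents_norm_ge_1:
  assumes "exponents n l \<kappa>" "n > 0" "norm l \<ge> 1"
  shows "norm (\<kappa> k) \<ge> 1"
proof (rule ccontr)
  assume "\<not> norm (\<kappa> k) \<ge> 1"
  then have "norm (\<kappa> k) ^ n < 1" using assms(2) by (intro power_Suc_less_one[of _ "n - 1", simplified] | simp add: power_less_one_iff)+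
  then show False using assms exponents_power[OF assms(1,2), of k] by (simp flip: norm_power)
qed

text \<open>
  Orthogonality of the characters of the cyclic group of order \<open>n\<close>.
\<close>

lemma exponents_orthogonal:
  assumes "exponents n l \<kappa>" and i: "i < n" and m: "m < n"
  shows "(\<Sum>k<n. \<kappa> k ^ i / \<kappa> k ^ m) = (if i = m then of_nat n else 0)"
proof -
  obtain c where c: "c \<noteq> 0" "\<And>k. \<kappa> k = c * unit_root n k" using assms(1) by (auto simp: exponents_def)
  define z where "z = unit_root n i / unit_root n m"
  have u0: "unit_root n k \<noteq> 0" for k by (simp add: unit_root_def)
  have swap: "unit_root n k ^ i = unit_root n i ^ k" for i k
    by (metis mult.commute power_mult unit_root_eq_power)
  have quot: "\<kappa> k ^ i / \<kappa> k ^ m = c ^ i / c ^ m * z ^ k" for k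
    by (simp add: c(2) z_def power_mult_distrib swap power_divide)
  show ?thesis
  proof (cases "i = m")
    case True
    then show ?thesis using exponents_nonzero[OF assms(1)] by simp
  next
    case False
    have "z \<noteq> 1" using False i m u0 unit_root_eq_iff[OF i m] by (simp add: z_def)
    moreover have "z ^ n = 1" using i by (simp add: z_def power_divide unit_root_power)
    ultimately have "(\<Sum>k<n. z ^ k) = 0" by (simp add: geometric_sum)
    then show ?thesis using False unfolding quot sum_distrib_left[symmetric] by simp
  qed
qed

lemma finite_positive_lower_bound:
  fixes f :: "'a \<Rightarrow> real"
  assumes "finite S" "\<And>x. x \<in> S \<Longrightarrow> f x > 0"
  shows "\<exists>g>0. \<forall>x\<in>S. f x \<ge> g"
proof (cases "S = {}")
  case False
  then have "Min (f ` S) > 0" using assms by simp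
  moreover have "\<forall>x\<in>S. f x \<ge> Min (f ` S)" using assms(1) by simp
  ultimately show ?thesis by blast
qed (auto intro: exI[of _ 1])

text \<open>
  Roots with the same modulus and the same real part are equal or complex conjugate, and a conjugate
  pair of roots would make \<open>l\<close> real.
\<close>

lemma real_parts_of_roots_distinct:
  assumes e: "exponents n l \<kappa>" and l: "Im l \<noteq> 0" and ij: "i < n" "j < n" "i \<noteq> j"
  shows "Re (\<kappa> i) \<noteq> Re (\<kappa> j)"
proof
  assume re: "Re (\<kappa> i) = Re (\<kappa> j)"
  have n: "n > 0" using ij by simp
  have "(Re (\<kappa> i))\<^sup>2 + (Im (\<kappa> i))\<^sup>2 = (Re (\<kappa> j))\<^sup>2 + (Im (\<kappa> j))\<^sup>2"
    using exponents_norm[OF e, of i j] by (simp flip: cmod_power2)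
  then have "Im (\<kappa> i) = Im (\<kappa> j) \<or> Im (\<kappa> i) = - Im (\<kappa> j)"
    using re by (simp add: power2_eq_iff)
  then show False
  proof
    assume "Im (\<kappa> i) = Im (\<kappa> j)"
    then have "\<kappa> i = \<kappa> j" using re by (simp add: complex_eq_iff)
    then have "unit_root n i = unit_root n j" using e by (auto simp: exponents_def)
    then show False using unit_root_eq_iff ij by blast
  next
    assume "Im (\<kappa> i) = - Im (\<kappa> j)"
    then have "\<kappa> i = cnj (\<kappa> j)" using re by (simp add: complex_eq_iff)
    then have "l = cnj l"
      using exponents_power[OF e n, of i] exponents_power[OF e n, of j] by (metis complex_cnj_power)
    then have "Im l = - Im l" by (metis complex_cnj cnj.sel(2))
    then show False using l by simp
  qed
qed

text \<open>
  Write \<open>l = is z\<close> with \<open>z\<close> in a fixed disc around \<open>1\<close>. The roots of \<open>l\<close> are \<open>|s|\<^sup>1\<^sup>/\<^sup>n\<close> times those of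
  \<open>i\<close> or \<open>-i\<close>, times the principal root of \<open>z\<close>, and the last factor is so close to \<open>1\<close> that it
  preserves half of the gaps between the real parts. That the discs have radius proportional to
  \<open>|s|\<close> is what Cauchy's inequality needs later.
\<close>

lemma exponents_near_imaginary_axis:
  assumes n: "n > 0"
  obtains \<delta> g where "0 < \<delta>" "\<delta> \<le> 1/2" "g > 0"
    "\<And>s :: real. s \<noteq> 0 \<Longrightarrow> \<exists>\<kappa>. (\<forall>k. \<kappa> k holomorphic_on ball (\<i> * s) (\<delta> * \<bar>s\<bar>)) \<and>
       (\<forall>l\<in>ball (\<i> * s) (\<delta> * \<bar>s\<bar>). exponents n l (\<lambda>k. \<kappa> k l) \<and>
          (\<forall>i<n. \<forall>j<n. i \<noteq> j \<longrightarrow> \<bar>Re (\<kappa> i l) - Re (\<kappa> j l)\<bar> \<ge> g * root n \<bar>s\<bar>))"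
proof -
  define \<tau> where "\<tau> = (\<lambda>z. exp (Ln z / of_nat n))"
  have \<tau>n: "\<tau> z ^ n = z" if "z \<noteq> 0" for z
    using that n by (simp add: \<tau>_def flip: exp_of_nat_mult)
  have \<tau>1: "\<tau> 1 = 1" by (simp add: \<tau>_def)
  define \<zeta> where "\<zeta> = (\<lambda>(\<sigma>::complex) k. \<tau> \<sigma> * unit_root n k)"
  have \<zeta>e: "exponents n \<sigma> (\<zeta> \<sigma>)" if "\<sigma> \<noteq> 0" for \<sigma>
    using \<tau>n[OF that] unfolding exponents_def \<zeta>_def by (intro exI[of _ "\<tau> \<sigma>"]) (auto simp: \<tau>_def)
  define S where "S = {(\<sigma>, i, j). \<sigma> \<in> {\<i>, - \<i>} \<and> i < n \<and> j < n \<and> i \<noteq> j}"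
  have "finite S"
    by (rule finite_subset[of _ "{\<i>, - \<i>} \<times> {..<n} \<times> {..<n}"]) (auto simp: S_def)
  moreover have "(\<lambda>(\<sigma>, i, j). \<bar>Re (\<zeta> \<sigma> i) - Re (\<zeta> \<sigma> j)\<bar>) x > 0" if "x \<in> S" for x
  proof -
    obtain \<sigma> i j where x: "x = (\<sigma>, i, j)" by (cases x)
    have "\<sigma> \<noteq> 0" "Im \<sigma> \<noteq> 0" "i < n" "j < n" "i \<noteq> j" using that by (auto simp: S_def x)
    then show ?thesis using real_parts_of_roots_distinct[OF \<zeta>e] by (simp add: x)
  qed
  ultimately have "\<exists>g>0. \<forall>x\<in>S. (\<lambda>(\<sigma>, i, j). \<bar>Re (\<zeta> \<sigma> i) - Re (\<zeta> \<sigma> j)\<bar>) x \<ge> g"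
    by (rule finite_positive_lower_bound)
  then obtain g0 where g0: "g0 > 0"
    and "\<forall>x\<in>S. (\<lambda>(\<sigma>, i, j). \<bar>Re (\<zeta> \<sigma> i) - Re (\<zeta> \<sigma> j)\<bar>) x \<ge> g0" by blast
  then have gap: "\<bar>Re (\<zeta> \<sigma> i) - Re (\<zeta> \<sigma> j)\<bar> \<ge> g0" if "(\<sigma>, i, j) \<in> S" for \<sigma> i j
    using that by (auto dest: bspec)
  have "isCont \<tau> 1"
    unfolding \<tau>_def using n by (intro continuous_intros) auto
  then obtain d where d: "d > 0" "\<And>z. dist z 1 < d \<Longrightarrow> dist (\<tau> z) (\<tau> 1) < g0 / 4"
    using g0 unfolding continuous_at_eps_delta by (metis divide_pos_pos zero_less_numeral)
  define \<delta> where "\<delta> = min d (1/2)"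
  show thesis
  proof (rule that[of \<delta> "g0 / 2"])
    show "0 < \<delta>" "\<delta> \<le> 1/2" "g0 / 2 > 0" using d g0 by (auto simp: \<delta>_def)
    fix s :: real assume s: "s \<noteq> 0"
    define \<sigma> where "\<sigma> = \<i> * of_real (sgn s)"
    have \<sigma>: "\<sigma> \<in> {\<i>, - \<i>}" "\<sigma> \<noteq> 0" using s by (auto simp: \<sigma>_def sgn_if)
    define \<rho> where "\<rho> = root n \<bar>s\<bar>"
    have \<rho>: "\<rho> > 0" "\<rho> ^ n = \<bar>s\<bar>" using s n by (auto simp: \<rho>_def)
    define \<kappa> where "\<kappa> = (\<lambda>k l. of_real \<rho> * \<zeta> \<sigma> k * \<tau> (l / (\<i> * s)))"
    have near: "dist (l / (\<i> * s)) 1 < \<delta>" if "l \<in> ball (\<i> * s) (\<delta> * \<bar>s\<bar>)" for l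
    proof -
      have "l / (\<i> * s) - 1 = (l - \<i> * s) / (\<i> * s)" using s by (simp add: diff_divide_distrib)
      then have "dist (l / (\<i> * s)) 1 = dist (\<i> * s) l / \<bar>s\<bar>"
        by (simp add: dist_norm norm_divide norm_mult norm_minus_commute)
      then show ?thesis using that s by (simp add: divide_less_eq)
    qed
    have slit: "l / (\<i> * s) \<notin> \<real>\<^sub>\<le>\<^sub>0" if "l \<in> ball (\<i> * s) (\<delta> * \<bar>s\<bar>)" for l
    proof
      assume "l / (\<i> * s) \<in> \<real>\<^sub>\<le>\<^sub>0"
      then have "Re (l / (\<i> * s)) \<le> 0" by (simp add: complex_nonpos_Reals_iff)
      moreover have "\<bar>Re (l / (\<i> * s) - 1)\<bar> < 1/2"
        using near[OF that] abs_Re_le_cmod[of "l / (\<i> * s) - 1"] unfolding dist_norm \<delta>_def by linarith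
      ultimately show False by simp
    qed
    show "\<exists>\<kappa>. (\<forall>k. \<kappa> k holomorphic_on ball (\<i> * s) (\<delta> * \<bar>s\<bar>)) \<and>
       (\<forall>l\<in>ball (\<i> * s) (\<delta> * \<bar>s\<bar>). exponents n l (\<lambda>k. \<kappa> k l) \<and>
          (\<forall>i<n. \<forall>j<n. i \<noteq> j \<longrightarrow> \<bar>Re (\<kappa> i l) - Re (\<kappa> j l)\<bar> \<ge> g0 / 2 * root n \<bar>s\<bar>))"
    proof (intro exI[of _ \<kappa>] conjI allI ballI impI)
      fix k
      show "\<kappa> k holomorphic_on ball (\<i> * s) (\<delta> * \<bar>s\<bar>)"
        unfolding \<kappa>_def \<tau>_def using slit s n by (intro holomorphic_intros) auto
    next
      fix l assume l: "l \<in> ball (\<i> * s) (\<delta> * \<bar>s\<bar>)"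
      define t where "t = \<tau> (l / (\<i> * s))"
      have l0: "l / (\<i> * s) \<noteq> 0" using slit[OF l] by auto
      have tn: "t ^ n = l / (\<i> * s)" unfolding t_def by (rule \<tau>n[OF l0])
      have "(of_real \<rho> * \<tau> \<sigma> * t) ^ n = of_real (\<rho> ^ n) * \<sigma> * (l / (\<i> * s))"
        by (simp add: power_mult_distrib tn \<tau>n[OF \<sigma>(2)])
      also have "\<dots> = l" using s by (simp add: \<rho>(2) \<sigma>_def sgn_if abs_if)
      finally have "(of_real \<rho> * \<tau> \<sigma> * t) ^ n = l" .
      then show "exponents n l (\<lambda>k. \<kappa> k l)"
        using \<rho>(1) unfolding exponents_def
        by (intro exI[of _ "of_real \<rho> * \<tau> \<sigma> * t"]) (auto simp: \<kappa>_def \<zeta>_def t_def \<tau>_def)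
      fix i j assume ij: "i < n" "j < n" "i \<noteq> j"
      have t1: "norm (t - 1) \<le> g0 / 4"
        using d(2)[of "l / (\<i> * s)"] near[OF l] by (simp add: t_def \<tau>1 dist_norm \<delta>_def)
      have "norm (\<tau> \<sigma>) = 1"
      proof -
        have "norm (\<tau> \<sigma>) ^ n = 1" using \<tau>n[OF \<sigma>(2)] \<sigma>(1) by (auto simp flip: norm_power)
        then show ?thesis using n power_eq_1_iff[of "norm (\<tau> \<sigma>)" n] by auto
      qed
      then have n\<zeta>: "norm (\<zeta> \<sigma> k) = 1" for k by (simp add: \<zeta>_def norm_mult norm_unit_root)
      define D where "D = \<zeta> \<sigma> i - \<zeta> \<sigma> j"
      have D2: "norm D \<le> 2" using norm_triangle_ineq4[of "\<zeta> \<sigma> i" "\<zeta> \<sigma> j"] n\<zeta> by (simp add: D_def)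
      have Dg: "\<bar>Re D\<bar> \<ge> g0" using gap[of \<sigma> i j] ij \<sigma> by (auto simp: S_def D_def)
      have "Re (D * t) = Re D + Re (D * (t - 1))" by (simp add: algebra_simps)
      moreover have "\<bar>Re (D * (t - 1))\<bar> \<le> 2 * (g0 / 4)"
        using abs_Re_le_cmod[of "D * (t - 1)"] mult_mono[OF D2 t1] by (simp add: norm_mult)
      ultimately have "\<bar>Re (D * t)\<bar> \<ge> g0 / 2" using Dg by linarith
      then have "\<rho> * \<bar>Re (D * t)\<bar> \<ge> \<rho> * (g0 / 2)" using \<rho>(1) by (intro mult_left_mono) auto
      moreover have "Re (\<kappa> i l) - Re (\<kappa> j l) = \<rho> * Re (D * t)"
        by (simp add: \<kappa>_def D_def t_def algebra_simps)
      ultimately show "\<bar>Re (\<kappa> i l) - Re (\<kappa> j l)\<bar> \<ge> g0 / 2 * root n \<bar>s\<bar>"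
        using \<rho>(1) by (simp add: abs_mult \<rho>_def mult_ac)
    qed
  qed
qed

text \<open>
  The inverse of the Vandermonde matrix of the roots \<open>\<kappa>\<close>, applied to the vector of derivatives.
\<close>

definition mode_coord :: "nat \<Rightarrow> (nat \<Rightarrow> complex) \<Rightarrow> (real \<Rightarrow> nat \<Rightarrow> complex) \<Rightarrow> real \<Rightarrow> nat \<Rightarrow> complex" where
  "mode_coord n \<kappa> v x k = (\<Sum>m<n. v x m / \<kappa> k ^ m) / of_nat n"

lemma mode_coord_inverse:
  assumes "exponents n l \<kappa>" "i < n"
  shows "v x i = (\<Sum>k<n. \<kappa> k ^ i * mode_coord n \<kappa> v x k)"
proof -
  have "(\<Sum>k<n. \<kappa> k ^ i * mode_coord n \<kappa> v x k) = (\<Sum>k<n. \<Sum>m<n. v x m / of_nat n * (\<kappa> k ^ i / \<kappa> k ^ m))"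
    by (simp add: mode_coord_def sum_distrib_left sum_divide_distrib mult_ac)
  also have "\<dots> = (\<Sum>m<n. v x m / of_nat n * (\<Sum>k<n. \<kappa> k ^ i / \<kappa> k ^ m))"
    by (subst sum.swap) (simp add: sum_distrib_left)
  also have "\<dots> = (\<Sum>m<n. if m = i then v x i else 0)"
    using assms by (intro sum.cong) (auto simp: exponents_orthogonal[OF assms(1)])
  also have "\<dots> = v x i" using assms(2) by simp
  finally show ?thesis ..
qed

lemma mode_coord_lincomb:
  "mode_coord n \<kappa> (\<lambda>x i. \<alpha> * v x i + \<beta> * w x i) x k = \<alpha> * mode_coord n \<kappa> v x k + \<beta> * mode_coord n \<kappa> w x k"
  by (simp add: mode_coord_def add_divide_distrib sum.distrib sum_distrib_left sum_divide_distrib)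

lemma companion_apply_eq:
  assumes "i < n"
  shows "(\<Sum>j<n. companion_mat n a x l $$ (i, j) * v j)
    = (if Suc i < n then v (Suc i) else l * v 0 - (\<Sum>m<n. of_real (a (n - m) x) * v m))"
proof (cases "Suc i < n")
  case True
  have "(\<Sum>j<n. companion_mat n a x l $$ (i, j) * v j) = (\<Sum>j<n. if j = Suc i then v j else 0)"
    using True assms by (intro sum.cong) (auto simp: companion_mat_def)
  then show ?thesis using True by simp
next
  case False
  have "(\<Sum>j<n. companion_mat n a x l $$ (i, j) * v j) = (\<Sum>j<n. (if j = 0 then l * v j else 0) - of_real (a (n - j) x) * v j)"
    using False assms by (intro sum.cong) (auto simp: companion_mat_def algebra_simps)
  also have "\<dots> = l * v 0 - (\<Sum>m<n. of_real (a (n - m) x) * v m)"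
    using assms by (simp add: sum_subtractf)
  finally show ?thesis using False by simp
qed

text \<open>
  The coefficients \<open>a k\<close> enter the last row of the system only. The change of coordinates divides that
  row by \<open>n \<kappa>\<^sup>n\<^sup>-\<^sup>1\<close>, and the derivative of order \<open>m < n\<close> is at most \<open>n |\<kappa>|\<^sup>m max |w|\<close>, so the powers of
  \<open>\<kappa>\<close> leave a bounded factor as soon as \<open>|\<kappa>| \<ge> 1\<close>.
\<close>

lemma nearly_diagonal_mode_coord:
  assumes A: "\<And>k x. k \<in> {1..n} \<Longrightarrow> \<bar>a k x\<bar> \<le> A" and e: "exponents n l \<kappa>" and l: "norm l \<ge> 1"
    and v: "solves n a l v"
  shows "nearly_diagonal n \<kappa> (n * A) (mode_coord n \<kappa> v)"
  unfolding nearly_diagonal_def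
proof (intro allI impI)
  fix x k assume k: "k < n"
  obtain N where N: "n = Suc N" using k by (cases n) auto
  have n: "n > 0" using k by simp
  have A0: "A \<ge> 0" using A[of n x] n by force
  define q where "q = \<kappa> k"
  define \<rho> where "\<rho> = norm q"
  have \<rho>: "\<rho> \<ge> 1" unfolding \<rho>_def q_def by (rule exponents_norm_ge_1[OF e n l])
  have q0: "q \<noteq> 0" using \<rho> by (auto simp: \<rho>_def)
  have qn: "q ^ n = l" unfolding q_def by (rule exponents_power[OF e n])
  define d where "d = (\<Sum>m<n. (companion_apply n a x l (v x) m) / q ^ m) / of_nat n"
  have der: "((\<lambda>y. mode_coord n \<kappa> v y k) has_vector_derivative d) (at x)"
    unfolding mode_coord_def d_def q_def[symmetric]
    by (intro has_vector_derivative_divide has_vector_derivative_sum solvesD[OF v]) auto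
  define E where "E = (\<Sum>m<n. of_real (a (n - m) x) * v x m)"
  have "(\<Sum>m<n. (companion_apply n a x l (v x) m) / q ^ m)
      = (\<Sum>m<N. v x (Suc m) / q ^ m) + (l * v x 0 - E) / q ^ N"
  proof -
    have "(\<Sum>m<n. (companion_apply n a x l (v x) m) / q ^ m)
        = (\<Sum>m<n. (if Suc m < n then v x (Suc m) else l * v x 0 - E) / q ^ m)"
      by (intro sum.cong) (auto simp: companion_apply_eq E_def)
    then show ?thesis by (simp add: N)
  qed
  also have "(\<Sum>m<N. v x (Suc m) / q ^ m) = q * (\<Sum>m<N. v x (Suc m) / q ^ Suc m)"
    using q0 by (simp add: sum_distrib_left)
  also have "(l * v x 0 - E) / q ^ N = q * v x 0 - E / q ^ N"
    using q0 qn by (simp add: N diff_divide_distrib flip: qn)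
  also have "q * (\<Sum>m<N. v x (Suc m) / q ^ Suc m) + (q * v x 0 - E / q ^ N)
     = q * (\<Sum>m<n. v x m / q ^ m) - E / q ^ N"
    unfolding N by (subst sum.lessThan_Suc_shift) (simp add: algebra_simps)
  finally have diff: "d - q * mode_coord n \<kappa> v x k = - (E / q ^ N / of_nat n)"
    by (simp add: d_def mode_coord_def q_def[symmetric] diff_divide_distrib)
  have "norm (d - q * mode_coord n \<kappa> v x k) \<le> n * A * B" if B: "\<And>m. m < n \<Longrightarrow> norm (mode_coord n \<kappa> v x m) \<le> B" for B
  proof -
    have B0: "B \<ge> 0" using B[OF k] norm_ge_zero order_trans by blast
    have vm: "norm (v x m) \<le> n * (\<rho> ^ N * B)" if m: "m < n" for m
    proof -
      have "norm (v x m) \<le> (\<Sum>k<n. norm (\<kappa> k ^ m * mode_coord n \<kappa> v x k))"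
        by (subst mode_coord_inverse[OF e m]) (rule norm_sum)
      also have "\<dots> \<le> (\<Sum>k<n. \<rho> ^ N * B)"
      proof (rule sum_mono)
        fix i assume i: "i \<in> {..<n}"
        have "norm (\<kappa> i) = \<rho>" unfolding \<rho>_def q_def by (rule exponents_norm[OF e])
        moreover have "\<rho> ^ m \<le> \<rho> ^ N" using m \<rho> by (intro power_increasing) (auto simp: N)
        ultimately show "norm (\<kappa> i ^ m * mode_coord n \<kappa> v x i) \<le> \<rho> ^ N * B"
          using B[of i] i \<rho> by (simp add: norm_mult norm_power mult_mono)
      qed
      finally show ?thesis by simp
    qed
    have "norm E \<le> (\<Sum>m<n. A * (n * (\<rho> ^ N * B)))"
      unfolding E_def
    proof (rule sum_norm_le)
      fix m assume m: "m \<in> {..<n}"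
      have "\<bar>a (n - m) x\<bar> \<le> A" using m by (intro A) auto
      then show "norm (of_real (a (n - m) x) * v x m) \<le> A * (n * (\<rho> ^ N * B))"
        using vm[of m] m A0 by (simp add: norm_mult mult_mono)
    qed
    then have "norm E / (\<rho> ^ N * n) \<le> (n * (A * (n * (\<rho> ^ N * B)))) / (\<rho> ^ N * n)"
      using \<rho> n by (intro divide_right_mono) auto
    also have "\<dots> = n * A * B" using \<rho> n by simp
    finally show ?thesis using \<rho> unfolding diff by (simp add: norm_divide norm_mult norm_power \<rho>_def[symmetric] mult_ac)
  qed
  then show "\<exists>d. ((\<lambda>y. mode_coord n \<kappa> v y k) has_vector_derivative d) (at x) \<and>
      (\<forall>B. (\<forall>m<n. norm (mode_coord n \<kappa> v x m) \<le> B) \<longrightarrow>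
         norm (d - \<kappa> k * mode_coord n \<kappa> v x k) \<le> real n * A * B)"
    using der unfolding q_def by blast
qed

section \<open>Characteristic polynomials of polynomials in a matrix\<close>

abbreviation linear_product :: "complex list \<Rightarrow> complex poly" where
  "linear_product rs \<equiv> \<Prod>r\<leftarrow>rs. [:- r, 1:]"

lemma char_pol_eq_char_poly:
  assumes "M lam \<in> carrier_mat n n"
  shows "char_pol n M lam = Polynomial.smult ((- 1) ^ n) (char_poly (M lam))"
proof -
  have eq: "map_mat (\<lambda>c. [:c:]) (M lam) - [:0, 1:] \<cdot>\<^sub>m 1\<^sub>m n = (- 1) \<cdot>\<^sub>m char_poly_matrix (M lam)"
    using assms by (intro eq_matI) (auto simp: char_poly_matrix_def)
  have dim: "dim_col (char_poly_matrix (M lam)) = n" using char_poly_matrix_closed[OF assms] by blast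
  have "char_pol n M lam = (- 1) ^ n * char_poly (M lam)"
    unfolding char_pol_def eq det_smult dim char_poly_def ..
  also have "(- 1) ^ n = [:(- 1 :: complex) ^ n:]"
  proof (induction n)
    case (Suc n)
    have "(- 1 :: complex poly) ^ Suc n = - [:(- 1) ^ n:]" by (simp only: power_Suc Suc mult_minus1)
    then show ?case by simp
  qed simp
  finally show ?thesis by simp
qed

lemma coeff_prod_holomorphic:
  fixes F :: "'i \<Rightarrow> complex \<Rightarrow> complex poly"
  assumes "finite I" "\<And>i k. i \<in> I \<Longrightarrow> (\<lambda>l. coeff (F i l) k) holomorphic_on S"
  shows "(\<lambda>l. coeff (\<Prod>i\<in>I. F i l) k) holomorphic_on S"
  using assms
proof (induction I arbitrary: k rule: finite_induct)
  case empty
  then show ?case by (cases k) (auto simp: coeff_eq_0)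
next
  case (insert i I)
  then have "(\<lambda>l. coeff (F i l * (\<Prod>i\<in>I. F i l)) k) holomorphic_on S"
    unfolding coeff_mult by (intro holomorphic_intros) auto
  then show ?case using insert by simp
qed

lemma coeff_char_poly_holomorphic:
  fixes A :: "complex \<Rightarrow> complex mat"
  assumes A: "\<And>l. A l \<in> carrier_mat n n"
    and hol: "\<And>i j. i < n \<Longrightarrow> j < n \<Longrightarrow> (\<lambda>l. A l $$ (i, j)) holomorphic_on S"
  shows "(\<lambda>l. coeff (char_poly (A l)) k) holomorphic_on S"
proof -
  have entry: "(\<lambda>l. coeff (char_poly_matrix (A l) $$ (i, j)) k) holomorphic_on S" if ij: "i < n" "j < n" for i j k
  proof -
    have "char_poly_matrix (A l) $$ (i, j) = (if i = j then [:0, 1:] else 0) + [: - (A l $$ (i, j)) :]" for l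
      using A[of l] ij by (auto simp: char_poly_matrix_def)
    then show ?thesis
      by (cases k) (auto intro!: holomorphic_intros hol ij)
  qed
  have "(\<lambda>l. coeff (of_int (sign p) * (\<Prod>i = 0..<n. char_poly_matrix (A l) $$ (i, p i))) k) holomorphic_on S"
    if p: "p permutes {0..<n}" for p
  proof -
    have pi: "i < n \<Longrightarrow> p i < n" for i using permutes_in_image[OF p, of i] by auto
    have "(\<lambda>l. coeff (\<Prod>i = 0..<n. char_poly_matrix (A l) $$ (i, p i)) k) holomorphic_on S"
      by (rule coeff_prod_holomorphic) (auto intro: entry pi)
    then show ?thesis
      by (cases "p" rule: sign_cases) (auto intro!: holomorphic_intros)
  qed
  then show ?thesis
    unfolding char_poly_def det_def'[OF char_poly_matrix_closed[OF A]] coeff_sum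
    by (intro holomorphic_on_sum) auto
qed

text \<open>
  The matrix \<open>f(A)\<close>, given by its entries to make visible that they depend holomorphically on
  parameters in \<open>A\<close> and in the coefficients of \<open>f\<close>.
\<close>

definition mat_poly :: "complex mat \<Rightarrow> complex poly \<Rightarrow> complex mat" where
  "mat_poly A f = Matrix.mat (dim_row A) (dim_row A) (\<lambda>ij. \<Sum>k\<le>degree f. coeff f k * (A ^\<^sub>m k) $$ ij)"

lemma mat_poly_carrier: "A \<in> carrier_mat n n \<Longrightarrow> mat_poly A f \<in> carrier_mat n n"
  by (auto simp: mat_poly_def)

lemma mat_poly_index:
  assumes "A \<in> carrier_mat n n" "i < n" "j < n" "degree f \<le> N"
  shows "mat_poly A f $$ (i, j) = (\<Sum>k\<le>N. coeff f k * (A ^\<^sub>m k) $$ (i, j))"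
proof -
  have "mat_poly A f $$ (i, j) = (\<Sum>k\<le>degree f. coeff f k * (A ^\<^sub>m k) $$ (i, j))"
    using assms by (simp add: mat_poly_def)
  also have "\<dots> = (\<Sum>k\<le>N. coeff f k * (A ^\<^sub>m k) $$ (i, j))"
    using assms by (intro sum.mono_neutral_left) (auto simp: coeff_eq_0)
  finally show ?thesis .
qed

lemma mat_poly_smult:
  assumes A: "A \<in> carrier_mat n n"
  shows "mat_poly A (Polynomial.smult c f) = c \<cdot>\<^sub>m mat_poly A f"
proof (rule eq_matI)
  fix i j assume "i < dim_row (c \<cdot>\<^sub>m mat_poly A f)" "j < dim_col (c \<cdot>\<^sub>m mat_poly A f)"
  then have "i < n" "j < n" using mat_poly_carrier[OF A, of f] by auto
  then show "mat_poly A (Polynomial.smult c f) $$ (i, j) = (c \<cdot>\<^sub>m mat_poly A f) $$ (i, j)"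
    using mat_poly_carrier[OF A, of f]
    by (simp add: mat_poly_index[OF A, where N = "degree f"] sum_distrib_left mult.assoc)
qed (use A in \<open>auto simp: mat_poly_def\<close>)

lemma mat_poly_one: "A \<in> carrier_mat n n \<Longrightarrow> mat_poly A 1 = 1\<^sub>m n"
  by (intro eq_matI) (auto simp: mat_poly_def)

lemma mat_poly_linear_mult:
  assumes A: "A \<in> carrier_mat n n"
  shows "mat_poly A ([:- b, 1:] * f) = char_matrix A b * mat_poly A f"
proof (rule eq_matI)
  note C = mat_poly_carrier[OF A, of f] char_matrix_closed[OF A, of b]
  fix i j assume "i < dim_row (char_matrix A b * mat_poly A f)" "j < dim_col (char_matrix A b * mat_poly A f)"
  then have i: "i < n" and j: "j < n" using C by auto
  define N where "N = degree f"
  have pow: "A ^\<^sub>m k \<in> carrier_mat n n" for k using A by (rule pow_carrier_mat)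
  have comm: "A * A ^\<^sub>m k = A ^\<^sub>m Suc k" for k
  proof (induction k)
    case 0 then show ?case using A by simp
  next
    case (Suc k)
    have "A * A ^\<^sub>m Suc k = A * A ^\<^sub>m k * A" using A pow by (simp add: assoc_mult_mat[OF A pow A])
    then show ?case using Suc by simp
  qed
  have deg: "degree ([:- b, 1:] * f) \<le> Suc N"
    by (rule order_trans[OF degree_mult_le]) (simp add: N_def)
  have coeffN: "coeff f (Suc N) = 0" by (simp add: N_def coeff_eq_0)
  have "mat_poly A ([:- b, 1:] * f) $$ (i, j)
    = (\<Sum>k\<le>Suc N. (coeff (pCons 0 f) k - b * coeff f k) * (A ^\<^sub>m k) $$ (i, j))"
    by (subst mat_poly_index[OF A i j deg]) (simp add: algebra_simps)
  also have "\<dots> = (\<Sum>k\<le>Suc N. coeff (pCons 0 f) k * (A ^\<^sub>m k) $$ (i, j)) - b * (\<Sum>k\<le>Suc N. coeff f k * (A ^\<^sub>m k) $$ (i, j))"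
    by (simp only: left_diff_distrib sum_subtractf sum_distrib_left mult.assoc)
  also have "(\<Sum>k\<le>Suc N. coeff (pCons 0 f) k * (A ^\<^sub>m k) $$ (i, j)) = (\<Sum>k\<le>N. coeff f k * (A ^\<^sub>m Suc k) $$ (i, j))"
    by (subst sum.atMost_Suc_shift) simp
  also have "\<dots> = (\<Sum>k\<le>N. coeff f k * (\<Sum>l = 0..<n. A $$ (i, l) * (A ^\<^sub>m k) $$ (l, j)))"
  proof (intro sum.cong refl arg_cong2[where f = "(*)"])
    fix k show "(A ^\<^sub>m Suc k) $$ (i, j) = (\<Sum>l = 0..<n. A $$ (i, l) * (A ^\<^sub>m k) $$ (l, j))"
      unfolding comm[symmetric] using A pow[of k] i j by (simp add: scalar_prod_def)
  qed
  also have "\<dots> = (\<Sum>l = 0..<n. A $$ (i, l) * mat_poly A f $$ (l, j))"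
    using j by (simp add: mat_poly_index[OF A _ j, where N = N] N_def sum_distrib_left
        sum.swap[of _ "{..degree f}"] algebra_simps)
  also have "(\<Sum>k\<le>Suc N. coeff f k * (A ^\<^sub>m k) $$ (i, j)) = mat_poly A f $$ (i, j)"
    using mat_poly_index[OF A i j, of f "Suc N"] by (simp add: N_def)
  also have "(\<Sum>l = 0..<n. A $$ (i, l) * mat_poly A f $$ (l, j)) - b * mat_poly A f $$ (i, j)
    = (\<Sum>l = 0..<n. A $$ (i, l) * mat_poly A f $$ (l, j) + (if l = i then - b * mat_poly A f $$ (l, j) else 0))"
    using i by (simp add: sum.distrib)
  also have "\<dots> = (char_matrix A b * mat_poly A f) $$ (i, j)"
  proof -
    have "(char_matrix A b * mat_poly A f) $$ (i, j)
      = (\<Sum>l = 0..<n. (A $$ (i, l) + (if l = i then - b else 0)) * mat_poly A f $$ (l, j))"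
      using C A i j by (auto simp: scalar_prod_def char_matrix_def intro!: sum.cong)
    also have "\<dots> = (\<Sum>l = 0..<n. A $$ (i, l) * mat_poly A f $$ (l, j) + (if l = i then - b * mat_poly A f $$ (l, j) else 0))"
      by (intro sum.cong) (auto simp: algebra_simps)
    finally show ?thesis by simp
  qed
  finally show "mat_poly A ([:- b, 1:] * f) $$ (i, j) = (char_matrix A b * mat_poly A f) $$ (i, j)" .
qed (use A mat_poly_carrier[OF A] in \<open>auto simp: mat_poly_def char_matrix_def\<close>)

text \<open>
  Factor \<open>f\<close> into linear factors \<open>X - b\<close>; the determinant of \<open>A - b\<close> is the product of the numbers \<open>r - b\<close>
  over the eigenvalues \<open>r\<close>.
\<close>

lemma det_mat_poly:
  assumes A: "A \<in> carrier_mat n n" and r: "char_poly A = linear_product rs"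
  shows "Determinant.det (mat_poly A f) = (\<Prod>r\<leftarrow>rs. poly f r)"
proof -
  have len: "length rs = n"
    using degree_monic_char_poly[OF A] degree_linear_factors[of uminus rs] by (simp add: r)
  have lin: "Determinant.det (char_matrix A b) = (\<Prod>r\<leftarrow>rs. r - b)" for b
  proof -
    have "(- 1) ^ n * Determinant.det (char_matrix A b) = Determinant.det (- char_matrix A b)"
    proof -
      have "- char_matrix A b = (- 1) \<cdot>\<^sub>m char_matrix A b" by (intro eq_matI) auto
      then have "Determinant.det (- char_matrix A b) = (- 1) ^ dim_col (char_matrix A b) * Determinant.det (char_matrix A b)"
        by (simp only: det_smult)
      moreover have "dim_col (char_matrix A b) = n" using char_matrix_closed[OF A, of b] by blast
      ultimately show ?thesis by (simp only:)
    qed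
    also have "\<dots> = poly (char_poly A) b" by (simp add: char_poly_matrix[OF A])
    also have "\<dots> = (\<Prod>r\<leftarrow>rs. b - r)" unfolding r
      by (induction rs) (auto simp: algebra_simps)
    also have "\<dots> = (- 1) ^ n * (\<Prod>r\<leftarrow>rs. r - b)"
      unfolding len[symmetric] by (induction rs) (auto simp: algebra_simps)
    finally show ?thesis by simp
  qed
  obtain bs where "Polynomial.smult (lead_coeff f) (linear_product bs) = f"
    using fundamental_theorem_algebra_factorized[of f] by blast
  moreover have "Determinant.det (mat_poly A (linear_product bs)) = (\<Prod>r\<leftarrow>rs. poly (linear_product bs) r)"
  proof (induction bs)
    case Nil
    then show ?case by (simp add: mat_poly_one[OF A]) (induction rs, auto)
  next
    case (Cons b bs)
    define g where "g = linear_product bs"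
    have "Determinant.det (mat_poly A ([:- b, 1:] * g)) = Determinant.det (char_matrix A b) * Determinant.det (mat_poly A g)"
      unfolding mat_poly_linear_mult[OF A]
      by (rule det_mult[OF char_matrix_closed[OF A] mat_poly_carrier[OF A]])
    also have "\<dots> = (\<Prod>r\<leftarrow>rs. r - b) * (\<Prod>r\<leftarrow>rs. poly g r)" using Cons lin by (simp add: g_def)
    also have "\<dots> = (\<Prod>r\<leftarrow>rs. poly ([:- b, 1:] * g) r)"
      by (induction rs) (auto simp: algebra_simps)
    finally show ?case by (simp only: g_def list.map prod_list.Cons)
  qed
  moreover have "Determinant.det (c \<cdot>\<^sub>m mat_poly A g) = c ^ n * Determinant.det (mat_poly A g)" for c g
    using mat_poly_carrier[OF A, of g] by (simp add: det_smult)
  moreover have "c ^ n * (\<Prod>r\<leftarrow>rs. poly g r) = (\<Prod>r\<leftarrow>rs. poly (Polynomial.smult c g) r)" for c g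
    unfolding len[symmetric] by (induction rs) (auto simp: algebra_simps)
  ultimately show ?thesis using mat_poly_smult[OF A] by metis
qed

text \<open>
  Spectral mapping with multiplicities. It turns symmetric functions of the values of \<open>f\<close> at the
  eigenvalues of \<open>A\<close> into coefficients of a characteristic polynomial, which are holomorphic when
  \<open>A\<close> and \<open>f\<close> are, also where eigenvalues collide.
\<close>

lemma char_poly_mat_poly:
  assumes A: "A \<in> carrier_mat n n" and r: "char_poly A = linear_product rs"
  shows "char_poly (mat_poly A f) = (\<Prod>r\<leftarrow>rs. [:- poly f r, 1:])"
proof -
  have "poly (char_poly (mat_poly A f)) t = poly (\<Prod>r\<leftarrow>rs. [:- poly f r, 1:]) t" for t
  proof -
    note C = mat_poly_carrier[OF A]
    have deg: "degree ([:t:] - f) \<le> degree f" by (rule degree_diff_le) auto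
    have "- char_matrix (mat_poly A f) t = mat_poly A ([:t:] - f)"
    proof (rule eq_matI)
      fix i j assume "i < dim_row (mat_poly A ([:t:] - f))" "j < dim_col (mat_poly A ([:t:] - f))"
      then have i: "i < n" and j: "j < n" using C[of "[:t:] - f"] by auto
      have "mat_poly A ([:t:] - f) $$ (i, j) = (\<Sum>k\<le>degree f. coeff [:t:] k * (A ^\<^sub>m k) $$ (i, j)) - mat_poly A f $$ (i, j)"
        by (simp add: mat_poly_index[OF A i j, where N = "degree f"] deg left_diff_distrib sum_subtractf)
      also have "(\<Sum>k\<le>degree f. coeff [:t:] k * (A ^\<^sub>m k) $$ (i, j)) = (\<Sum>k\<le>degree f. if k = 0 then t * (A ^\<^sub>m 0) $$ (i, j) else 0)"
        by (intro sum.cong) (auto split: nat.splits simp: coeff_pCons)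
      also have "\<dots> = (if i = j then t else 0)" using A i j by simp
      finally show "(- char_matrix (mat_poly A f) t) $$ (i, j) = mat_poly A ([:t:] - f) $$ (i, j)"
        using C[of f] i j by (simp add: char_matrix_def)
    qed (use C[of f] C[of "[:t:] - f"] in \<open>auto simp: char_matrix_def\<close>)
    then have "poly (char_poly (mat_poly A f)) t = Determinant.det (mat_poly A ([:t:] - f))"
      by (simp add: char_poly_matrix[OF C])
    also have "\<dots> = (\<Prod>r\<leftarrow>rs. poly ([:t:] - f) r)" by (rule det_mat_poly[OF A r])
    also have "\<dots> = poly (\<Prod>r\<leftarrow>rs. [:- poly f r, 1:]) t"
      by (induction rs) (auto simp: algebra_simps)
    finally show ?thesis .
  qed
  then show ?thesis by (intro iffD1[OF poly_eq_poly_eq_iff] ext)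
qed

lemma mat_poly_entry_holomorphic:
  fixes A :: "complex \<Rightarrow> complex mat" and f :: "complex \<Rightarrow> complex poly"
  assumes A: "\<And>l. A l \<in> carrier_mat n n"
    and hol: "\<And>i j. i < n \<Longrightarrow> j < n \<Longrightarrow> (\<lambda>l. A l $$ (i, j)) holomorphic_on S"
    and deg: "\<And>l. degree (f l) \<le> N" and f: "\<And>k. (\<lambda>l. coeff (f l) k) holomorphic_on S"
    and ij: "i < n" "j < n"
  shows "(\<lambda>l. mat_poly (A l) (f l) $$ (i, j)) holomorphic_on S"
proof -
  have "(\<lambda>l. (A l ^\<^sub>m k) $$ (i, j)) holomorphic_on S" if "i < n" "j < n" for i j k
    using that
  proof (induction k arbitrary: i j)
    case 0
    have "(A l ^\<^sub>m 0) $$ (i, j) = (if i = j then 1 else 0)" for l using A[of l] 0 by simp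
    then show ?case by simp
  next
    case (Suc k)
    have "(A l ^\<^sub>m Suc k) $$ (i, j) = (\<Sum>m = 0..<n. (A l ^\<^sub>m k) $$ (i, m) * A l $$ (m, j))" for l
      using A[of l] pow_carrier_mat[OF A[of l], of k] Suc.prems by (simp add: scalar_prod_def)
    then show ?case
      using Suc by (simp only:) (intro holomorphic_on_sum holomorphic_on_mult hol, auto)
  qed
  then show ?thesis
    unfolding mat_poly_index[OF A ij deg] using ij by (intro holomorphic_on_sum holomorphic_on_mult f) auto
qed

text \<open>
  The lowest nonzero coefficient sits at the multiplicity of the root \<open>0\<close>.
\<close>

lemma coeff_prod_linear_count_zero:
  fixes bs :: "complex list"
  defines "c \<equiv> length (filter (\<lambda>b. b = 0) bs)"
  shows "(\<forall>i<c. coeff (linear_product bs) i = 0) \<and> coeff (linear_product bs) c \<noteq> 0"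
  unfolding c_def
proof (induction bs)
  case (Cons b bs)
  define p where "p = linear_product bs"
  define c where "c = length (filter (\<lambda>b. b = 0) bs)"
  have IH: "\<forall>i<c. coeff p i = 0" "coeff p c \<noteq> 0" using Cons by (auto simp: p_def c_def)
  have coeff0: "coeff ([:- b, 1:] * p) 0 = - b * coeff p 0" by simp
  have coeffS: "coeff ([:- b, 1:] * p) (Suc m) = - b * coeff p (Suc m) + coeff p m" for m by simp
  have main: "(\<forall>i<(if b = 0 then Suc c else c). coeff ([:- b, 1:] * p) i = 0) \<and> coeff ([:- b, 1:] * p) (if b = 0 then Suc c else c) \<noteq> 0"
  proof (cases "b = 0")
    case True
    have "coeff ([:- b, 1:] * p) i = 0" if "i < Suc c" for i
    proof (cases i)
      case 0 then show ?thesis using True by (simp only: coeff0) simp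
    next
      case (Suc m) then show ?thesis using that IH(1) True by (simp only: coeffS) simp
    qed
    then show ?thesis using True IH(2) by (simp only: coeffS) simp
  next
    case False
    have "coeff ([:- b, 1:] * p) i = 0" if "i < c" for i
    proof (cases i)
      case 0 then show ?thesis using that IH(1) by (simp only: coeff0) simp
    next
      case (Suc m) then show ?thesis using that IH(1) by (simp only: coeffS) simp
    qed
    moreover have "coeff ([:- b, 1:] * p) c \<noteq> 0"
    proof (cases c)
      case 0 then show ?thesis using IH(2) False by (simp only: coeff0) simp
    next
      case (Suc m)
      then have "coeff p m = 0" using IH(1) by simp
      then show ?thesis using IH(2) False Suc by (simp only: coeffS) simp
    qed
    ultimately show ?thesis using False by simp
  qed
  have e1: "linear_product (b # bs) = [:- b, 1:] * p"
    by (simp only: p_def list.map prod_list.Cons)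
  have e2: "length (filter (\<lambda>b. b = 0) (b # bs)) = (if b = 0 then Suc c else c)"
    by (simp add: c_def)
  show ?case unfolding e1 e2 by (rule main)
qed simp

section \<open>Root functions of a holomorphic family of polynomials\<close>

lemma isCont_tendsto_nhds: "isCont f x \<Longrightarrow> (f \<longlongrightarrow> f x) (nhds x)"
  using tendsto_at_iff_tendsto_nhds[of f x] by (simp add: isCont_def)

locale holomorphic_monic_poly =
  fixes P :: "complex \<Rightarrow> complex poly" and n :: nat
  assumes degree_P: "degree (P l) = n" and monic: "coeff (P l) n = 1"
    and coeff_holomorphic: "(\<lambda>l. coeff (P l) k) holomorphic_on UNIV"
begin

abbreviation is_root :: "complex \<Rightarrow> complex \<Rightarrow> bool" where
  "is_root l x \<equiv> poly (P l) x = 0"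

lemma P_nonzero: "P l \<noteq> 0"
  using monic[of l] by auto

lemma poly_P: "poly (P l) x = (\<Sum>k\<le>n. coeff (P l) k * x ^ k)"
  by (simp add: poly_altdef degree_P)

lemma value_holomorphic: "(\<lambda>l. poly (P l) x) holomorphic_on S"
  unfolding poly_P
  by (intro holomorphic_on_sum holomorphic_on_mult holomorphic_on_subset[OF coeff_holomorphic]) auto

lemma value_continuous: "isCont (\<lambda>l. poly (P l) x) l0"
  using holomorphic_on_imp_continuous_on[OF value_holomorphic[of x UNIV]]
  by (simp add: continuous_on_eq_continuous_at)

text \<open>
  If all roots of \<open>P l\<close> had distance at least \<open>e\<close> from \<open>m0\<close>, then \<open>|P l (m0)| \<ge> e\<^sup>n\<close>.
\<close>

lemma root_near:
  assumes "is_root l0 m0" "e > 0"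
  shows "\<forall>\<^sub>F l in nhds l0. \<exists>m. is_root l m \<and> dist m m0 < e"
proof -
  have "((\<lambda>l. poly (P l) m0) \<longlongrightarrow> poly (P l0) m0) (nhds l0)"
    by (rule isCont_tendsto_nhds[OF value_continuous])
  then have "\<forall>\<^sub>F l in nhds l0. dist (poly (P l) m0) 0 < e ^ n"
    using assms by (metis tendstoD zero_less_power)
  then show ?thesis
  proof eventually_elim
    case (elim l)
    obtain rs where rs: "Polynomial.smult (lead_coeff (P l)) (linear_product rs) = P l" "length rs = degree (P l)"
      using fundamental_theorem_algebra_factorized[of "P l"] by blast
    then have P: "P l = linear_product rs" and len: "length rs = n"
      using monic degree_P by auto
    show ?case
    proof (rule ccontr)
      assume "\<nexists>m. is_root l m \<and> dist m m0 < e"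
      then have far: "norm (m0 - r) \<ge> e" if "r \<in> set rs" for r
      proof -
        have "is_root l r" using that unfolding P by (simp add: poly_prod_list_zero_iff image_iff)
        then show ?thesis
          using \<open>\<nexists>m. is_root l m \<and> dist m m0 < e\<close> by (force simp: dist_norm norm_minus_commute)
      qed
      have "e ^ length rs \<le> norm (poly (linear_product rs) m0)"
        using far
      proof (induction rs)
        case (Cons r rs)
        have "e * e ^ length rs \<le> norm (m0 - r) * norm (poly (linear_product rs) m0)"
          using Cons assms by (intro mult_mono) auto
        also have "\<dots> = norm (poly (linear_product (r # rs)) m0)"
          by (simp add: algebra_simps flip: norm_mult)
        finally show ?case by simp
      qed simp
      then show False using elim by (simp add: P len)
    qed
  qed
qed

text \<open>
  The divided difference of \<open>P l\<close> at \<open>x\<close> and \<open>y\<close>. It is jointly continuous and on the diagonal equals the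
  derivative, so near a simple root it does not vanish; this gives local uniqueness and
  differentiability of the root at once.
\<close>

definition divdiff :: "complex \<Rightarrow> complex \<Rightarrow> complex \<Rightarrow> complex" where
  "divdiff l x y = (\<Sum>k\<le>n. coeff (P l) k * (\<Sum>i<k. y ^ (k - Suc i) * x ^ i))"

lemma divdiff_eq: "poly (P l) x - poly (P l) y = (x - y) * divdiff l x y"
proof -
  have "poly (P l) x - poly (P l) y = (\<Sum>k\<le>n. coeff (P l) k * (x ^ k - y ^ k))"
    by (simp add: poly_P right_diff_distrib sum_subtractf)
  also have "\<dots> = (\<Sum>k\<le>n. (x - y) * (coeff (P l) k * (\<Sum>i<k. y ^ (k - Suc i) * x ^ i)))"
    by (intro sum.cong) (auto simp: power_diff_sumr2)
  finally show ?thesis by (simp add: divdiff_def sum_distrib_left)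
qed

lemma divdiff_diagonal: "divdiff l x x = poly (pderiv (P l)) x"
proof -
  have "((\<lambda>x. poly (P l) x) has_field_derivative (\<Sum>k\<le>n. coeff (P l) k * (of_nat k * x ^ (k - Suc 0)))) (at x)"
    unfolding poly_P by (rule derivative_eq_intros refl | simp add: mult_ac)+
  moreover have "((\<lambda>x. poly (P l) x) has_field_derivative poly (pderiv (P l)) x) (at x)"
    by (rule poly_DERIV)
  ultimately have "poly (pderiv (P l)) x = (\<Sum>k\<le>n. coeff (P l) k * (of_nat k * x ^ (k - Suc 0)))"
    by (metis DERIV_unique)
  also have "\<dots> = divdiff l x x"
    unfolding divdiff_def
  proof (intro sum.cong refl arg_cong2[where f = "(*)"])
    fix k
    have "(\<Sum>i<k. x ^ (k - Suc i) * x ^ i) = (\<Sum>i<k. x ^ (k - Suc 0))"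
      by (intro sum.cong) (auto simp flip: power_add)
    then show "of_nat k * x ^ (k - Suc 0) = (\<Sum>i<k. x ^ (k - Suc i) * x ^ i)" by simp
  qed
  finally show ?thesis by simp
qed

lemma divdiff_continuous: "continuous_on UNIV (\<lambda>(l, x, y). divdiff l x y)"
proof -
  have "continuous_on UNIV (\<lambda>z :: complex \<times> complex \<times> complex. coeff (P (fst z)) k)" for k
    by (rule continuous_on_compose2[OF holomorphic_on_imp_continuous_on[OF coeff_holomorphic[of k]]])
       (auto intro: continuous_intros)
  then show ?thesis
    unfolding divdiff_def case_prod_unfold by (intro continuous_intros)
qed

text \<open>
  A case of the implicit function theorem: \<open>root_near\<close> supplies a root close to \<open>m0\<close>, and the divided
  difference shows that it is unique and differentiable in \<open>l\<close>.
\<close>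

lemma local_root_function:
  assumes root: "is_root l0 m0" and simple: "poly (pderiv (P l0)) m0 \<noteq> 0"
  obtains r e f where "r > 0" "e > 0" "f holomorphic_on ball l0 r" "f l0 = m0"
    "\<And>l. l \<in> ball l0 r \<Longrightarrow> is_root l (f l)"
    "\<And>l. l \<in> ball l0 r \<Longrightarrow> dist (f l) m0 < e"
    "\<And>l m. l \<in> ball l0 r \<Longrightarrow> is_root l m \<Longrightarrow> dist m m0 < e \<Longrightarrow> m = f l"
proof -
  have "open {z. (\<lambda>(l, x, y). divdiff l x y) z \<noteq> 0}"
    using open_Collect_neq[OF divdiff_continuous continuous_on_const] .
  moreover have "(l0, m0, m0) \<in> {z. (\<lambda>(l, x, y). divdiff l x y) z \<noteq> 0}"
    using simple by (simp add: divdiff_diagonal)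
  ultimately obtain A B where "open A" "open B" "(l0, m0, m0) \<in> A \<times> B"
      and ABsub: "A \<times> B \<subseteq> {z. (\<lambda>(l, x, y). divdiff l x y) z \<noteq> 0}"
    by (rule open_prod_elim)
  then have AB: "open A" "open B" "l0 \<in> A" "(m0, m0) \<in> B" by simp_all
  from AB(2,4) obtain C D where "open C" "open D" "(m0, m0) \<in> C \<times> D" and CDsub: "C \<times> D \<subseteq> B"
    by (rule open_prod_elim)
  then have CD: "open C" "open D" "m0 \<in> C" "m0 \<in> D" by simp_all
  obtain e1 where e1: "e1 > 0" "ball m0 e1 \<subseteq> C \<inter> D"
    using CD by (meson IntI open_Int openE)
  obtain r1 where r1: "r1 > 0" "ball l0 r1 \<subseteq> A" using AB(1,3) by (rule openE)
  have nz: "divdiff l x y \<noteq> 0" if "l \<in> ball l0 r1" "dist x m0 < e1" "dist y m0 < e1" for l x y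
  proof -
    have "x \<in> C" "y \<in> D" using e1(2) that by (auto simp: dist_commute)
    then have "(x, y) \<in> B" using CDsub by (simp add: subset_iff)
    moreover have "l \<in> A" using r1(2) that(1) by (rule subsetD)
    ultimately have "(l, x, y) \<in> {z. (\<lambda>(l, x, y). divdiff l x y) z \<noteq> 0}"
      by (intro subsetD[OF ABsub]) simp
    then show ?thesis by simp
  qed
  obtain r2 where r2: "r2 > 0" "\<And>l. dist l l0 < r2 \<Longrightarrow> \<exists>m. is_root l m \<and> dist m m0 < e1"
    using root_near[OF root e1(1)] unfolding eventually_nhds_metric by blast
  define r where "r = min r1 r2"
  have r: "r > 0" using r1 r2 by (simp add: r_def)
  have "\<exists>m. is_root l m \<and> dist m m0 < e1" if "l \<in> ball l0 r" for l
    using r2(2)[of l] that by (simp add: r_def dist_commute)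
  then obtain f where f: "\<And>l. l \<in> ball l0 r \<Longrightarrow> is_root l (f l) \<and> dist (f l) m0 < e1"
    by metis
  have uniq: "m = f l" if "l \<in> ball l0 r" "is_root l m" "dist m m0 < e1" for l m
  proof -
    have "(m - f l) * divdiff l m (f l) = 0" using divdiff_eq[of l m "f l"] that f by simp
    moreover have "divdiff l m (f l) \<noteq> 0" using nz[of l m "f l"] that f by (auto simp: r_def)
    ultimately show ?thesis by simp
  qed
  have cont: "(f \<longlongrightarrow> f l1) (nhds l1)" if l1: "l1 \<in> ball l0 r" for l1
  proof (rule tendstoI)
    fix \<epsilon> :: real assume \<epsilon>: "\<epsilon> > 0"
    \<comment> \<open>Within this distance of \<open>f l1\<close> a root is also close enough to \<open>m0\<close> for uniqueness.\<close>
    define \<epsilon>' where "\<epsilon>' = min \<epsilon> (e1 - dist (f l1) m0)"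
    have "\<epsilon>' > 0" using \<epsilon> f[OF l1] by (simp add: \<epsilon>'_def)
    from root_near[OF conjunct1[OF f[OF l1]] this]
    have "\<forall>\<^sub>F l in nhds l1. \<exists>m. is_root l m \<and> dist m (f l1) < \<epsilon>'" .
    moreover have "\<forall>\<^sub>F l in nhds l1. l \<in> ball l0 r" using l1 by (intro eventually_nhds_in_open) auto
    ultimately show "\<forall>\<^sub>F l in nhds l1. dist (f l) (f l1) < \<epsilon>"
    proof eventually_elim
      case (elim l)
      then obtain m where m: "is_root l m" "dist m (f l1) < \<epsilon>'" by blast
      have "dist m m0 < e1" using m(2) dist_triangle[of m m0 "f l1"] by (simp add: \<epsilon>'_def)
      then have "m = f l" using uniq elim m by blast
      then show ?case using m(2) by (simp add: \<epsilon>'_def)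
    qed
  qed
  have "\<exists>D. (f has_field_derivative D) (at l1)" if l1: "l1 \<in> ball l0 r" for l1
  proof -
    define m1 where "m1 = f l1"
    have fl1: "is_root l1 m1" "dist m1 m0 < e1" using f[OF l1] by (auto simp: m1_def)
    obtain D where D: "((\<lambda>l. poly (P l) m1) has_field_derivative D) (at l1)"
      using value_holomorphic[of m1 UNIV] by (auto simp: holomorphic_on_def field_differentiable_def)
    have "((\<lambda>l. (l, f l, m1)) \<longlongrightarrow> (l1, m1, m1)) (at l1)"
      using cont[OF l1] by (intro tendsto_intros) (simp add: m1_def tendsto_at_iff_tendsto_nhds)
    moreover have "isCont (\<lambda>(l, x, y). divdiff l x y) (l1, m1, m1)"
      using divdiff_continuous by (simp add: continuous_on_eq_continuous_at)
    ultimately have lim: "((\<lambda>l. divdiff l (f l) m1) \<longlongrightarrow> divdiff l1 m1 m1) (at l1)"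
      using isCont_tendsto_compose by fastforce
    have nz1: "divdiff l1 m1 m1 \<noteq> 0" using nz[of l1 m1 m1] l1 fl1 by (auto simp: r_def)
    have "((\<lambda>l. - ((poly (P l) m1 - poly (P l1) m1) / (l - l1)) / divdiff l (f l) m1) \<longlongrightarrow> - D / divdiff l1 m1 m1) (at l1)"
      using D lim nz1 by (intro tendsto_intros) (auto simp: has_field_derivative_iff)
    moreover have "\<forall>\<^sub>F l in at l1. - ((poly (P l) m1 - poly (P l1) m1) / (l - l1)) / divdiff l (f l) m1 = (f l - f l1) / (l - l1)"
    proof -
      have "\<forall>\<^sub>F l in at l1. l \<in> ball l0 r" using l1 by (intro eventually_at_in_open') auto
      moreover have "\<forall>\<^sub>F l in at l1. l \<noteq> l1" by (simp add: eventually_at_filter)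
      ultimately show ?thesis
      proof eventually_elim
        case (elim l)
        have "(f l - m1) * divdiff l (f l) m1 = - poly (P l) m1"
          using divdiff_eq[of l "f l" m1] f elim by auto
        moreover have "divdiff l (f l) m1 \<noteq> 0" using nz[of l "f l" m1] elim f fl1 by (auto simp: r_def)
        ultimately have "f l - m1 = - poly (P l) m1 / divdiff l (f l) m1"
          by (subst nonzero_eq_divide_eq)
        then show ?case using fl1(1) by (simp add: m1_def[symmetric])
      qed
    qed
    ultimately have "((\<lambda>l. (f l - f l1) / (l - l1)) \<longlongrightarrow> - D / divdiff l1 m1 m1) (at l1)"
      by (rule Lim_transform_eventually)
    then show ?thesis by (auto simp: has_field_derivative_iff)
  qed
  then have "f holomorphic_on ball l0 r"
    by (meson field_differentiable_def holomorphic_on_def field_differentiable_at_within)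
  moreover have "f l0 = m0" using uniq[of l0 m0] r root e1 by auto
  ultimately show thesis using that[of r e1 f] r e1(1) f uniq by blast
qed

lemma root_function_derivative:
  assumes f: "f holomorphic_on ball l0 r" "r > 0" and root: "\<And>l. l \<in> ball l0 r \<Longrightarrow> is_root l (f l)"
  shows "deriv (\<lambda>l. poly (P l) (f l0)) l0 + poly (pderiv (P l0)) (f l0) * deriv f l0 = 0"
proof -
  have df: "(f has_field_derivative deriv f l0) (at l0)"
    using f by (intro holomorphic_derivI[of f "ball l0 r"]) auto
  define c where "c = (\<lambda>k l. coeff (P l) k)"
  have dc: "(c k has_field_derivative deriv (c k) l0) (at l0)" for k
    using coeff_holomorphic[of k] by (intro holomorphic_derivI[of _ UNIV]) (auto simp: c_def)
  have 1: "((\<lambda>l. \<Sum>k\<le>n. c k l * f l ^ k) has_field_derivative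
      (\<Sum>k\<le>n. deriv (c k) l0 * f l0 ^ k + c k l0 * (of_nat k * f l0 ^ (k - Suc 0) * deriv f l0))) (at l0)"
    by (rule derivative_eq_intros df dc refl | simp add: algebra_simps)+
  have 2: "((\<lambda>l. \<Sum>k\<le>n. c k l * f l0 ^ k) has_field_derivative (\<Sum>k\<le>n. deriv (c k) l0 * f l0 ^ k)) (at l0)"
    by (rule derivative_eq_intros dc refl | simp add: algebra_simps)+
  have 3: "((\<lambda>x. \<Sum>k\<le>n. c k l0 * x ^ k) has_field_derivative
      (\<Sum>k\<le>n. c k l0 * (of_nat k * f l0 ^ (k - Suc 0)))) (at (f l0))"
    by (rule derivative_eq_intros refl | simp add: algebra_simps)+
  have "(\<lambda>x. \<Sum>k\<le>n. c k l0 * x ^ k) = poly (P l0)" by (simp add: poly_P c_def fun_eq_iff)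
  with 3 have 3: "poly (pderiv (P l0)) (f l0) = (\<Sum>k\<le>n. c k l0 * (of_nat k * f l0 ^ (k - Suc 0)))"
    using poly_DERIV DERIV_unique by metis
  have "((\<lambda>l. poly (P l) (f l)) has_field_derivative 0) (at l0)"
    by (rule has_field_derivative_transform_within[OF DERIV_const f(2)]) (use root in \<open>auto simp: dist_commute\<close>)
  then have "(\<Sum>k\<le>n. deriv (c k) l0 * f l0 ^ k + c k l0 * (of_nat k * f l0 ^ (k - Suc 0) * deriv f l0)) = 0"
    using 1 DERIV_unique unfolding poly_P c_def by blast
  moreover have "deriv (\<lambda>l. poly (P l) (f l0)) l0 = (\<Sum>k\<le>n. deriv (c k) l0 * f l0 ^ k)"
    using DERIV_imp_deriv[OF 2] by (simp add: poly_P c_def)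
  ultimately show ?thesis unfolding 3 by (simp add: sum.distrib sum_distrib_left mult_ac)
qed

text \<open>
  If all roots at \<open>l0\<close> are simple, their local continuations are \<open>n\<close> distinct roots and thus exhaust
  the roots of \<open>P l\<close>.
\<close>

lemma separable_root_functions:
  assumes simple: "rsquarefree (P l0)"
  defines "R \<equiv> {m. is_root l0 m}"
  shows "\<exists>F. (\<forall>m\<in>R. F m l0 = m \<and> isCont (F m) l0 \<and>
        (\<exists>r>0. \<exists>e>0. F m holomorphic_on ball l0 r \<and> (\<forall>l\<in>ball l0 r. is_root l (F m l) \<and>
          (\<forall>x. is_root l x \<longrightarrow> dist x m < e \<longrightarrow> x = F m l)))) \<and>
    (\<forall>\<^sub>F l in nhds l0. inj_on (\<lambda>m. F m l) R \<and> {x. is_root l x} = (\<lambda>m. F m l) ` R)"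
proof -
  have fin: "finite R" unfolding R_def by (rule poly_roots_finite[OF P_nonzero])
  have card: "card R = n" using simple rsquarefree_card_degree[OF P_nonzero] by (simp add: R_def degree_P)
  have "\<exists>f. f l0 = m \<and> (\<exists>r>0. \<exists>e>0. f holomorphic_on ball l0 r \<and> (\<forall>l\<in>ball l0 r. is_root l (f l) \<and>
        (\<forall>x. is_root l x \<longrightarrow> dist x m < e \<longrightarrow> x = f l)))" if m: "m \<in> R" for m
  proof -
    have "is_root l0 m" using m by (simp add: R_def)
    moreover from this have "poly (pderiv (P l0)) m \<noteq> 0" using simple by (auto simp: rsquarefree_roots)
    ultimately show ?thesis using local_root_function by metis
  qed
  then obtain F where F: "\<And>m. m \<in> R \<Longrightarrow> F m l0 = m"
    and F2: "\<And>m. m \<in> R \<Longrightarrow> \<exists>r>0. \<exists>e>0. F m holomorphic_on ball l0 r \<and> (\<forall>l\<in>ball l0 r. is_root l (F m l) \<and>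
        (\<forall>x. is_root l x \<longrightarrow> dist x m < e \<longrightarrow> x = F m l))" by metis
  have cont: "isCont (F m) l0" if "m \<in> R" for m
    using F2[OF that]
    by (metis centre_in_ball continuous_on_eq_continuous_at holomorphic_on_imp_continuous_on open_ball)
  have "\<forall>\<^sub>F l in nhds l0. is_root l (F m l)" if m: "m \<in> R" for m
  proof -
    obtain r where "r > 0" "\<forall>l\<in>ball l0 r. is_root l (F m l)" using F2[OF m] by blast
    then show ?thesis unfolding eventually_nhds_metric by (auto simp: dist_commute)
  qed
  then have roots: "\<forall>\<^sub>F l in nhds l0. \<forall>m\<in>R. is_root l (F m l)"
    using fin by (simp add: eventually_ball_finite)
  have "\<forall>\<^sub>F l in nhds l0. F m l \<noteq> F m' l" if "m \<in> R" "m' \<in> R" "m \<noteq> m'" for m m'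
  proof -
    have "((\<lambda>l. F m l - F m' l) \<longlongrightarrow> F m l0 - F m' l0) (nhds l0)"
      by (intro tendsto_diff isCont_tendsto_nhds cont that)
    then have "\<forall>\<^sub>F l in nhds l0. F m l - F m' l \<noteq> 0"
      using F that by (intro tendsto_imp_eventually_ne) auto
    then show ?thesis by eventually_elim simp
  qed
  then have "\<forall>\<^sub>F l in nhds l0. \<forall>m\<in>R. \<forall>m'\<in>R. m \<noteq> m' \<longrightarrow> F m l \<noteq> F m' l"
    using fin by (intro eventually_ball_finite ballI) (auto intro: always_eventually)
  with roots have "\<forall>\<^sub>F l in nhds l0. inj_on (\<lambda>m. F m l) R \<and> {x. is_root l x} = (\<lambda>m. F m l) ` R"
  proof eventually_elim
    case (elim l)
    then have inj: "inj_on (\<lambda>m. F m l) R" by (auto simp: inj_on_def)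
    have "(\<lambda>m. F m l) ` R = {x. is_root l x}"
    proof (rule card_seteq)
      show "finite {x. is_root l x}" by (rule poly_roots_finite[OF P_nonzero])
      show "card {x. is_root l x} \<le> card ((\<lambda>m. F m l) ` R)"
        using card_poly_roots_bound[OF P_nonzero, of l] card inj by (simp add: card_image degree_P)
    qed (use elim in auto)
    with inj show ?case by simp
  qed
  then show ?thesis using F cont F2 by (intro exI[of _ F] conjI ballI) auto
qed

end

lemma dist_reflection: "Re l0 = 0 \<Longrightarrow> dist l0 (- cnj l) = dist l0 l"
proof -
  assume "Re l0 = 0"
  then have "l0 - - cnj l = - cnj (l0 - l)" by (simp add: complex_eq_iff)
  then show ?thesis unfolding dist_norm by (simp only: norm_minus_cancel complex_mod_cnj)
qed

text \<open>
  By the hypothesis \<open>refl\<close> the reflection \<open>l \<mapsto> - cnj l\<close> corresponds under \<open>f\<close> to the inversion in the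
  unit circle. Where \<open>|f l| = 1\<close>, the points \<open>l\<close> and \<open>- cnj l\<close> have the same value and coincide by
  local injectivity.
\<close>

lemma no_unimodular_values_off_axis:
  assumes f: "f holomorphic_on ball l0 r" "r > 0" and l0: "Re l0 = 0" and d: "deriv f l0 \<noteq> 0"
    and refl: "\<forall>\<^sub>F l in nhds l0. f (- cnj l) * cnj (f l) = 1"
  shows "\<forall>\<^sub>F l in nhds l0. norm (f l) = 1 \<longrightarrow> Re l = 0"
proof -
  obtain s where s: "s > 0" "ball l0 s \<subseteq> ball l0 r" "inj_on f (ball l0 s)"
    using has_complex_derivative_locally_injective[OF f(1) _ open_ball d] f(2) by (metis centre_in_ball)
  have "\<forall>\<^sub>F l in nhds l0. l \<in> ball l0 s" using s by (intro eventually_nhds_in_open) auto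
  with refl show ?thesis
  proof eventually_elim
    case (elim l)
    have in2: "- cnj l \<in> ball l0 s" using elim dist_reflection[OF l0] by simp
    show ?case
    proof
      assume "norm (f l) = 1"
      then have "f l * cnj (f l) = 1" by (simp add: complex_norm_square[symmetric])
      then have "f (- cnj l) = f l" using elim by (metis mult_cancel_right mult_zero_right zero_neq_one)
      then have "- cnj l = l" using s(3) in2 elim by (meson inj_onD)
      then have "Re (- cnj l) = Re l" by (rule arg_cong)
      then show "Re l = 0" by simp
    qed
  qed
qed

section \<open>Common roots and reflection in the axis and the circle\<close>

lemma char_poly_family:
  assumes "\<And>l. M l \<in> carrier_mat n n"
    and "\<And>i j. i < n \<Longrightarrow> j < n \<Longrightarrow> (\<lambda>l. M l $$ (i, j)) holomorphic_on UNIV"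
  shows "holomorphic_monic_poly (\<lambda>l. char_poly (M l)) n"
proof
  show "degree (char_poly (M l)) = n" "coeff (char_poly (M l)) n = 1" for l
    using degree_monic_char_poly[OF assms(1)[of l]] by auto
  show "(\<lambda>l. coeff (char_poly (M l)) k) holomorphic_on UNIV" for k
    by (rule coeff_char_poly_holomorphic[OF assms])
qed

text \<open>
  The characteristic polynomial of \<open>f l\<close> evaluated at \<open>M l\<close> has a root \<open>0\<close> whose multiplicity is the number of
  common roots. For \<open>G\<close> take its first coefficient that does not vanish identically in \<open>l\<close>: as long
  as \<open>G l\<close> is nonzero, that multiplicity is the index of this coefficient.
\<close>

lemma common_root_count:
  fixes f :: "complex \<Rightarrow> complex poly"
  assumes M: "\<And>l. M l \<in> carrier_mat n n"
    and hol: "\<And>i j. i < n \<Longrightarrow> j < n \<Longrightarrow> (\<lambda>l. M l $$ (i, j)) holomorphic_on UNIV"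
    and deg: "\<And>l. degree (f l) \<le> N" and f: "\<And>k. (\<lambda>l. coeff (f l) k) holomorphic_on UNIV"
  shows "\<exists>G K. G holomorphic_on UNIV \<and> (\<exists>l. G l \<noteq> 0) \<and>
    (\<forall>l rs. G l \<noteq> 0 \<longrightarrow> char_poly (M l) = linear_product rs \<longrightarrow> length (filter (\<lambda>r. poly (f l) r = 0) rs) = K)"
proof -
  define c where "c = (\<lambda>k l. coeff (char_poly (mat_poly (M l) (f l))) k)"
  have hol_c: "c k holomorphic_on UNIV" for k
    unfolding c_def
    by (rule coeff_char_poly_holomorphic[OF mat_poly_carrier[OF M] mat_poly_entry_holomorphic[OF M hol deg f]])
  have cn: "c n l = 1" for l
    using degree_monic_char_poly[OF mat_poly_carrier[OF M]] by (simp add: c_def)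
  define K where "K = (LEAST k. \<exists>l. c k l \<noteq> 0)"
  have "\<exists>l. c n l \<noteq> 0" by (simp add: cn)
  then have K: "\<exists>l. c K l \<noteq> 0" unfolding K_def by (rule LeastI)
  show ?thesis
  proof (intro exI[of _ "c K"] exI[of _ K] conjI hol_c K allI impI)
    fix l rs assume l: "c K l \<noteq> 0" and rs: "char_poly (M l) = linear_product rs"
    define k where "k = length (filter (\<lambda>r. poly (f l) r = 0) rs)"
    have ck: "(\<forall>i<k. c i l = 0) \<and> c k l \<noteq> 0"
      using coeff_prod_linear_count_zero[of "map (poly (f l)) rs"]
      by (simp add: c_def char_poly_mat_poly[OF M rs] k_def o_def filter_map)
    then have "K \<le> k" unfolding K_def by (intro Least_le) blast
    moreover have "k \<le> K" using ck l by (meson not_le)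
    ultimately show "length (filter (\<lambda>r. poly (f l) r = 0) rs) = K" by (simp add: k_def)
  qed
qed

text \<open>
  For \<open>E\<close> take, up to sign, the product of the values of \<open>f l\<close> over the eigenvalues. It depends
  holomorphically on \<open>l\<close> also where the degree of \<open>f l\<close> drops.
\<close>

lemma common_root_indicator:
  fixes f :: "complex \<Rightarrow> complex poly"
  assumes M: "\<And>l. M l \<in> carrier_mat n n"
    and hol: "\<And>i j. i < n \<Longrightarrow> j < n \<Longrightarrow> (\<lambda>l. M l $$ (i, j)) holomorphic_on UNIV"
    and deg: "\<And>l. degree (f l) \<le> N" and f: "\<And>k. (\<lambda>l. coeff (f l) k) holomorphic_on UNIV"
  shows "\<exists>E. E holomorphic_on UNIV \<and>
    (\<forall>l. E l = 0 \<longleftrightarrow> (\<exists>r. poly (char_poly (M l)) r = 0 \<and> poly (f l) r = 0))"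
proof -
  define E where "E = (\<lambda>l. coeff (char_poly (mat_poly (M l) (f l))) 0)"
  have "E holomorphic_on UNIV"
    unfolding E_def
    by (rule coeff_char_poly_holomorphic[OF mat_poly_carrier[OF M] mat_poly_entry_holomorphic[OF M hol deg f]])
  moreover have "E l = 0 \<longleftrightarrow> (\<exists>r. poly (char_poly (M l)) r = 0 \<and> poly (f l) r = 0)" for l
  proof -
    obtain rs where rs: "char_poly (M l) = linear_product rs"
      using char_poly_factorized[OF M] by blast
    have "E l = poly (\<Prod>r\<leftarrow>rs. [:- poly (f l) r, 1:]) 0"
      by (simp only: E_def char_poly_mat_poly[OF M rs] poly_0_coeff_0)
    moreover have "(poly (\<Prod>r\<leftarrow>rs. [:- poly (f l) r, 1:]) 0 = 0) = (\<exists>r\<in>set rs. poly (f l) r = 0)"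
      by (simp add: poly_prod_list_zero_iff)
    moreover have "poly (char_poly (M l)) r = 0 \<longleftrightarrow> r \<in> set rs" for r
      unfolding rs by (auto simp: poly_prod_list_zero_iff)
    ultimately show ?thesis by auto
  qed
  ultimately show ?thesis by blast
qed

text \<open>
  The polynomial with roots \<open>1 / cnj x\<close>, for \<open>x\<close> a nonzero root of \<open>P (- cnj l)\<close>. Both conjugations together
  make its coefficients holomorphic in \<open>l\<close>.
\<close>

definition reflected_poly :: "nat \<Rightarrow> (complex \<Rightarrow> complex poly) \<Rightarrow> complex \<Rightarrow> complex poly" where
  "reflected_poly n P l = (\<Sum>i\<le>n. Polynomial.monom (cnj (coeff (P (- cnj l)) (n - i))) i)"

lemma coeff_reflected_poly:
  "coeff (reflected_poly n P l) k = (if k \<le> n then cnj (coeff (P (- cnj l)) (n - k)) else 0)"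
  by (simp add: reflected_poly_def coeff_sum)

lemma degree_reflected_poly: "degree (reflected_poly n P l) \<le> n"
  by (rule degree_le) (simp add: coeff_reflected_poly)

lemma reflection_holomorphic:
  assumes "f holomorphic_on (\<lambda>z. - cnj z) ` A" "open A"
  shows "(\<lambda>z. cnj (f (- cnj z))) holomorphic_on A"
proof -
  have "(f \<circ> uminus) holomorphic_on cnj ` A"
    using assms by (intro holomorphic_on_compose) (auto intro!: holomorphic_intros simp: image_image)
  from holomorphic_on_compose_cnj_cnj[OF this assms(2)] show ?thesis by (simp add: o_def)
qed

context holomorphic_monic_poly
begin

lemma coeff_reflected_holomorphic: "(\<lambda>l. coeff (reflected_poly n P l) k) holomorphic_on UNIV"
proof (cases "k \<le> n")
  case True
  have "(\<lambda>l. cnj (coeff (P (- cnj l)) (n - k))) holomorphic_on UNIV"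
    by (rule reflection_holomorphic[OF holomorphic_on_subset[OF coeff_holomorphic]]) auto
  then show ?thesis using True by (simp add: coeff_reflected_poly)
qed (simp add: coeff_reflected_poly)

lemma poly_reflected:
  assumes "x \<noteq> 0"
  shows "poly (reflected_poly n P l) x = x ^ n * cnj (poly (P (- cnj l)) (1 / cnj x))"
proof -
  have "poly (reflected_poly n P l) x = (\<Sum>i\<le>n. cnj (coeff (P (- cnj l)) (n - i)) * x ^ i)"
    by (simp add: reflected_poly_def poly_sum poly_monom)
  also have "\<dots> = (\<Sum>k\<le>n. cnj (coeff (P (- cnj l)) k) * x ^ (n - k))"
    by (rule sum.reindex_bij_witness[of _ "\<lambda>i. n - i" "\<lambda>i. n - i"]) auto
  also have "\<dots> = (\<Sum>k\<le>n. x ^ n * (cnj (coeff (P (- cnj l)) k) * (1 / x) ^ k))"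
    using assms by (intro sum.cong) (auto simp: power_diff power_one_over field_simps)
  also have "\<dots> = x ^ n * cnj (poly (P (- cnj l)) (1 / cnj x))"
    by (simp add: poly_P sum_distrib_left)
  finally show ?thesis .
qed

lemma spectrum_on_axis_if_root_functions:
  assumes F0: "\<And>m. m \<in> R \<Longrightarrow> F m l0 = m" and cont: "\<And>m. m \<in> R \<Longrightarrow> isCont (F m) l0"
    and roots: "\<forall>\<^sub>F l in nhds l0. {x. is_root l x} = (\<lambda>m. F m l) ` R" and fin: "finite R"
    and R: "\<And>m. m \<in> R \<Longrightarrow> norm m = 1 \<Longrightarrow> \<forall>\<^sub>F l in nhds l0. norm (F m l) = 1 \<longrightarrow> Re l = 0"
  shows "\<forall>\<^sub>F l in nhds l0. (\<exists>x. norm x = 1 \<and> is_root l x) \<longrightarrow> Re l = 0"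
proof -
  have "\<forall>\<^sub>F l in nhds l0. norm (F m l) = 1 \<longrightarrow> Re l = 0" if m: "m \<in> R" for m
  proof (cases "norm m = 1")
    case True then show ?thesis using R m by blast
  next
    case False
    have "((\<lambda>l. norm (F m l)) \<longlongrightarrow> norm (F m l0)) (nhds l0)"
      by (intro tendsto_norm isCont_tendsto_nhds cont m)
    then have "\<forall>\<^sub>F l in nhds l0. norm (F m l) \<noteq> 1"
      using F0[OF m] False by (intro tendsto_imp_eventually_ne) auto
    then show ?thesis by eventually_elim simp
  qed
  then have "\<forall>\<^sub>F l in nhds l0. \<forall>m\<in>R. norm (F m l) = 1 \<longrightarrow> Re l = 0"
    using fin by (intro eventually_ball_finite) auto
  with roots show ?thesis
  proof eventually_elim
    case (elim l)
    show ?case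
    proof (intro impI, elim exE conjE)
      fix x assume x: "norm x = 1" "is_root l x"
      then have "x \<in> (\<lambda>m. F m l) ` R" using elim(1) by blast
      then show "Re l = 0" using elim(2) x(1) by auto
    qed
  qed
qed

lemma root_derivative_nonzero:
  assumes "F holomorphic_on ball l0 r" "r > 0" "\<And>l. l \<in> ball l0 r \<Longrightarrow> is_root l (F l)"
    and "deriv (\<lambda>l. poly (P l) (F l0)) l0 \<noteq> 0"
  shows "deriv F l0 \<noteq> 0"
  using root_function_derivative[OF assms(1-3)] assms(4) by auto

text \<open>
  The set \<open>I l\<close> of root functions that are also roots of the reflected polynomial can only shrink near
  \<open>l0\<close>, and its cardinality is constant, so it is constant. It contains every root function that is
  unimodular at \<open>l0\<close>; for such a root function \<open>1 / cnj (F m l)\<close> is a root at \<open>- cnj l\<close> close to \<open>m\<close>, hence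
  equal to \<open>F m (- cnj l)\<close>.
\<close>

lemma spectrum_on_axis_near_generic_point:
  assumes l0: "Re l0 = 0"
    and simple: "rsquarefree (P l0)"
    and noncrit: "\<And>m. is_root l0 m \<Longrightarrow> deriv (\<lambda>l. poly (P l) m) l0 \<noteq> 0"
    and count: "\<forall>\<^sub>F l in nhds l0. \<forall>rs. P l = linear_product rs \<longrightarrow>
                  length (filter (\<lambda>r. poly (reflected_poly n P l) r = 0) rs) = K"
  shows "\<forall>\<^sub>F l in nhds l0. (\<exists>x. norm x = 1 \<and> is_root l x) \<longrightarrow> Re l = 0"
proof -
  define R where "R = {m. is_root l0 m}"
  define q where "q = reflected_poly n P"
  have fin: "finite R" unfolding R_def by (rule poly_roots_finite[OF P_nonzero])
  have card: "card R = n" using simple rsquarefree_card_degree[OF P_nonzero] by (simp add: R_def degree_P)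
  from separable_root_functions[OF simple, folded R_def]
  obtain F where FF: "\<forall>m\<in>R. F m l0 = m \<and> isCont (F m) l0 \<and>
        (\<exists>r>0. \<exists>e>0. F m holomorphic_on ball l0 r \<and> (\<forall>l\<in>ball l0 r. is_root l (F m l) \<and>
          (\<forall>x. is_root l x \<longrightarrow> dist x m < e \<longrightarrow> x = F m l)))"
    and roots: "\<forall>\<^sub>F l in nhds l0. inj_on (\<lambda>m. F m l) R \<and> {x. is_root l x} = (\<lambda>m. F m l) ` R"
    by (elim exE conjE)
  have F0: "F m l0 = m" and cont: "isCont (F m) l0"
    and F: "\<exists>r>0. \<exists>e>0. F m holomorphic_on ball l0 r \<and> (\<forall>l\<in>ball l0 r. is_root l (F m l) \<and>
          (\<forall>x. is_root l x \<longrightarrow> dist x m < e \<longrightarrow> x = F m l))" if "m \<in> R" for m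
    using bspec[OF FF that] by blast+
  have lim: "(F m \<longlongrightarrow> m) (nhds l0)" if "m \<in> R" for m
    using isCont_tendsto_nhds[OF cont[OF that]] F0[OF that] by simp
  define I where "I = (\<lambda>l. {m \<in> R. poly (q l) (F m l) = 0})"
  have cardI: "\<forall>\<^sub>F l in nhds l0. card (I l) = K"
    using count roots
  proof eventually_elim
    case (elim l)
    obtain rs where "Polynomial.smult (lead_coeff (P l)) (linear_product rs) = P l" "length rs = degree (P l)"
      using fundamental_theorem_algebra_factorized[of "P l"] by blast
    then have P: "P l = linear_product rs" and len: "length rs = n"
      using monic degree_P by auto
    have set_rs: "set rs = (\<lambda>m. F m l) ` R"
      using elim(2) unfolding P by (auto simp: poly_prod_list_zero_iff)
    then have "distinct rs" using elim(2) len card by (intro card_distinct) (simp add: card_image)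
    have "K = length (filter (\<lambda>r. poly (q l) r = 0) rs)" using elim(1) P by (simp add: q_def)
    also have "\<dots> = card ({x. poly (q l) x = 0} \<inter> set rs)"
      by (rule distinct_length_filter[OF \<open>distinct rs\<close>])
    also have "{x. poly (q l) x = 0} \<inter> set rs = (\<lambda>m. F m l) ` I l"
      unfolding set_rs I_def by auto
    also have "card \<dots> = card (I l)"
      using elim(2) by (intro card_image) (auto simp: I_def inj_on_def)
    finally show ?case by simp
  qed
  have "\<forall>\<^sub>F l in nhds l0. m \<notin> I l" if m: "m \<in> R" "m \<notin> I l0" for m
  proof -
    have expand: "poly (q l) x = (\<Sum>k\<le>n. coeff (q l) k * x ^ k)" for l x
    proof -
      have "poly (q l) x = (\<Sum>k\<le>degree (q l). coeff (q l) k * x ^ k)" by (rule poly_altdef)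
      also have "\<dots> = (\<Sum>k\<le>n. coeff (q l) k * x ^ k)"
        using degree_reflected_poly[of n P l] by (intro sum.mono_neutral_left) (auto simp: q_def coeff_eq_0)
      finally show ?thesis .
    qed
    have "isCont (\<lambda>l. coeff (q l) k) l0" for k
      using holomorphic_on_imp_continuous_on[OF coeff_reflected_holomorphic[of k]]
      by (simp add: q_def continuous_on_eq_continuous_at)
    then have "((\<lambda>l. coeff (q l) k) \<longlongrightarrow> coeff (q l0) k) (nhds l0)" for k
      by (rule isCont_tendsto_nhds)
    then have "((\<lambda>l. poly (q l) (F m l)) \<longlongrightarrow> poly (q l0) m) (nhds l0)"
      unfolding expand by (intro tendsto_intros lim m)
    moreover have "poly (q l0) m \<noteq> 0" using m F0 by (simp add: I_def)
    ultimately have "\<forall>\<^sub>F l in nhds l0. poly (q l) (F m l) \<noteq> 0" by (rule tendsto_imp_eventually_ne)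
    then show ?thesis by eventually_elim (simp add: I_def)
  qed
  then have "\<forall>\<^sub>F l in nhds l0. \<forall>m\<in>R - I l0. m \<notin> I l"
    using fin by (intro eventually_ball_finite) auto
  with cardI have I: "\<forall>\<^sub>F l in nhds l0. I l = I l0"
  proof eventually_elim
    case (elim l)
    have "card (I l0) = K" using cardI by (rule eventually_nhds_x_imp_x)
    moreover have "I l \<subseteq> I l0" using elim(2) by (auto simp: I_def)
    ultimately show ?case using elim(1) fin by (intro card_subset_eq) (auto simp: I_def)
  qed
  have neg: "- cnj l0 = l0" using l0 by (simp add: complex_eq_iff)
  show ?thesis
  proof (rule spectrum_on_axis_if_root_functions[OF F0 cont _ fin])
    show "\<forall>\<^sub>F l in nhds l0. {x. is_root l x} = (\<lambda>m. F m l) ` R"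
      using roots by eventually_elim blast
    fix m assume m: "m \<in> R" and m1: "norm m = 1"
    obtain r e where r: "r > 0" and e: "e > 0" and hol: "F m holomorphic_on ball l0 r"
      and Fr: "\<And>l. l \<in> ball l0 r \<Longrightarrow> is_root l (F m l)"
      and uniq: "\<And>l x. l \<in> ball l0 r \<Longrightarrow> is_root l x \<Longrightarrow> dist x m < e \<Longrightarrow> x = F m l"
      using F[OF m] by metis
    have d: "deriv (F m) l0 \<noteq> 0"
      using noncrit[of m] m F0[OF m] by (intro root_derivative_nonzero[OF hol r Fr]) (auto simp: R_def)
    have m0: "m \<noteq> 0" using m1 by auto
    have inv: "1 / cnj m = m" using m1 m0 by (simp add: divide_eq_eq complex_norm_square[symmetric])
    have "poly (q l0) m = 0"
      using m unfolding q_def poly_reflected[OF m0] neg inv by (simp add: R_def)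
    then have mI: "m \<in> I l0" using m F0 by (simp add: I_def)
    have ne0: "\<forall>\<^sub>F l in nhds l0. F m l \<noteq> 0" using lim[OF m] m0 by (rule tendsto_imp_eventually_ne)
    have "((\<lambda>l. 1 / cnj (F m l)) \<longlongrightarrow> 1 / cnj m) (nhds l0)"
      using m0 by (intro tendsto_intros lim m) auto
    then have near: "\<forall>\<^sub>F l in nhds l0. dist (1 / cnj (F m l)) m < e"
      unfolding inv using e by (rule tendstoD)
    have "((\<lambda>l. - cnj l) \<longlongrightarrow> - cnj l0) (nhds l0)" by (intro tendsto_intros filterlim_ident)
    then have ball: "\<forall>\<^sub>F l in nhds l0. - cnj l \<in> ball l0 r"
      unfolding neg using r by (intro topological_tendstoD) auto
    have "\<forall>\<^sub>F l in nhds l0. F m (- cnj l) * cnj (F m l) = 1"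
      using I ne0 near ball
    proof eventually_elim
      case (elim l)
      have "poly (q l) (F m l) = 0" using mI elim(1) by (auto simp: I_def)
      then have "is_root (- cnj l) (1 / cnj (F m l))"
        using elim(2) unfolding q_def poly_reflected[OF elim(2)] by simp
      from uniq[OF elim(4) this elim(3)] show ?case using elim(2) by (simp add: divide_eq_eq)
    qed
    from no_unimodular_values_off_axis[OF hol r l0 d this]
    show "\<forall>\<^sub>F l in nhds l0. norm (F m l) = 1 \<longrightarrow> Re l = 0" .
  qed
qed

text \<open>
  Close to \<open>l0\<close> only the root function of the single unimodular root \<open>m\<close> can be unimodular, hence it
  is unimodular along the segment. There \<open>- cnj l = l\<close>, so the holomorphic function \<open>g\<close> that expresses the
  reflection identity vanishes on a set with limit point \<open>l0\<close>.
\<close>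

lemma spectrum_on_axis_near_segment_point:
  assumes l0: "Re l0 = 0"
    and simple: "rsquarefree (P l0)"
    and noncrit: "\<And>m. is_root l0 m \<Longrightarrow> deriv (\<lambda>l. poly (P l) m) l0 \<noteq> 0"
    and single: "\<And>m m'. is_root l0 m \<Longrightarrow> poly (P l0) m' = 0 \<Longrightarrow> norm m = 1 \<Longrightarrow> norm m' = 1 \<Longrightarrow> m = m'"
    and seg: "b \<noteq> c" "l0 \<in> closed_segment b c"
      "\<And>l. l \<in> closed_segment b c \<Longrightarrow> Re l = 0 \<and> (\<exists>x. norm x = 1 \<and> is_root l x)"
  shows "\<forall>\<^sub>F l in nhds l0. (\<exists>x. norm x = 1 \<and> is_root l x) \<longrightarrow> Re l = 0"
proof -
  define R where "R = {m. is_root l0 m}"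
  have fin: "finite R" unfolding R_def by (rule poly_roots_finite[OF P_nonzero])
  from separable_root_functions[OF simple, folded R_def]
  obtain F where FF: "\<forall>m\<in>R. F m l0 = m \<and> isCont (F m) l0 \<and>
        (\<exists>r>0. \<exists>e>0. F m holomorphic_on ball l0 r \<and> (\<forall>l\<in>ball l0 r. is_root l (F m l) \<and>
          (\<forall>x. is_root l x \<longrightarrow> dist x m < e \<longrightarrow> x = F m l)))"
    and roots: "\<forall>\<^sub>F l in nhds l0. inj_on (\<lambda>m. F m l) R \<and> {x. is_root l x} = (\<lambda>m. F m l) ` R"
    by (elim exE conjE)
  have F0: "F m l0 = m" and cont: "isCont (F m) l0"
    and F: "\<exists>r>0. \<exists>e>0. F m holomorphic_on ball l0 r \<and> (\<forall>l\<in>ball l0 r. is_root l (F m l) \<and>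
          (\<forall>x. is_root l x \<longrightarrow> dist x m < e \<longrightarrow> x = F m l))" if "m \<in> R" for m
    using bspec[OF FF that] by blast+
  have roots': "\<forall>\<^sub>F l in nhds l0. {x. is_root l x} = (\<lambda>m. F m l) ` R"
    using roots by eventually_elim blast
  show ?thesis
  proof (rule spectrum_on_axis_if_root_functions[OF F0 cont roots' fin])
    fix m assume m: "m \<in> R" and m1: "norm m = 1"
    obtain r where r: "r > 0" and hol: "F m holomorphic_on ball l0 r"
      and Fr: "\<And>l. l \<in> ball l0 r \<Longrightarrow> is_root l (F m l)"
      using F[OF m] by metis
    have d: "deriv (F m) l0 \<noteq> 0"
      using noncrit[of m] m F0[OF m] by (intro root_derivative_nonzero[OF hol r Fr]) (auto simp: R_def)
    have "\<forall>\<^sub>F l in nhds l0. norm (F m' l) \<noteq> 1" if m': "m' \<in> R - {m}" for m'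
    proof -
      have "norm m' \<noteq> 1" using single[of m m'] m m' m1 by (auto simp: R_def)
      moreover have "((\<lambda>l. norm (F m' l)) \<longlongrightarrow> norm (F m' l0)) (nhds l0)"
        using m' by (intro tendsto_norm isCont_tendsto_nhds cont) simp
      ultimately show ?thesis
        using F0[of m'] m' by (intro tendsto_imp_eventually_ne) auto
    qed
    then have "\<forall>\<^sub>F l in nhds l0. \<forall>m'\<in>R - {m}. norm (F m' l) \<noteq> 1"
      using fin by (intro eventually_ball_finite) auto
    with roots' have "\<forall>\<^sub>F l in nhds l0. (\<exists>x. norm x = 1 \<and> is_root l x) \<longrightarrow> norm (F m l) = 1"
    proof eventually_elim
      case (elim l)
      show ?case
      proof (intro impI, elim exE conjE)
        fix x assume x: "norm x = 1" "is_root l x"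
        then have "x \<in> (\<lambda>m. F m l) ` R" using elim(1) by blast
        then show "norm (F m l) = 1" using elim(2) x(1) by blast
      qed
    qed
    then have ev: "\<forall>\<^sub>F l in at l0. l \<in> {l. ((\<exists>x. norm x = 1 \<and> is_root l x) \<longrightarrow> norm (F m l) = 1)} \<inter> ball l0 r"
      using eventually_nhds_in_open[of "ball l0 r" l0] r
      by (auto simp: eventually_at_filter elim: eventually_elim2)
    have neg: "- cnj l = l" if "Re l = 0" for l using that by (simp add: complex_eq_iff)
    have sym: "- cnj l \<in> ball l0 r \<longleftrightarrow> l \<in> ball l0 r" for l
      by (simp add: dist_reflection[OF l0])
    define g where "g = (\<lambda>l. F m l * cnj (F m (- cnj l)) - 1)"
    have "(\<lambda>l. cnj (F m (- cnj l))) holomorphic_on ball l0 r"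
      by (rule reflection_holomorphic[OF holomorphic_on_subset[OF hol]]) (use sym in auto)
    then have g: "g holomorphic_on ball l0 r" unfolding g_def by (intro holomorphic_intros hol)
    have "l0 islimpt closed_segment b c"
    proof (rule connected_imp_perfect)
      fix x
      show "closed_segment b c \<noteq> {x}"
      proof
        assume eq: "closed_segment b c = {x}"
        have "b \<in> {x}" "c \<in> {x}" unfolding eq[symmetric] by (rule ends_in_segment)+
        then show False using seg(1) by simp
      qed
    qed (use seg(2) in auto)
    from islimpt_Int_eventually[OF this ev]
    have lim0: "l0 islimpt {l \<in> ball l0 r. g l = 0}"
    proof (rule islimpt_subset, intro subsetI)
      fix l assume "l \<in> closed_segment b c \<inter> ({l. ((\<exists>x. norm x = 1 \<and> is_root l x) \<longrightarrow> norm (F m l) = 1)} \<inter> ball l0 r)"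
      then have l: "l \<in> closed_segment b c" "l \<in> ball l0 r"
        and imp: "(\<exists>x. norm x = 1 \<and> is_root l x) \<longrightarrow> norm (F m l) = 1" by blast+
      have "F m l * cnj (F m l) = complex_of_real ((norm (F m l))\<^sup>2)" by (rule complex_norm_square[symmetric])
      also have "norm (F m l) = 1" using seg(3)[OF l(1)] imp by (elim conjE) (rule mp)
      finally have "g l = 0" unfolding g_def neg[OF conjunct1[OF seg(3)[OF l(1)]]] by simp
      with l(2) show "l \<in> {l \<in> ball l0 r. g l = 0}" by simp
    qed
    have g0: "g l = 0" if "l \<in> ball l0 r" for l
      by (rule analytic_continuation[OF g open_ball connected_ball, of "{l \<in> ball l0 r. g l = 0}" l0])
         (use that r lim0 in auto)
    have "\<forall>\<^sub>F l in nhds l0. l \<in> ball l0 r" using r by (intro eventually_nhds_in_open) auto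
    then have "\<forall>\<^sub>F l in nhds l0. F m (- cnj l) * cnj (F m l) = 1"
    proof eventually_elim
      case (elim l)
      then have "g (- cnj l) = 0" using g0 sym by blast
      then show ?case by (simp add: g_def)
    qed
    from no_unimodular_values_off_axis[OF hol r l0 d this]
    show "\<forall>\<^sub>F l in nhds l0. norm (F m l) = 1 \<longrightarrow> Re l = 0" .
  qed
qed

end

section \<open>Multipliers of the periodic problem\<close>

lemma prod_list_extract:
  "m \<in> set rs \<Longrightarrow> linear_product rs = [:- m, 1:] * linear_product (remove1 m rs)"
proof (induction rs)
  case (Cons r rs)
  show ?case
  proof (cases "r = m")
    case True then show ?thesis by (simp only: remove1.simps simp_thms if_True list.map prod_list.Cons)
  next
    case False
    then have "linear_product rs = [:- m, 1:] * linear_product (remove1 m rs)"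
      using Cons by simp
    then have "linear_product (r # rs) = [:- r, 1:] * ([:- m, 1:] * linear_product (remove1 m rs))"
      by (simp only: list.map prod_list.Cons)
    also have "\<dots> = [:- m, 1:] * linear_product (remove1 m (r # rs))"
    proof -
      have "remove1 m (r # rs) = r # remove1 m rs" using False by simp
      then show ?thesis by (simp only: list.map prod_list.Cons mult.left_commute)
    qed
    finally show ?thesis .
  qed
qed simp

text \<open>
  The columns \<open>p\<close> of a Schur basis. Since the eigenvalues may be listed in any order, the first two
  columns span an invariant plane for any prescribed pair of roots of the characteristic polynomial,
  double roots included.
\<close>

lemma schur_columns:
  fixes B :: "complex mat"
  assumes B: "B \<in> carrier_mat n n" and es: "char_poly B = linear_product es"
  shows "\<exists>p b. (\<forall>i<n. \<forall>j<n. (\<Sum>k<n. B $$ (i, k) * p k j) = (\<Sum>k\<le>j. p i k * b k j)) \<and>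
     (\<forall>j<n. b j j = es ! j) \<and>
     (\<forall>\<alpha>. (\<forall>i<n. (\<Sum>j<n. p i j * \<alpha> j) = 0) \<longrightarrow> (\<forall>j<n. \<alpha> j = (0::complex)))"
proof -
  obtain U P Q where dec: "schur_decomposition B es = (U, P, Q)" by (metis prod_cases3)
  note S = schur_decomposition[OF B es dec]
  have dim: "dim_row B = n" using B by auto
  from S have carr: "U \<in> carrier_mat n n" "P \<in> carrier_mat n n" "Q \<in> carrier_mat n n"
    and QP: "Q * P = 1\<^sub>m n" and BPUQ: "B = P * U * Q" and tri: "upper_triangular U" and diag: "diag_mat U = es"
    by (auto simp: similar_mat_wit_def Let_def dim)
  have "B * P = P * U * (Q * P)"
    unfolding BPUQ using carr by (simp add: assoc_mult_mat[of _ n n _ n _ n])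
  then have BP: "B * P = P * U" using carr by (simp add: QP)
  have 1: "(\<Sum>k<n. B $$ (i, k) * P $$ (k, j)) = (\<Sum>k\<le>j. P $$ (i, k) * U $$ (k, j))" if ij: "i < n" "j < n" for i j
  proof -
    have "(\<Sum>k<n. B $$ (i, k) * P $$ (k, j)) = (B * P) $$ (i, j)"
      using B carr ij by (simp add: scalar_prod_def lessThan_atLeast0)
    also have "\<dots> = (\<Sum>k<n. P $$ (i, k) * U $$ (k, j))"
      unfolding BP using carr ij by (simp add: scalar_prod_def lessThan_atLeast0)
    also have "\<dots> = (\<Sum>k\<le>j. P $$ (i, k) * U $$ (k, j))"
    proof (rule sum.mono_neutral_right)
      show "\<forall>k\<in>{..<n} - {..j}. P $$ (i, k) * U $$ (k, j) = 0"
        using tri carr unfolding upper_triangular_def by auto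
    qed (use ij in auto)
    finally show ?thesis .
  qed
  have 2: "U $$ (j, j) = es ! j" if "j < n" for j
    using that carr unfolding diag[symmetric] by (simp add: diag_mat_def)
  have 3: "\<alpha> j = 0" if z: "\<forall>i<n. (\<Sum>j<n. P $$ (i, j) * \<alpha> j) = 0" and j: "j < n" for \<alpha> j
  proof -
    have "0 = (\<Sum>i<n. Q $$ (j, i) * (\<Sum>k<n. P $$ (i, k) * \<alpha> k))" using z by simp
    also have "\<dots> = (\<Sum>k<n. (\<Sum>i<n. Q $$ (j, i) * P $$ (i, k)) * \<alpha> k)"
      unfolding sum_distrib_left sum_distrib_right by (subst sum.swap) (simp add: mult.assoc)
    also have "\<dots> = (\<Sum>k<n. if k = j then \<alpha> k else 0)"
    proof (intro sum.cong refl)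
      fix k assume k: "k \<in> {..<n}"
      have "(\<Sum>i<n. Q $$ (j, i) * P $$ (i, k)) = (Q * P) $$ (j, k)"
        using carr j k by (simp add: scalar_prod_def lessThan_atLeast0)
      then show "(\<Sum>i<n. Q $$ (j, i) * P $$ (i, k)) * \<alpha> k = (if k = j then \<alpha> k else 0)"
        using j k by (simp add: QP)
    qed
    also have "\<dots> = \<alpha> j" using j by simp
    finally show ?thesis by simp
  qed
  show ?thesis
    by (rule exI[of _ "\<lambda>i j. P $$ (i, j)"], rule exI[of _ "\<lambda>i j. U $$ (i, j)"]) (use 1 2 3 in blast)
qed

locale periodic_problem =
  fixes n :: nat and T :: real and a :: "nat \<Rightarrow> real \<Rightarrow> real"
    and V :: "complex \<Rightarrow> real \<Rightarrow> complex mat" and M :: "complex \<Rightarrow> complex mat" and A :: real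
  assumes n_pos: "n > 0" and T_pos: "T > 0"
    and periodic: "k \<in> {1..n} \<Longrightarrow> a k (x + T) = a k x"
    and bounded: "k \<in> {1..n} \<Longrightarrow> \<bar>a k x\<bar> \<le> A"
    and principal: "principal_solution n a lam (V lam)"
    and monodromy: "M lam = V lam T"
begin

lemma V_carrier: "V lam x \<in> carrier_mat n n"
  using principal unfolding principal_solution_def by blast

lemma M_carrier: "M lam \<in> carrier_mat n n"
  unfolding monodromy by (rule V_carrier)

lemma column_solves:
  assumes "j < n"
  shows "solves n a lam (\<lambda>x i. V lam x $$ (i, j))"
  unfolding solves_def
proof (intro allI impI)
  fix x i assume i: "i < n"
  have "((\<lambda>y. V lam y $$ (i, j)) has_vector_derivative (companion_mat n a x lam * V lam x) $$ (i, j)) (at x)"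
    using principal i assms unfolding principal_solution_def by blast
  moreover have "companion_mat n a x lam \<in> carrier_mat n n" by (simp add: companion_mat_def)
  then have "(companion_mat n a x lam * V lam x) $$ (i, j) = (\<Sum>k<n. companion_mat n a x lam $$ (i, k) * V lam x $$ (k, j))"
    using V_carrier[of lam x] i assms by (simp add: scalar_prod_def lessThan_atLeast0)
  ultimately show "((\<lambda>y. V lam y $$ (i, j)) has_vector_derivative
      (\<Sum>k<n. companion_mat n a x lam $$ (i, k) * V lam x $$ (k, j))) (at x)" by simp
qed

lemma V_0: "i < n \<Longrightarrow> j < n \<Longrightarrow> V lam 0 $$ (i, j) = (if i = j then 1 else 0)"
  using principal[of lam] unfolding principal_solution_def by simp

lemma M_holomorphic:
  assumes "i < n" "j < n"
  shows "(\<lambda>lam. M lam $$ (i, j)) holomorphic_on UNIV"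
  unfolding monodromy
  by (rule solution_holomorphic_in_parameter[where a = a and A = A and v = "\<lambda>lam x i. V lam x $$ (i, j)"
        and c = "\<lambda>i. if i = j then 1 else 0", OF bounded less_imp_le[OF T_pos] column_solves[OF assms(2)] V_0[OF _ assms(2)] assms(1)])

sublocale P: holomorphic_monic_poly "\<lambda>l. char_poly (M l)" n
  by (rule char_poly_family[OF M_carrier M_holomorphic])

abbreviation multiplier :: "complex \<Rightarrow> complex \<Rightarrow> bool" where
  "multiplier l m \<equiv> poly (char_poly (M l)) m = 0"

abbreviation dlam :: "complex \<Rightarrow> complex \<Rightarrow> complex" where
  "dlam l m \<equiv> deriv (\<lambda>l. poly (char_poly (M l)) m) l"

text \<open>
  The situation at high frequency: simple multipliers that move with nonzero speed in \<open>l\<close>, of which at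
  most one is unimodular.
\<close>

definition separated_multipliers :: "complex \<Rightarrow> bool" where
  "separated_multipliers l \<longleftrightarrow> rsquarefree (char_poly (M l)) \<and> (\<forall>m. multiplier l m \<longrightarrow> dlam l m \<noteq> 0) \<and>
     (\<forall>m m'. multiplier l m \<longrightarrow> multiplier l m' \<longrightarrow> norm m = 1 \<longrightarrow> norm m' = 1 \<longrightarrow> m = m')"

definition sol :: "complex \<Rightarrow> (nat \<Rightarrow> complex) \<Rightarrow> real \<Rightarrow> nat \<Rightarrow> complex" where
  "sol lam c x i = (\<Sum>k<n. V lam x $$ (i, k) * c k)"

lemma sol_solves: "solves n a lam (sol lam c)"
  using solves_sum[of "{..<n}" n a lam "\<lambda>k x i. V lam x $$ (i, k)" c] column_solves
  unfolding sol_def by simp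

lemma sol_0: "i < n \<Longrightarrow> sol lam c 0 i = c i"
proof -
  assume i: "i < n"
  have "sol lam c 0 i = (\<Sum>k<n. if k = i then c k else 0)"
    unfolding sol_def using i by (intro sum.cong) (auto simp: V_0)
  then show ?thesis using i by simp
qed

lemma sol_T: "sol lam c T i = (\<Sum>k<n. M lam $$ (i, k) * c k)"
  by (simp add: sol_def monodromy)

lemma shifted_solution_eq:
  assumes v: "solves n a lam v" and w: "solves n a lam w" and eq: "\<And>i. i < n \<Longrightarrow> v T i = w 0 i" and i: "i < n"
  shows "v (x + T) i = w x i"
proof -
  \<comment> \<open>The factors \<open>1\<close> and \<open>-1\<close> bring \<open>u\<close> into the form of a linear combination of solutions.\<close>
  define u where "u = (\<lambda>x i. 1 * v (x + T) i + (- 1) * w x i)"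
  have u: "solves n a lam u"
    unfolding u_def by (intro solves_lincomb solves_shift periodic v w)
  have "u 0 k = 0" if "k < n" for k using eq[OF that] by (simp add: u_def)
  then have "u x i = 0"
    by (intro solves_unique_zero[where a = a and A = A and v = u, OF _ u _ i]) (auto intro: bounded)
  then show ?thesis by (simp add: u_def)
qed

lemma root_extract:
  assumes "multiplier l m"
  obtains rest where "char_poly (M l) = linear_product (m # rest)"
proof -
  obtain rs where rs: "char_poly (M l) = linear_product rs"
    using char_poly_factorized[OF M_carrier] by blast
  then have "m \<in> set rs" using assms by (auto simp: poly_prod_list_zero_iff)
  then have "char_poly (M l) = linear_product (m # remove1 m rs)"
    unfolding rs by (simp only: prod_list_extract list.map prod_list.Cons)
  then show thesis by (rule that)
qed

text \<open>
  Solutions started at the Schur columns: the period map is triangular in this basis.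
\<close>

lemma floquet_schur_basis:
  assumes es: "char_poly (M l) = linear_product es"
  shows "\<exists>v b. (\<forall>j<n. solves n a l (v j)) \<and>
     (\<forall>j<n. \<forall>x. \<forall>i<n. v j (x + T) i = (\<Sum>k\<le>j. v k x i * b k j)) \<and> (\<forall>j<n. b j j = es ! j) \<and>
     (\<forall>\<alpha>. (\<forall>i<n. (\<Sum>j<n. v j 0 i * \<alpha> j) = 0) \<longrightarrow> (\<forall>j<n. \<alpha> j = (0 :: complex)))"
proof -
  from schur_columns[OF M_carrier es] obtain p b where
    p: "\<forall>i<n. \<forall>j<n. (\<Sum>k<n. M l $$ (i, k) * p k j) = (\<Sum>k\<le>j. p i k * b k j)"
    and b: "\<forall>j<n. b j j = es ! j"
    and indep: "\<forall>\<alpha>. (\<forall>i<n. (\<Sum>j<n. p i j * \<alpha> j) = 0) \<longrightarrow> (\<forall>j<n. \<alpha> j = (0 :: complex))"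
    by (elim exE conjE)
  define v where "v = (\<lambda>j. sol l (\<lambda>k. p k j))"
  have v: "solves n a l (v j)" for j unfolding v_def by (rule sol_solves)
  have v0: "v j 0 i = p i j" if "i < n" for i j using that by (simp add: v_def sol_0)
  have "v j (x + T) i = (\<Sum>k\<le>j. v k x i * b k j)" if j: "j < n" and i: "i < n" for j x i
  proof (rule shifted_solution_eq[OF v solves_sum[OF v] _ i])
    fix i assume i: "i < n"
    have "v j T i = (\<Sum>k<n. M l $$ (i, k) * p k j)" by (simp only: v_def sol_T)
    also have "\<dots> = (\<Sum>k\<le>j. p i k * b k j)" using p i j by blast
    finally show "v j T i = (\<Sum>k\<le>j. v k 0 i * b k j)" by (simp only: v0[OF i])
  qed
  moreover have "\<alpha> j = 0" if z: "\<forall>i<n. (\<Sum>j<n. v j 0 i * \<alpha> j) = 0" and j: "j < n" for \<alpha> j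
  proof -
    have "\<forall>i<n. (\<Sum>j<n. p i j * \<alpha> j) = 0" using z by (auto simp only: v0)
    from mp[OF spec[OF indep] this] show ?thesis using j by blast
  qed
  ultimately show ?thesis using v b by (intro exI[of _ v] exI[of _ b] conjI allI impI) blast+
qed

text \<open>
  The first solution of a Schur basis is multiplied by \<open>m\<close> over one period.
\<close>

lemma multiplier_near_exponent:
  assumes e: "exponents n l \<kappa>" and l: "norm l \<ge> 1" and m: "multiplier l m"
  shows "m \<noteq> 0 \<and> (\<exists>k<n. \<bar>ln (norm m) / T - Re (\<kappa> k)\<bar> \<le> n * A)"
proof -
  obtain rest where "char_poly (M l) = linear_product (m # rest)" using root_extract[OF m] .
  from floquet_schur_basis[OF this] obtain v' b where
    v': "\<forall>j<n. solves n a l (v' j)"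
    and shift': "\<forall>j<n. \<forall>x. \<forall>i<n. v' j (x + T) i = (\<Sum>k\<le>j. v' k x i * b k j)"
    and b: "\<forall>j<n. b j j = (m # rest) ! j"
    and indep: "\<forall>\<alpha>. (\<forall>i<n. (\<Sum>j<n. v' j 0 i * \<alpha> j) = 0) \<longrightarrow> (\<forall>j<n. \<alpha> j = (0 :: complex))"
    by (elim exE conjE)
  define v where "v = v' 0"
  have v: "solves n a l v" using v' n_pos by (simp add: v_def)
  have shift: "v (x + T) i = m * v x i" if "i < n" for x i
  proof -
    have "v' 0 (x + T) i = (\<Sum>k\<le>0. v' k x i * b k 0)" using shift' n_pos that by blast
    moreover have "b 0 0 = m" using b n_pos by simp
    ultimately show ?thesis by (simp add: v_def)
  qed
  have "\<exists>i<n. v 0 i \<noteq> 0"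
  proof (rule ccontr)
    assume "\<not> ?thesis"
    then have "\<forall>i<n. (\<Sum>j<n. v' j 0 i * (if j = 0 then 1 else 0)) = 0" using n_pos by (simp add: v_def)
    from mp[OF spec[OF indep] this] have "\<forall>j<n. (if j = 0 then 1 else 0 :: complex) = 0" .
    then show False using n_pos by auto
  qed
  then obtain i where i: "i < n" "v 0 i \<noteq> 0" by blast
  have m0: "m \<noteq> 0" using shift[OF i(1), of "- T"] i by auto
  define w where "w = mode_coord n \<kappa> v"
  have nd: "nearly_diagonal n \<kappa> (n * A) w"
    unfolding w_def by (rule nearly_diagonal_mode_coord[where a = a, OF bounded e l v])
  have "\<exists>k<n. w 0 k \<noteq> 0"
  proof (rule ccontr)
    assume "\<not> ?thesis"
    then have "v 0 i = 0" unfolding mode_coord_inverse[OF e i(1), of v 0] by (simp add: w_def)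
    then show False using i by simp
  qed
  then obtain k where k: "k < n" "w 0 k \<noteq> 0" by blast
  have "norm (w (x + T) k) = norm m * norm (w x k)" if "k < n" for x k
  proof -
    have "w (x + T) k = m * w x k"
      by (simp add: w_def mode_coord_def shift sum_distrib_left)
    then show ?thesis by (simp add: norm_mult)
  qed
  from floquet_exponent_near_diagonal[OF nd T_pos _ this k] m0 show ?thesis by simp
qed

text \<open>
  The first two solutions of a Schur basis for the eigenvalues \<open>m1\<close>, \<open>m2\<close> form the pair with triangular
  period relations.
\<close>

lemma no_two_multipliers:
  assumes e: "exponents n l \<kappa>" and l: "norm l \<ge> 1"
    and fact: "char_poly (M l) = linear_product (m1 # m2 # rest)" and j: "j < n"
    and near: "\<bar>ln (norm m1) / T - Re (\<kappa> j)\<bar> \<le> n * A" "\<bar>ln (norm m2) / T - Re (\<kappa> j)\<bar> \<le> n * A"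
    and gap: "\<And>k. k < n \<Longrightarrow> k \<noteq> j \<Longrightarrow> \<bar>Re (\<kappa> k) - Re (\<kappa> j)\<bar> > 2 * (n * A) + 1"
  shows False
proof -
  have roots: "multiplier l m1" "multiplier l m2"
    unfolding fact by simp_all
  have n2: "1 < n"
    using degree_monic_char_poly[OF M_carrier, of l] degree_linear_factors[of uminus "m1 # m2 # rest"]
    by (simp only: fact) simp
  from floquet_schur_basis[OF fact] obtain v b where
    v: "\<forall>j<n. solves n a l (v j)"
    and shift: "\<forall>j<n. \<forall>x. \<forall>i<n. v j (x + T) i = (\<Sum>k\<le>j. v k x i * b k j)"
    and b: "\<forall>j<n. b j j = (m1 # m2 # rest) ! j"
    and indep: "\<forall>\<alpha>. (\<forall>i<n. (\<Sum>j<n. v j 0 i * \<alpha> j) = 0) \<longrightarrow> (\<forall>j<n. \<alpha> j = (0 :: complex))"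
    by (elim exE conjE)
  have v12: "solves n a l (v 0)" "solves n a l (v 1)" using v n2 by auto
  have shift1: "v 0 (x + T) i = m1 * v 0 x i" if "i < n" for x i
  proof -
    have "v 0 (x + T) i = (\<Sum>k\<le>0. v k x i * b k 0)" using shift n_pos that by blast
    moreover have "b 0 0 = m1" using b n_pos by simp
    ultimately show ?thesis by simp
  qed
  have shift2: "v 1 (x + T) i = m2 * v 1 x i + b 0 1 * v 0 x i" if "i < n" for x i
  proof -
    have "v 1 (x + T) i = (\<Sum>k\<le>1. v k x i * b k 1)" using shift n2 that by blast
    moreover have "b 1 1 = m2" using b n2 by simp
    ultimately show ?thesis by simp
  qed
  define w where "w = (\<lambda>j. mode_coord n \<kappa> (v j))"
  show False
  proof (rule no_two_multipliers_near_one_exponent[of n \<kappa> "n * A" "w 0" "w 1" T j m1 m2 "b 0 1"])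
    show "nearly_diagonal n \<kappa> (n * A) (\<lambda>x k. \<alpha> * w 0 x k + \<beta> * w 1 x k)" for \<alpha> \<beta>
      using nearly_diagonal_mode_coord[where a = a, OF bounded e l solves_lincomb[OF v12, of \<alpha> \<beta>]]
      by (simp add: w_def mode_coord_lincomb[abs_def])
    show "w 0 (x + T) k = m1 * w 0 x k" for x k
      by (simp add: w_def mode_coord_def shift1 sum_distrib_left)
    show "w 1 (x + T) k = m2 * w 1 x k + b 0 1 * w 0 x k" for x k
    proof -
      have "w 1 (x + T) k = (\<Sum>m<n. (m2 * v 1 x m + b 0 1 * v 0 x m) / \<kappa> k ^ m) / of_nat n"
        unfolding w_def mode_coord_def by (intro arg_cong2[where f = "(/)"] sum.cong) (simp_all only: lessThan_iff shift2)
      then show ?thesis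
        by (simp only: w_def mode_coord_def sum_distrib_left add_divide_distrib sum.distrib times_divide_eq_right)
    qed
    show "m1 \<noteq> 0" "m2 \<noteq> 0" using multiplier_near_exponent[OF e l] roots by blast+
    fix \<alpha> \<beta> assume z: "\<And>x k. k < n \<Longrightarrow> \<alpha> * w 0 x k + \<beta> * w 1 x k = 0"
    define c where "c = (\<lambda>j :: nat. if j = 0 then \<alpha> else if j = 1 then \<beta> else (0 :: complex))"
    have "(\<Sum>j<n. v j 0 i * c j) = 0" if i: "i < n" for i
    proof -
      have "(\<Sum>j<n. v j 0 i * c j) = (\<Sum>j\<in>{0, 1}. v j 0 i * c j)"
        using n2 by (intro sum.mono_neutral_right) (auto simp: c_def)
      also have "\<dots> = \<alpha> * v 0 0 i + \<beta> * v 1 0 i" by (simp add: c_def)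
      also have "\<dots> = (\<Sum>k<n. \<kappa> k ^ i * (\<alpha> * w 0 0 k + \<beta> * w 1 0 k))"
        using mode_coord_inverse[OF e i, of "\<lambda>x i. \<alpha> * v 0 x i + \<beta> * v 1 x i" 0]
        by (simp add: mode_coord_lincomb w_def)
      also have "\<dots> = 0" using z by simp
      finally show ?thesis .
    qed
    then have "\<forall>j<n. c j = 0" using spec[OF indep, of c] by simp
    then have "c 0 = 0" "c 1 = 0" using n2 by auto
    then show "\<alpha> = 0 \<and> \<beta> = 0" by (simp add: c_def)
  qed (use T_pos j near gap in auto)
qed

text \<open>
  There are \<open>n\<close> multipliers with multiplicity, each belongs to one of \<open>n\<close> exponents, and no exponent
  receives two of them.
\<close>

lemma multipliers_separated:
  assumes e: "exponents n l \<kappa>" and l: "norm l \<ge> 1"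
    and gap: "\<And>i j. i < n \<Longrightarrow> j < n \<Longrightarrow> i \<noteq> j \<Longrightarrow> \<bar>Re (\<kappa> i) - Re (\<kappa> j)\<bar> > 2 * (n * A) + 1"
  shows "rsquarefree (char_poly (M l))"
    and "j < n \<Longrightarrow> \<exists>!m. multiplier l m \<and> \<bar>ln (norm m) / T - Re (\<kappa> j)\<bar> \<le> n * A"
proof -
  define R where "R = {m. multiplier l m}"
  obtain rs where rs: "char_poly (M l) = linear_product rs" and len: "length rs = n"
    using char_poly_factorized[OF M_carrier] by blast
  have R: "R = set rs" unfolding R_def rs by (auto simp: poly_prod_list_zero_iff)
  define near where "near = (\<lambda>(m :: complex) j. \<bar>ln (norm m) / T - Re (\<kappa> j)\<bar> \<le> n * A)"
  have two: "False" if "m \<in> set rs" "m' \<in> set (remove1 m rs)" "j < n" "near m j" "near m' j" for m m' j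
  proof -
    have "char_poly (M l) = linear_product (m # m' # remove1 m' (remove1 m rs))"
      unfolding rs list.map prod_list.Cons by (simp only: prod_list_extract[OF that(1)] prod_list_extract[OF that(2)])
    from no_two_multipliers[OF e l this that(3)] that(4,5) gap that(3) show False unfolding near_def by blast
  qed
  have ex: "\<exists>j<n. near m j" if "m \<in> set rs" for m
    using multiplier_near_exponent[OF e l, of m] that R by (auto simp: R_def near_def)
  have "distinct rs"
  proof (rule ccontr)
    assume "\<not> distinct rs"
    then obtain xs ys zs m where dec: "rs = xs @ [m] @ ys @ [m] @ zs" using not_distinct_decomp by blast
    then have "m \<in> set rs" "m \<in> set (remove1 m rs)" by (auto simp: remove1_append)
    moreover obtain j where "j < n" "near m j" using ex[of m] dec by auto
    ultimately show False using two by blast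
  qed
  then have cardR: "card R = n" using R len by (simp add: distinct_card)
  then show "rsquarefree (char_poly (M l))"
    using rsquarefree_card_degree[OF P.P_nonzero, of l] by (simp add: R_def P.degree_P)
  obtain J where J: "\<And>m. m \<in> R \<Longrightarrow> J m < n \<and> near m (J m)" using ex R by metis
  have uniq: "m = m'" if "m \<in> R" "m' \<in> R" "j < n" "near m j" "near m' j" for m m' j
  proof (rule ccontr)
    assume "m \<noteq> m'"
    then have "m' \<in> set (remove1 m rs)" using that(2) R by (simp add: in_set_remove1)
    then show False using two[of m m' j] that R by blast
  qed
  have "inj_on J R"
  proof (rule inj_onI)
    fix m m' assume m: "m \<in> R" "m' \<in> R" and eq: "J m = J m'"
    show "m = m'" by (rule uniq[of m m' "J m"]) (use J[OF m(1)] J[OF m(2)] m eq in auto)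
  qed
  then have "card (J ` R) = n" using cardR by (simp add: card_image)
  moreover have "J ` R \<subseteq> {..<n}" using J by auto
  ultimately have im: "J ` R = {..<n}" by (intro card_subset_eq) auto
  show "\<exists>!m. multiplier l m \<and> \<bar>ln (norm m) / T - Re (\<kappa> j)\<bar> \<le> n * A" if j: "j < n"
  proof -
    have "j \<in> J ` R" using im j by simp
    then obtain m where m: "m \<in> R" "J m = j" by blast
    have "\<exists>!m. m \<in> R \<and> near m j"
    proof (rule ex1I[of _ m])
      show "m \<in> R \<and> near m j" using J[OF m(1)] m by simp
      fix m' assume "m' \<in> R \<and> near m' j"
      then show "m' = m" using uniq[of m' m j] J[OF m(1)] m j by simp
    qed
    then show ?thesis by (simp only: R_def near_def mem_Collect_eq)
  qed
qed

end

section \<open>High frequency\<close>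

context periodic_problem
begin

text \<open>
  On the disc the multiplier \<open>f l\<close> that belongs to exponent \<open>j\<close> is a holomorphic function, and
  \<open>H = f exp(-T \<kappa>\<^sub>j)\<close> satisfies \<open>exp(-CT) \<le> |H| \<le> exp(CT)\<close>. If \<open>f'\<close> vanished at \<open>l0\<close>, then \<open>|H'| = |H| T |\<kappa>\<^sub>j'|\<close>
  there, which for large \<open>\<kappa>\<^sub>j\<close> contradicts Cauchy's inequality. Since
  \<open>p\<^sub>\<lambda> + p\<^sub>\<mu> f' = 0\<close>, this is the claim.
\<close>

lemma simple_noncritical_of_separated_exponents:
  assumes r: "r > 0" "r < r'" and ball: "\<And>l. l \<in> ball l0 r' \<Longrightarrow> norm l \<ge> 1"
    and hol: "\<And>k. \<kappa> k holomorphic_on ball l0 r'"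
    and e: "\<And>l. l \<in> ball l0 r' \<Longrightarrow> exponents n l (\<lambda>k. \<kappa> k l)"
    and gap: "\<And>l i j. l \<in> ball l0 r' \<Longrightarrow> i < n \<Longrightarrow> j < n \<Longrightarrow> i \<noteq> j \<Longrightarrow>
                 \<bar>Re (\<kappa> i l) - Re (\<kappa> j l)\<bar> > 2 * (n * A) + 1"
    and large: "T * norm (\<kappa> 0 l0) * r > n * norm l0 * exp (2 * (n * A) * T)"
    and root: "multiplier l0 m0"
  shows "dlam l0 m0 \<noteq> 0"
proof -
  define C where "C = n * A"
  have l0: "l0 \<in> ball l0 r'" using r by simp
  define near where "near = (\<lambda>l (m :: complex) j. \<bar>ln (norm m) / T - Re (\<kappa> j l)\<bar> \<le> C)"
  have m_near: "m \<noteq> 0 \<and> (\<exists>k<n. near l m k)" if "l \<in> ball l0 r'" "multiplier l m" for l m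
    using multiplier_near_exponent[OF e[OF that(1)] ball[OF that(1)] that(2)] by (simp add: near_def C_def)
  have sqfree: "rsquarefree (char_poly (M l))" if "l \<in> ball l0 r'" for l
    by (rule multipliers_separated(1)[OF e[OF that] ball[OF that] gap[OF that]])
  have ex1: "\<exists>!m. multiplier l m \<and> near l m j" if "l \<in> ball l0 r'" "j < n" for l j
    unfolding near_def C_def by (rule multipliers_separated(2)[OF e[OF that(1)] ball[OF that(1)] gap[OF that(1)] that(2)])
  obtain j where j: "j < n" "near l0 m0 j" using m_near[OF l0 root] by blast
  define f where "f = (\<lambda>l. THE m. multiplier l m \<and> near l m j)"
  have f: "multiplier l (f l)" "near l (f l) j" if "l \<in> ball l0 r'" for l
    using theI'[OF ex1[OF that j(1)]] by (auto simp: f_def)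
  have f_eq: "m = f l" if "l \<in> ball l0 r'" "multiplier l m" "near l m j" for l m
    using ex1[OF that(1) j(1)] f[OF that(1)] that(2,3) by blast
  have fl0: "f l0 = m0" using f_eq[OF l0 root j(2)] by simp
  have "\<exists>D. (f has_field_derivative D) (at l1)" if l1: "l1 \<in> ball l0 r'" for l1
  proof -
    define m1 where "m1 = f l1"
    have m1: "multiplier l1 m1" "near l1 m1 j" using f[OF l1] by (auto simp: m1_def)
    then have m10: "m1 \<noteq> 0" using m_near[OF l1] by blast
    have "poly (pderiv (char_poly (M l1))) m1 \<noteq> 0"
      using sqfree[OF l1] m1(1) by (auto simp: rsquarefree_roots)
    with m1(1) have "\<exists>s h. s > 0 \<and> h holomorphic_on ball l1 s \<and> h l1 = m1 \<and>
        (\<forall>l\<in>ball l1 s. multiplier l (h l))"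
      using P.local_root_function by metis
    then obtain s h where s: "s > 0" and h: "h holomorphic_on ball l1 s"
      and h1: "h l1 = m1" and hroot: "\<And>l. l \<in> ball l1 s \<Longrightarrow> multiplier l (h l)" by blast
    have dh: "(h has_field_derivative deriv h l1) (at l1)"
      using h s by (intro holomorphic_derivI[of h "ball l1 s"]) auto
    have hlim: "(h \<longlongrightarrow> m1) (nhds l1)"
      using isCont_tendsto_nhds[OF DERIV_isCont[OF dh]] by (simp add: h1)
    have "isCont (\<kappa> j) l1"
      using holomorphic_on_imp_continuous_on[OF hol[of j]] l1 by (simp add: continuous_on_eq_continuous_at)
    then have \<kappa>lim: "(\<kappa> j \<longlongrightarrow> \<kappa> j l1) (nhds l1)"
      by (rule isCont_tendsto_nhds)
    have "((\<lambda>l. \<bar>ln (norm (h l)) / T - Re (\<kappa> j l)\<bar>) \<longlongrightarrow> \<bar>ln (norm m1) / T - Re (\<kappa> j l1)\<bar>) (nhds l1)"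
      using m10 T_pos by (intro tendsto_intros hlim \<kappa>lim) auto
    moreover have "\<bar>ln (norm m1) / T - Re (\<kappa> j l1)\<bar> < C + 1" using m1(2) by (simp add: near_def)
    ultimately have "\<forall>\<^sub>F l in nhds l1. \<bar>ln (norm (h l)) / T - Re (\<kappa> j l)\<bar> < C + 1" by (rule order_tendstoD)
    moreover have "\<forall>\<^sub>F l in nhds l1. l \<in> ball l0 r'" using l1 by (intro eventually_nhds_in_open) auto
    moreover have "\<forall>\<^sub>F l in nhds l1. l \<in> ball l1 s" using s by (intro eventually_nhds_in_open) auto
    ultimately have "\<forall>\<^sub>F l in nhds l1. h l = f l"
    proof eventually_elim
      case (elim l)
      obtain k where k: "k < n" "near l (h l) k" using m_near[OF elim(2) hroot[OF elim(3)]] by blast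
      have "\<bar>Re (\<kappa> k l) - Re (\<kappa> j l)\<bar> < 2 * C + 1" using k(2) elim(1) unfolding near_def by linarith
      \<comment> \<open>The continued root belongs to some exponent \<open>k\<close>; by continuity it is still within \<open>C + 1\<close> of exponent \<open>j\<close>.\<close>
      then have "k = j" using gap[OF elim(2) k(1) j(1)] by (force simp: C_def)
      then show ?case using f_eq[OF elim(2) hroot[OF elim(3)]] k(2) by simp
    qed
    then have "(f has_field_derivative deriv h l1) (at l1)"
      using dh DERIV_cong_ev[OF refl _ refl, of h f l1] by blast
    then show ?thesis by blast
  qed
  then have fhol: "f holomorphic_on ball l0 r'"
    by (meson field_differentiable_def holomorphic_on_def field_differentiable_at_within)
  define H where "H = (\<lambda>l. f l * exp (- (of_real T * \<kappa> j l)))"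
  have Hhol: "H holomorphic_on ball l0 r'" unfolding H_def by (intro holomorphic_intros fhol hol)
  have normH: "norm (H l) \<le> exp (C * T)" "exp (- (C * T)) \<le> norm (H l)" if l: "l \<in> ball l0 r'" for l
  proof -
    have "f l \<noteq> 0" using m_near[OF l f(1)[OF l]] by blast
    then have "norm (H l) = exp (ln (norm (f l)) - T * Re (\<kappa> j l))"
      by (simp add: H_def norm_mult norm_divide exp_diff exp_minus field_simps)
    moreover have "\<bar>ln (norm (f l)) - T * Re (\<kappa> j l)\<bar> \<le> C * T"
    proof -
      have "ln (norm (f l)) - T * Re (\<kappa> j l) = T * (ln (norm (f l)) / T - Re (\<kappa> j l))"
        using T_pos by (simp add: field_simps)
      then show ?thesis
        using f(2)[OF l] T_pos by (simp add: near_def abs_mult mult.commute)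
    qed
    ultimately show "norm (H l) \<le> exp (C * T)" "exp (- (C * T)) \<le> norm (H l)" by auto
  qed
  have sub: "cball l0 r \<subseteq> ball l0 r'" using r by auto
  have "norm ((deriv ^^ 1) H l0) \<le> fact 1 * exp (C * T) / r ^ 1"
  proof (rule Cauchy_inequality[OF _ _ r(1)])
    show "H holomorphic_on ball l0 r" using Hhol sub by (meson ball_subset_cball holomorphic_on_subset subset_trans)
    show "continuous_on (cball l0 r) H"
      using holomorphic_on_imp_continuous_on[OF holomorphic_on_subset[OF Hhol sub]] .
    show "norm (H x) \<le> exp (C * T)" if "norm (l0 - x) = r" for x
      using that sub by (intro normH) (auto simp: dist_norm)
  qed
  then have cauchy: "norm (deriv H l0) \<le> exp (C * T) / r" by simp
  have d\<kappa>: "(\<kappa> j has_field_derivative deriv (\<kappa> j) l0) (at l0)"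
    using hol l0 by (intro holomorphic_derivI[of _ "ball l0 r'"]) auto
  have df: "(f has_field_derivative deriv f l0) (at l0)"
    using fhol l0 by (intro holomorphic_derivI[of _ "ball l0 r'"]) auto
  have norm_d\<kappa>: "n * norm l0 * norm (deriv (\<kappa> j) l0) = norm (\<kappa> 0 l0)"
  proof -
    have "((\<lambda>l. \<kappa> j l ^ n) has_field_derivative of_nat n * \<kappa> j l0 ^ (n - Suc 0) * deriv (\<kappa> j) l0) (at l0)"
      by (rule derivative_eq_intros d\<kappa> refl | simp)+
    moreover have "((\<lambda>l. \<kappa> j l ^ n) has_field_derivative 1) (at l0)"
    proof (rule has_field_derivative_transform_within_open[OF DERIV_ident open_ball l0])
      show "l = \<kappa> j l ^ n" if "l \<in> ball l0 r'" for l
        using exponents_power[OF e[OF that] n_pos, of j] by simp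
    qed
    ultimately have "of_nat n * \<kappa> j l0 ^ (n - Suc 0) * deriv (\<kappa> j) l0 = 1" by (rule DERIV_unique)
    then have "of_nat n * (\<kappa> j l0 * \<kappa> j l0 ^ (n - Suc 0)) * deriv (\<kappa> j) l0 = \<kappa> j l0"
      by (metis mult.assoc mult.commute mult_1_right)
    also have "\<kappa> j l0 * \<kappa> j l0 ^ (n - Suc 0) = l0"
      using n_pos exponents_power[OF e[OF l0] n_pos, of j] by (simp flip: power_Suc)
    finally have "norm (of_nat n * l0 * deriv (\<kappa> j) l0) = norm (\<kappa> j l0)" by simp
    then show ?thesis using exponents_norm[OF e[OF l0], of j 0] by (simp add: norm_mult)
  qed
  have "deriv f l0 \<noteq> 0"
  proof
    assume df0: "deriv f l0 = 0"
    have "(H has_field_derivative H l0 * (- (of_real T * deriv (\<kappa> j) l0))) (at l0)"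
      unfolding H_def by (rule derivative_eq_intros df d\<kappa> refl | simp add: df0 mult_ac)+
    then have "deriv H l0 = H l0 * (- (of_real T * deriv (\<kappa> j) l0))" by (rule DERIV_imp_deriv)
    then have "norm (deriv H l0) = norm (H l0) * (T * norm (deriv (\<kappa> j) l0))"
      using T_pos by (simp add: norm_mult)
    moreover have "exp (- (C * T)) * (T * norm (deriv (\<kappa> j) l0)) \<le> norm (H l0) * (T * norm (deriv (\<kappa> j) l0))"
      using normH(2)[OF l0] T_pos by (intro mult_right_mono) auto
    ultimately have "exp (- (C * T)) * (T * norm (deriv (\<kappa> j) l0)) \<le> exp (C * T) / r" using cauchy by simp
    then have "exp (C * T) * (exp (- (C * T)) * (T * norm (deriv (\<kappa> j) l0)) * r) \<le> exp (C * T) * exp (C * T)"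
      using r(1) by (simp add: pos_le_divide_eq)
    also have "exp (C * T) * exp (C * T) = exp (2 * C * T)" by (simp flip: exp_add)
    also have "exp (C * T) * (exp (- (C * T)) * (T * norm (deriv (\<kappa> j) l0)) * r) = T * norm (deriv (\<kappa> j) l0) * r"
      by (simp add: exp_minus)
    finally have "n * norm l0 * (T * norm (deriv (\<kappa> j) l0) * r) \<le> n * norm l0 * exp (2 * C * T)"
      by (intro mult_left_mono) auto
    moreover have "n * norm l0 * (T * norm (deriv (\<kappa> j) l0) * r) = T * norm (\<kappa> 0 l0) * r"
      unfolding norm_d\<kappa>[symmetric] by (simp add: mult_ac)
    ultimately show False using large by (simp add: C_def)
  qed
  moreover have "r' > 0" using r by simp
  ultimately have "deriv f l0 \<noteq> 0 \<and> poly (pderiv (char_poly (M l0))) (f l0) \<noteq> 0"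
    using sqfree[OF l0] f(1)[OF l0] by (auto simp: rsquarefree_roots)
  then show ?thesis
    using P.root_function_derivative[OF fhol _ f(1)] r by (auto simp: fl0)
qed

lemma large_imaginary_axis:
  "\<exists>R. \<forall>l. Re l = 0 \<longrightarrow> norm l > R \<longrightarrow> separated_multipliers l"
proof -
  define C where "C = n * A"
  have "A \<ge> 0" using bounded[of n 0] n_pos by force
  then have C0: "C \<ge> 0" by (simp add: C_def)
  from exponents_near_imaginary_axis[OF n_pos] obtain \<delta> g where \<delta>: "0 < \<delta>" "\<delta> \<le> 1/2" and g: "g > 0"
    and E: "\<And>s :: real. s \<noteq> 0 \<Longrightarrow> \<exists>\<kappa>. (\<forall>k. \<kappa> k holomorphic_on ball (\<i> * s) (\<delta> * \<bar>s\<bar>)) \<and>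
       (\<forall>l\<in>ball (\<i> * s) (\<delta> * \<bar>s\<bar>). exponents n l (\<lambda>k. \<kappa> k l) \<and>
          (\<forall>i<n. \<forall>j<n. i \<noteq> j \<longrightarrow> \<bar>Re (\<kappa> i l) - Re (\<kappa> j l)\<bar> \<ge> g * root n \<bar>s\<bar>))" by metis
  \<comment> \<open>\<open>K1\<close> is the size of the roots at which the gaps exceed \<open>2C + 1\<close>, \<open>K2\<close> the one at which \<open>\<kappa>\<^sub>k'\<close> beats
    Cauchy's inequality on the disc of radius \<open>\<delta>|s|/2\<close>; the summand \<open>2\<close> in \<open>R\<close> keeps the discs outside the unit disc.\<close>
  define K1 where "K1 = (2 * C + 1) / g"
  define K2 where "K2 = 2 * n * exp (2 * C * T) / (\<delta> * T)"
  have K: "K1 \<ge> 0" "K2 \<ge> 0" using C0 g \<delta> T_pos by (auto simp: K1_def K2_def)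
  define R where "R = 2 + K1 ^ n + K2 ^ n"
  have main: "separated_multipliers (\<i> * s)" if s: "\<bar>s\<bar> > R" for s :: real
  proof -
    have "K1 ^ n \<ge> 0" "K2 ^ n \<ge> 0" using K by auto
    then have s2: "\<bar>s\<bar> > 2" and s1: "\<bar>s\<bar> > K1 ^ n" "\<bar>s\<bar> > K2 ^ n" using s by (auto simp: R_def)
    define \<rho> where "\<rho> = root n \<bar>s\<bar>"
    have \<rho>K: "\<rho> > K1" "\<rho> > K2"
      using s1 K n_pos real_root_less_mono[OF n_pos] by (metis \<rho>_def real_root_power_cancel)+
    define l0 where "l0 = \<i> * complex_of_real s"
    define r' where "r' = \<delta> * \<bar>s\<bar>"
    have nl0: "norm l0 = \<bar>s\<bar>" by (simp add: l0_def norm_mult)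
    have r': "r' > 0" using \<delta> s2 by (simp add: r'_def)
    obtain \<kappa> where hol: "\<And>k. \<kappa> k holomorphic_on ball l0 r'"
      and e: "\<And>l. l \<in> ball l0 r' \<Longrightarrow> exponents n l (\<lambda>k. \<kappa> k l)"
      and gap: "\<And>l i j. l \<in> ball l0 r' \<Longrightarrow> i < n \<Longrightarrow> j < n \<Longrightarrow> i \<noteq> j \<Longrightarrow> \<bar>Re (\<kappa> i l) - Re (\<kappa> j l)\<bar> \<ge> g * \<rho>"
      using E[of s] s2 unfolding l0_def r'_def \<rho>_def by fastforce
    have "g * \<rho> > g * K1" using \<rho>K g by simp
    then have "g * \<rho> > 2 * C + 1" using g by (simp add: K1_def)
    then have gap': "\<bar>Re (\<kappa> i l) - Re (\<kappa> j l)\<bar> > 2 * (n * A) + 1"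
      if "l \<in> ball l0 r'" "i < n" "j < n" "i \<noteq> j" for l i j
      using gap[OF that] by (simp add: C_def)
    have ball: "norm l \<ge> 1" if "l \<in> ball l0 r'" for l
    proof -
      have "r' \<le> \<bar>s\<bar> / 2" using \<delta>(2) s2 unfolding r'_def by (metis mult.commute mult_left_mono abs_ge_zero times_divide_eq_right mult_1_right)
      moreover have "norm l0 - norm l \<le> dist l0 l" by (simp add: dist_norm norm_triangle_ineq2)
      moreover have "dist l0 l < r'" using that by simp
      ultimately show ?thesis using nl0 s2 by linarith
    qed
    have l0b: "l0 \<in> ball l0 r'" using r' by simp
    have norm\<kappa>: "norm (\<kappa> 0 l0) = \<rho>"
    proof -
      have "norm (\<kappa> 0 l0) ^ n = \<bar>s\<bar>"
        using exponents_power[OF e[OF l0b] n_pos, of 0] nl0 by (simp flip: norm_power)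
      then show ?thesis unfolding \<rho>_def using n_pos by (metis norm_ge_zero real_root_power_cancel)
    qed
    have large: "T * norm (\<kappa> 0 l0) * (r' / 2) > n * norm l0 * exp (2 * (n * A) * T)"
    proof -
      have "\<delta> * T * K2 < \<delta> * T * \<rho>" using \<rho>K(2) \<delta> T_pos by simp
      then have "2 * n * exp (2 * C * T) < \<delta> * T * \<rho>" using \<delta> T_pos by (simp add: K2_def)
      then have "2 * n * exp (2 * C * T) * (\<bar>s\<bar> / 2) < \<delta> * T * \<rho> * (\<bar>s\<bar> / 2)"
        using s2 by (intro mult_strict_right_mono) auto
      then show ?thesis unfolding norm\<kappa> nl0 r'_def C_def by (simp add: mult_ac)
    qed
    have 1: "rsquarefree (char_poly (M l0))"
      by (rule multipliers_separated(1)[OF e[OF l0b] ball[OF l0b] gap'[OF l0b]])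
    have 2: "dlam l0 m \<noteq> 0" if "multiplier l0 m" for m
      by (rule simple_noncritical_of_separated_exponents[where r = "r' / 2" and r' = r' and \<kappa> = \<kappa>,
            OF _ _ ball hol e gap' large that]) (use r' in auto)
    have 3: "m = m'" if m: "multiplier l0 m" "multiplier l0 m'" "norm m = 1" "norm m' = 1" for m m'
    proof -
      note near = multiplier_near_exponent[OF e[OF l0b] ball[OF l0b]]
      obtain j where j: "j < n" "\<bar>ln (norm m) / T - Re (\<kappa> j l0)\<bar> \<le> n * A" using near[OF m(1)] by blast
      obtain k where k: "k < n" "\<bar>ln (norm m') / T - Re (\<kappa> k l0)\<bar> \<le> n * A" using near[OF m(2)] by blast
      have "\<bar>Re (\<kappa> j l0) - Re (\<kappa> k l0)\<bar> \<le> 2 * (n * A)" using j(2) k(2) m(3,4) by simp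
      then have jk: "j = k" using gap'[OF l0b j(1) k(1)] by force
      show ?thesis
        using multipliers_separated(2)[OF e[OF l0b] ball[OF l0b] gap'[OF l0b] j(1)] m j(2) k(2) jk by blast
    qed
    show ?thesis using 1 2 3 unfolding l0_def separated_multipliers_def by blast
  qed
  show ?thesis
  proof (rule exI[of _ R], intro allI impI)
    fix l assume "Re l = 0" "norm l > R"
    then have "l = \<i> * complex_of_real (Im l)" "\<bar>Im l\<bar> > R" by (auto simp: complex_eq_iff cmod_def)
    then show "separated_multipliers l"
      using main[of "Im l"] by simp
  qed
qed

end

section \<open>Finiteness\<close>

lemma smooth_real_imp_continuous: "smooth_real f \<Longrightarrow> continuous_on S f"
  unfolding smooth_real_def
  by (intro continuous_at_imp_continuous_on ballI differentiable_imp_continuous_within) (metis funpow_0)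

lemma periodic_continuous_bounded:
  fixes f :: "real \<Rightarrow> real"
  assumes "T > 0" "\<And>x. f (x + T) = f x" "continuous_on UNIV f"
  shows "\<exists>B. \<forall>x. \<bar>f x\<bar> \<le> B"
  using periodic_attains_max[of T "\<lambda>x. \<bar>f x\<bar>"] assms by (auto intro: continuous_on_rabs)

lemma entire_finite_zeros:
  assumes "E holomorphic_on UNIV" "E l \<noteq> 0" "compact K"
  shows "finite {z \<in> K. E z = 0}"
proof (cases "E constant_on UNIV")
  case True
  then have "E z \<noteq> 0" for z using assms(2) by (auto simp: constant_on_def)
  then show ?thesis by simp
next
  case False
  show ?thesis
    by (rule holomorphic_compact_finite_zeros[OF assms(1) open_UNIV connected_UNIV assms(3) subset_UNIV False])
qed

lemma Phi_zero_common_root: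
  assumes "Phi n M l = 0"
  shows "\<exists>m. poly (char_pol n M l) m = 0 \<and> poly (char_pol_dlam n M l) m = 0"
proof -
  define d where "d = gcd (char_pol n M l) (char_pol_dlam n M l)"
  have "degree d \<noteq> 0" using assms unfolding Phi_def d_def resultant_0_gcd .
  then have "\<not> constant (poly d)" by (simp add: constant_degree)
  then obtain m where "poly d m = 0" using fundamental_theorem_of_algebra by blast
  moreover have "d dvd char_pol n M l" "d dvd char_pol_dlam n M l" by (auto simp: d_def)
  ultimately show ?thesis by (metis dvdE mult_zero_left poly_mult)
qed

lemma no_bifurcation_if_spectrum_on_axis:
  assumes ev: "\<forall>\<^sub>F l in nhds l0. l \<in> S \<longrightarrow> Re l = 0"
  shows "\<not> bifurcates_transversally S l0"
proof
  assume "bifurcates_transversally S l0"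
  then obtain \<gamma> where \<gamma>: "path \<gamma>" "pathstart \<gamma> = l0" "path_image \<gamma> \<subseteq> S" "\<forall>t\<in>{0<..1}. \<gamma> t \<notin> imag_axis"
    unfolding bifurcates_transversally_def by blast
  obtain e where e: "e > 0" "\<And>l. dist l l0 < e \<Longrightarrow> l \<in> S \<Longrightarrow> Re l = 0"
    using ev unfolding eventually_nhds_metric by blast
  have "continuous_on {0..1} \<gamma>" using \<gamma>(1) by (simp add: path_def)
  then obtain d where d: "d > 0" "\<And>t. t \<in> {0..1} \<Longrightarrow> dist t 0 < d \<Longrightarrow> dist (\<gamma> t) (\<gamma> 0) < e"
    using e(1) unfolding continuous_on_iff by (metis atLeastAtMost_iff order_refl zero_le_one)
  define t where "t = min 1 (d / 2)"
  have t: "t \<in> {0<..1}" "dist t 0 < d" using d(1) by (auto simp: t_def)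
  then have "dist (\<gamma> t) l0 < e" using d(2)[of t] \<gamma>(2) by (simp add: pathstart_def)
  moreover have "\<gamma> t \<in> S" using \<gamma>(3) t by (auto simp: path_image_def)
  ultimately have "Re (\<gamma> t) = 0" by (rule e(2))
  then show False using \<gamma>(4) t by blast
qed

context periodic_problem
begin

lemma char_pol_smult: "char_pol n M l = Polynomial.smult ((- 1) ^ n) (char_poly (M l))"
  by (rule char_pol_eq_char_poly[OF M_carrier])

lemma ess_spectrum_iff: "l \<in> ess_spectrum n M \<longleftrightarrow> (\<exists>m. norm m = 1 \<and> multiplier l m)"
  by (simp add: ess_spectrum_def char_pol_smult)

lemma coeff_char_pol_holomorphic: "(\<lambda>l. coeff (char_pol n M l) i) holomorphic_on UNIV"
  unfolding char_pol_smult coeff_smult by (intro holomorphic_intros P.coeff_holomorphic)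

lemma coeff_char_pol_dlam:
  "coeff (char_pol_dlam n M l) k = (if k \<le> n then deriv (\<lambda>l. coeff (char_pol n M l) k) l else 0)"
  by (simp add: char_pol_dlam_def coeff_sum)

lemma poly_char_pol_dlam: "poly (char_pol_dlam n M l) m = (- 1) ^ n * dlam l m"
proof -
  have c: "((\<lambda>l. coeff (char_pol n M l) i) has_field_derivative deriv (\<lambda>l. coeff (char_pol n M l) i) l) (at l)" for i
    by (rule holomorphic_derivI[OF coeff_char_pol_holomorphic open_UNIV UNIV_I])
  have "((\<lambda>l. \<Sum>i\<le>n. coeff (char_pol n M l) i * m ^ i) has_field_derivative
      (\<Sum>i\<le>n. deriv (\<lambda>l. coeff (char_pol n M l) i) l * m ^ i)) (at l)"
    by (rule derivative_eq_intros c refl | simp)+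
  moreover have "(\<Sum>i\<le>n. coeff (char_pol n M l) i * m ^ i) = (- 1) ^ n * poly (char_poly (M l)) m" for l
    by (simp add: char_pol_smult P.poly_P sum_distrib_left mult.assoc)
  ultimately have "((\<lambda>l. (- 1) ^ n * poly (char_poly (M l)) m) has_field_derivative poly (char_pol_dlam n M l) m) (at l)"
    by (simp add: char_pol_dlam_def poly_sum poly_monom)
  moreover have "((\<lambda>l. (- 1) ^ n * poly (char_poly (M l)) m) has_field_derivative
      (- 1) ^ n * dlam l m) (at l)"
    by (intro DERIV_cmult holomorphic_derivI[OF P.value_holomorphic open_UNIV UNIV_I])
  ultimately show ?thesis by (rule DERIV_unique)
qed

text \<open>
  Outside a compact part \<open>K\<close> of the axis there are neither common roots of \<open>p\<close> and \<open>p\<^sub>\<lambda>\<close> nor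
  bifurcation points. Inside, the entire function \<open>E1\<close> vanishes where \<open>p\<close> and \<open>p\<^sub>\<lambda>\<close> have a common root, \<open>E2\<close>
  where \<open>p\<close> has a multiple root, and \<open>G\<close> where \<open>p\<close> has more common roots with its reflection than
  generically. The values on the axis outside \<open>K\<close> show that \<open>E1\<close> and \<open>E2\<close> are not identically zero.
\<close>

lemma finitely_many_bifurcations:
   "finite {l \<in> imag_axis. Phi n M l = 0} \<and> finite {l0. bifurcates_transversally (ess_spectrum n M) l0}"
proof -
  obtain R where R: "\<forall>l. Re l = 0 \<longrightarrow> norm l > R \<longrightarrow> separated_multipliers l"
    using large_imaginary_axis by blast
  define K where "K = {l \<in> cball 0 R. Re l = 0}"
  have "closed {l. Re l = 0}" by (intro closed_Collect_eq continuous_intros)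
  then have "compact (cball 0 R \<inter> {l. Re l = 0})" by (intro compact_Int_closed) auto
  then have K: "compact K" by (simp add: K_def Int_def)
  have simple: "rsquarefree (char_poly (M l))" if "Re l = 0" "l \<notin> K" for l
    using R that by (simp add: K_def separated_multipliers_def)
  have noncrit: "dlam l m \<noteq> 0"
    if "Re l = 0" "l \<notin> K" "multiplier l m" for l m
    using R that by (simp add: K_def separated_multipliers_def)
  have single: "m = m'" if "Re l = 0" "l \<notin> K" "multiplier l m" "multiplier l m'"
    "norm m = 1" "norm m' = 1" for l m m'
    using R that by (auto simp: K_def separated_multipliers_def)
  define l2 where "l2 = \<i> * complex_of_real (\<bar>R\<bar> + 1)"
  have l2: "Re l2 = 0" "l2 \<notin> K" by (auto simp: l2_def K_def norm_mult simp del: of_real_add)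
  have "\<exists>E. E holomorphic_on UNIV \<and>
    (\<forall>l. E l = 0 \<longleftrightarrow> (\<exists>m. multiplier l m \<and> poly (char_pol_dlam n M l) m = 0))"
  proof (rule common_root_indicator[OF M_carrier M_holomorphic])
    show "degree (char_pol_dlam n M l) \<le> n" for l by (rule degree_le) (simp add: coeff_char_pol_dlam)
    show "(\<lambda>l. coeff (char_pol_dlam n M l) k) holomorphic_on UNIV" for k
      unfolding coeff_char_pol_dlam
      by (cases "k \<le> n") (auto intro: holomorphic_deriv[OF coeff_char_pol_holomorphic open_UNIV])
  qed
  then obtain E1 where E1: "E1 holomorphic_on UNIV"
    "\<And>l. E1 l = 0 \<longleftrightarrow> (\<exists>m. multiplier l m \<and> poly (char_pol_dlam n M l) m = 0)"
    by blast
  have "\<exists>E. E holomorphic_on UNIV \<and>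
    (\<forall>l. E l = 0 \<longleftrightarrow> (\<exists>m. multiplier l m \<and> poly (pderiv (char_poly (M l))) m = 0))"
  proof (rule common_root_indicator[OF M_carrier M_holomorphic])
    show "degree (pderiv (char_poly (M l))) \<le> n" for l
      by (rule degree_le) (use P.degree_P[of l] in \<open>simp add: coeff_pderiv coeff_eq_0\<close>)
    show "(\<lambda>l. coeff (pderiv (char_poly (M l))) k) holomorphic_on UNIV" for k
      unfolding coeff_pderiv by (intro holomorphic_intros P.coeff_holomorphic)
  qed
  then obtain E2 where E2: "E2 holomorphic_on UNIV"
    "\<And>l. E2 l = 0 \<longleftrightarrow> (\<exists>m. multiplier l m \<and> poly (pderiv (char_poly (M l))) m = 0)"
    by blast
  have "\<exists>G N. G holomorphic_on UNIV \<and> (\<exists>l. G l \<noteq> 0) \<and>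
    (\<forall>l rs. G l \<noteq> 0 \<longrightarrow> char_poly (M l) = linear_product rs \<longrightarrow>
        length (filter (\<lambda>r. poly (reflected_poly n (\<lambda>l. char_poly (M l)) l) r = 0) rs) = N)"
    by (rule common_root_count[OF M_carrier M_holomorphic degree_reflected_poly P.coeff_reflected_holomorphic])
  then obtain G N where G: "G holomorphic_on UNIV" "\<exists>l. G l \<noteq> 0"
    and count: "\<And>l rs. G l \<noteq> 0 \<Longrightarrow> char_poly (M l) = linear_product rs \<Longrightarrow>
        length (filter (\<lambda>r. poly (reflected_poly n (\<lambda>l. char_poly (M l)) l) r = 0) rs) = N"
    by metis
  have E1_outside: "E1 l \<noteq> 0" if "Re l = 0" "l \<notin> K" for l
    using noncrit[OF that] by (auto simp: E1(2) poly_char_pol_dlam)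
  have E2_outside: "E2 l2 \<noteq> 0"
    using simple[OF l2] by (auto simp: E2(2) rsquarefree_roots)
  have fin1: "finite {l \<in> K. E1 l = 0}" by (rule entire_finite_zeros[OF E1(1) E1_outside[OF l2] K])
  have fin2: "finite {l \<in> K. E2 l = 0}" by (rule entire_finite_zeros[OF E2(1) E2_outside K])
  obtain l1 where "G l1 \<noteq> 0" using G(2) by blast
  then have fin3: "finite {l \<in> K. G l = 0}" by (rule entire_finite_zeros[OF G(1) _ K])
  have "{l \<in> imag_axis. Phi n M l = 0} \<subseteq> {l \<in> K. E1 l = 0}"
  proof
    fix l assume "l \<in> {l \<in> imag_axis. Phi n M l = 0}"
    then have l: "Re l = 0" "Phi n M l = 0" by auto
    obtain m where "poly (char_pol n M l) m = 0" "poly (char_pol_dlam n M l) m = 0"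
      using Phi_zero_common_root[OF l(2)] by blast
    then have E0: "E1 l = 0" unfolding E1(2) by (auto simp: char_pol_smult)
    moreover have "l \<in> K" using E0 E1_outside[OF l(1)] by blast
    ultimately show "l \<in> {l \<in> K. E1 l = 0}" by simp
  qed
  moreover have "{l0. bifurcates_transversally (ess_spectrum n M) l0} \<subseteq> {l \<in> K. E1 l = 0} \<union> {l \<in> K. E2 l = 0} \<union> {l \<in> K. G l = 0}"
  proof
    fix l0 assume "l0 \<in> {l0. bifurcates_transversally (ess_spectrum n M) l0}"
    then have bif: "bifurcates_transversally (ess_spectrum n M) l0" by simp
    then have l0: "Re l0 = 0" by (simp add: bifurcates_transversally_def)
    from bif obtain b c where bc: "b \<noteq> c" "l0 \<in> closed_segment b c"
      "closed_segment b c \<subseteq> ess_spectrum n M \<inter> imag_axis"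
      unfolding bifurcates_transversally_def by blast
    have not_ev: "\<not> (\<forall>\<^sub>F l in nhds l0. (\<exists>m. norm m = 1 \<and> multiplier l m) \<longrightarrow> Re l = 0)"
      using no_bifurcation_if_spectrum_on_axis[of "ess_spectrum n M" l0] bif unfolding ess_spectrum_iff by blast
    have "l0 \<in> K"
    proof (rule ccontr)
      assume "l0 \<notin> K"
      note far = l0 this
      have "\<forall>\<^sub>F l in nhds l0. (\<exists>m. norm m = 1 \<and> multiplier l m) \<longrightarrow> Re l = 0"
      proof (rule P.spectrum_on_axis_near_segment_point[OF l0 _ _ _ bc(1,2)])
        show "rsquarefree (char_poly (M l0))" by (rule simple[OF far])
        show "dlam l0 m \<noteq> 0" if "multiplier l0 m" for m
          by (rule noncrit[OF far that])
        show "m = m'" if "multiplier l0 m" "multiplier l0 m'" "norm m = 1" "norm m' = 1" for m m'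
          by (rule single[OF far that])
        show "Re l = 0 \<and> (\<exists>x. norm x = 1 \<and> multiplier l x)" if "l \<in> closed_segment b c" for l
          using that bc(3) ess_spectrum_iff by blast
      qed
      then show False using not_ev by blast
    qed
    moreover have "E1 l0 = 0 \<or> E2 l0 = 0 \<or> G l0 = 0"
    proof (rule ccontr)
      assume "\<not> (E1 l0 = 0 \<or> E2 l0 = 0 \<or> G l0 = 0)"
      then have nz: "E1 l0 \<noteq> 0" "E2 l0 \<noteq> 0" "G l0 \<noteq> 0" by auto
      have "\<forall>\<^sub>F l in nhds l0. (\<exists>m. norm m = 1 \<and> multiplier l m) \<longrightarrow> Re l = 0"
      proof (rule P.spectrum_on_axis_near_generic_point[OF l0])
        show "rsquarefree (char_poly (M l0))" using nz(2) by (auto simp: E2(2) rsquarefree_roots)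
        show "dlam l0 m \<noteq> 0" if "multiplier l0 m" for m
          using nz(1) that by (auto simp: E1(2) poly_char_pol_dlam)
        have "isCont G l0" using holomorphic_on_imp_continuous_on[OF G(1)] by (simp add: continuous_on_eq_continuous_at)
        then have "(G \<longlongrightarrow> G l0) (nhds l0)"
          by (rule isCont_tendsto_nhds)
        then have "\<forall>\<^sub>F l in nhds l0. G l \<noteq> 0" using nz(3) by (rule tendsto_imp_eventually_ne)
        then show "\<forall>\<^sub>F l in nhds l0. \<forall>rs. char_poly (M l) = linear_product rs \<longrightarrow>
            length (filter (\<lambda>r. poly (reflected_poly n (\<lambda>l. char_poly (M l)) l) r = 0) rs) = N"
          by eventually_elim (use count in blast)
      qed
      then show False using not_ev by blast
    qed
    ultimately show "l0 \<in> {l \<in> K. E1 l = 0} \<union> {l \<in> K. E2 l = 0} \<union> {l \<in> K. G l = 0}" by blast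
  qed
  ultimately show ?thesis using fin1 fin2 fin3 by (meson finite_UnI finite_subset)
qed

end

theorem theorem6:
  fixes n :: nat and T :: real
    and a :: "nat \<Rightarrow> real \<Rightarrow> real"
    and V :: "complex \<Rightarrow> real \<Rightarrow> complex Matrix.mat"
    and M :: "complex \<Rightarrow> complex Matrix.mat"
  assumes "odd n"
    and "T > 0"
    and "\<And>k. k \<in> {1..n} \<Longrightarrow> smooth_real (a k)"
    and "\<And>k x. k \<in> {1..n} \<Longrightarrow> a k (x + T) = a k x"
    and "\<And>lam. principal_solution n a lam (V lam)"
    and "\<And>lam. M lam = V lam T"
  shows "finite {lam \<in> imag_axis. Phi n M lam = 0} \<and>
         finite {lam0. bifurcates_transversally (ess_spectrum n M) lam0}"
proof -
  have "\<exists>B. \<forall>x. \<bar>a k x\<bar> \<le> B" if "k \<in> {1..n}" for k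
    using assms(3,4)[OF that] assms(2) by (intro periodic_continuous_bounded smooth_real_imp_continuous) auto
  then obtain B where B: "\<And>k x. k \<in> {1..n} \<Longrightarrow> \<bar>a k x\<bar> \<le> B k" by metis
  define A where "A = (\<Sum>k\<in>{1..n}. \<bar>B k\<bar>)"
  have "\<bar>a k x\<bar> \<le> A" if k: "k \<in> {1..n}" for k x
  proof -
    have "\<bar>a k x\<bar> \<le> \<bar>B k\<bar>" using B[OF k, of x] by simp
    also have "\<dots> \<le> A" unfolding A_def using k by (intro member_le_sum) auto
    finally show ?thesis .
  qed
  then interpret periodic_problem n T a V M A
    using assms by unfold_locales (auto intro: odd_pos)
  show ?thesis by (rule finitely_many_bifurcations)
qed

end
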